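(* Let $A$ be a vertex of the Petersen graph $\mathcal{P}$. Let $\{E_i : i\in\mathbb{Z}/6\mathbb{Z}\}$ be the edges, in cyclic order, of the hexagon in $\mathcal{P}$ that is not connected to $A$ (i.e. the hexagon on the six vertices of $\mathcal{P}$ that are different from $A$ and not adjacent to $A$), so that $E_{i+3}$ is the edge opposite to $E_i$. Let $\mathrm{Pen}(A,E_i)$ be the unique pentagon in $\mathcal{P}$ containing the vertex $A$ and the edge $E_i$. Then the monodromy action of $g_A$ on the set $\mathcal{L}(X_{\mathbb{1}})$ of the $27$ lines on the Clebsch surface $X_{\mathbb{1}}$ exchanges the lines $L_{E_i}$ and $L_{\mathrm{Pen}(A,E_{i+3})}$ for each $i\in\mathbb{Z}/6\mathbb{Z}$. These twelve lines form a double-six configuration. The remaining fifteen lines are fixed by $g_A$.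
   Context: **Petersen graph.** $\mathcal{P}$ is the graph whose vertices are the ten two-element subsets of $\{1,2,3,4,5\}$, two vertices being joined by an edge iff the subsets are disjoint. It has 15 edges. A pentagon (hexagon) in $\mathcal{P}$ is a 5-cycle (6-cycle); there are 12 pentagons. For $\{a,b,c,d,e\}=\{1,2,3,4,5\}$ let $\mathrm{Pen}_{abcde}$ be the pentagon with vertices $\{a,b\},\{b,c\},\{c,d\},\{d,e\},\{e,a\}$; it depends on $(a,b,c,d,e)$ only up to cyclic rotation and reversal, and every pentagon is of this form. **Surfaces.** Let $\mathbb{P}^3_0=\{[x_1:\dots:x_5]\in\mathbb{P}^4_{\mathbb{C}} : x_1+\dots+x_5=0\}\cong\mathbb{P}^3_{\mathbb{C}}$. For $\lambda=[\lambda_1:\dots:\lambda_5]\in\mathbb{P}^4$ let $X_\lambda\subset\mathbb{P}^3_0$ be the cubic surface $\lambda_1x_1^3+\dots+\lambda_5x_5^3=0$. The Clebsch surface is $X_{\mathbb{1}}$ with $\mathbb{1}=[1:1:1:1:1]$. It is smooth and $\mathcal{L}(X_{\mathbb{1}})$ denotes its set of 27 lines. **Names of lines.** Let $e_1,\dots,e_5$ be the standard basis of $\mathbb{C}^5$, $e_{ij}=e_i-e_j$, $\beta=(1-\sqrt5)/2$, and let $\mathbb{P}(x,y)$ denote the projectivization of $\mathbb{C}x+\mathbb{C}y$. The lines on $X_{\mathbb{1}}$ are labeled by the 15 edges and 12 pentagons of $\mathcal{P}$ as follows. - For an edge $E$ joining $\{i,j\}$ and $\{k,l\}$: $L_E=\mathbb{P}(e_{ij},e_{kl})$.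 - For a pentagon $S=\mathrm{Pen}_{abcde}$: $L_S=\mathbb{P}(e_{ca}+\beta e_{ed},\; e_{eb}+\beta e_{cd})$. (This depends only on the pentagon. Equivalently, it is the projectivization of the row span of the $2\times5$ matrix whose columns in positions $a,b,c,d,e$ are respectively $(1,0)^T,(0,1)^T,(-1,-\beta)^T,(\beta,\beta)^T,(-\beta,-1)^T$.) **The loops $g_A$.** Let $A=\{i,j\}$ be a vertex of $\mathcal{P}$. For $w\in\mathbb{C}$ let $X^{ij}_w=X_\lambda$ with $\lambda_i=\lambda_j=1-3w$ and $\lambda_k=1$ for $k\notin\{i,j\}$. So $X^{ij}_0=X_{\mathbb{1}}$, and at $w_*=5/27$ the surface $X^{ij}_{w_*}$ is singular with a single ordinary double point. Fix a sufficiently small real $\epsilon>0$ and $t_0<0<2\pi<t_3$. Let $w:[t_0,t_3]\to\mathbb{C}$ be the continuous path consisting of: the straight segment from $0$ to $w_*-\epsilon$ for $t\in[t_0,0]$; then the counterclockwise circle $w(t)=w_*-\epsilon e^{it}$ for $t\in[0,2\pi]$; then the first segment traversed in reverse, from $w_*-\epsilon$ back to $0$, for $t\in[2\pi,t_3]$. All surfaces $X^{ij}_{w(t)}$ are smooth. The element $g_A=g_{ij}$ of the orbifold fundamental group $G$ of the moduli space of smooth complex cubic surfaces, based at $X_{\mathbb{1}}$, is the class of the loop $t\mapsto X^{ij}_{w(t)}$. **Monodromy action.** For a line $\ell\in\mathcal{L}(X_{\mathbb{1}})$ there is a unique continuous path of lines $\ell(t)\subset X^{ij}_{w(t)}$,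 $t\in[t_0,t_3]$, with $\ell(t_0)=\ell$. The monodromy action of $g_A$ sends $\ell$ to $\ell(t_3)\in\mathcal{L}(X_{\mathbb{1}})$. **Double-six.** Twelve lines in $\mathbb{P}^3$ form a double-six if they can be arranged into two sextuples (sides) $a_1,\dots,a_6$ and $b_1,\dots,b_6$ such that the lines within each sextuple are pairwise disjoint and $a_i$ meets $b_j$ iff $i\ne j$. *)

theory Defs
  imports "HOL-Analysis.Analysis"
begin

section \<open>The Petersen graph\<close>

text \<open>The set \<open>{1,2,3,4,5}\<close> is the five-element numeral type \<^typ>\<open>5\<close>
  (where the numerals 5 and 0 denote the same element); only its cardinality is ever used.\<close>

type_synonym vertex = "5 set"
type_synonym edge = "vertex set"

definition vertices :: "vertex set" where
  "vertices = {A. card A = 2}"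

definition adjacent :: "vertex \<Rightarrow> vertex \<Rightarrow> bool" where
  "adjacent A B \<longleftrightarrow> A \<in> vertices \<and> B \<in> vertices \<and> A \<inter> B = {}"

definition edges :: "edge set" where
  "edges = {{A, B} | A B. adjacent A B}"

text \<open>The \<open>i\<close>-th edge of the closed walk through a list of vertices; the index is read
  modulo the length of the list.\<close>

definition cyclic_edge :: "vertex list \<Rightarrow> nat \<Rightarrow> edge" where
  "cyclic_edge vs i = {vs ! (i mod length vs), vs ! (Suc i mod length vs)}"

definition is_cycle :: "nat \<Rightarrow> vertex list \<Rightarrow> bool" where
  "is_cycle n vs \<longleftrightarrow> length vs = n \<and> distinct vs \<and> set vs \<subseteq> vertices \<and>
     (\<forall>i. cyclic_edge vs i \<in> edges)"

text \<open>A cycle regarded as a subgraph is identified with its set of edges, so \<open>\<Union>S\<close> is the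
  set of vertices of the pentagon \<open>S\<close>.\<close>

definition cycle_edges :: "vertex list \<Rightarrow> edge set" where
  "cycle_edges vs = range (cyclic_edge vs)"

definition pentagons :: "edge set set" where
  "pentagons = {cycle_edges vs | vs. is_cycle 5 vs}"

text \<open>The vertices of \<open>Pen\<^sub>a\<^sub>b\<^sub>c\<^sub>d\<^sub>e\<close> are \<open>ab, bc, cd, de, ea\<close>.  Adjacent vertices of the Petersen
  graph are disjoint pairs, so going around the pentagon they occur in the order
  \<open>ab, cd, ea, bc, de\<close>.\<close>

definition Pen :: "5 \<Rightarrow> 5 \<Rightarrow> 5 \<Rightarrow> 5 \<Rightarrow> 5 \<Rightarrow> edge set" where
  "Pen a b c d e = cycle_edges [{a, b}, {c, d}, {e, a}, {b, c}, {d, e}]"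

definition Pen_through :: "vertex \<Rightarrow> edge \<Rightarrow> edge set" where
  "Pen_through A E = (THE S. S \<in> pentagons \<and> A \<in> \<Union>S \<and> E \<in> S)"


section \<open>Projective space, lines and cubic surfaces\<close>

text \<open>A point of \<open>\<P>\<^sup>4\<close> is a one-dimensional linear subspace of \<open>\<complex>\<^sup>5\<close>.\<close>

type_synonym point = "(complex ^ 5) set"

definition projectivization :: "(complex ^ 5) set \<Rightarrow> point set" where
  "projectivization V = {p. vec.subspace p \<and> vec.dim p = 1 \<and> p \<subseteq> V}"

definition P3\<^sub>0 :: "point set" where
  "P3\<^sub>0 = projectivization {x. (\<Sum>k\<in>UNIV. x $ k) = 0}"

definition pspan :: "complex ^ 5 \<Rightarrow> complex ^ 5 \<Rightarrow> point set" where
  "pspan x y = projectivization (vec.span {x, y})"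

definition frames :: "((complex ^ 5) \<times> (complex ^ 5)) set" where
  "frames = {(x, y). x \<noteq> y \<and> vec.independent {x, y}}"

definition plines :: "point set set" where
  "plines = {pspan x y | x y. (x, y) \<in> frames}"

text \<open>The standard topology on the Grassmannian of lines in \<open>\<P>\<^sup>4\<close>: the quotient topology along
  the map that takes a linearly independent pair to the line it spans.\<close>

definition line_topology :: "point set topology" where
  "line_topology = topology (\<lambda>U. U \<subseteq> plines \<and>
     openin (top_of_set frames) {f \<in> frames. pspan (fst f) (snd f) \<in> U})"

lemma openin_line_topology:
  "openin line_topology U \<longleftrightarrow> U \<subseteq> plines \<and>
     openin (top_of_set frames) {f \<in> frames. pspan (fst f) (snd f) \<in> U}"
proof -
  let ?q = "\<lambda>U. {f \<in> frames. pspan (fst f) (snd f) \<in> U}"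
  have "istopology (\<lambda>U. U \<subseteq> plines \<and> openin (top_of_set frames) (?q U))"
    unfolding istopology_def
  proof (intro conjI allI impI)
    fix S T
    assume "S \<subseteq> plines \<and> openin (top_of_set frames) (?q S)"
      and "T \<subseteq> plines \<and> openin (top_of_set frames) (?q T)"
    moreover have "?q (S \<inter> T) = ?q S \<inter> ?q T" by auto
    ultimately show "S \<inter> T \<subseteq> plines" "openin (top_of_set frames) (?q (S \<inter> T))"
      by (auto intro: openin_Int)
  next
    fix K
    assume K: "\<forall>U\<in>K. U \<subseteq> plines \<and> openin (top_of_set frames) (?q U)"
    have "?q (\<Union>K) = \<Union>(?q ` K)" by auto
    moreover have "openin (top_of_set frames) (\<Union>(?q ` K))"
      using K by (intro openin_Union) auto
    ultimately show "\<Union>K \<subseteq> plines" "openin (top_of_set frames) (?q (\<Union>K))"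
      using K by auto
  qed
  then show ?thesis
    by (simp add: line_topology_def topology_inverse')
qed

lemma topspace_line_topology: "topspace line_topology = plines"
proof -
  have "pspan (fst f) (snd f) \<in> plines" if "f \<in> frames" for f
    using that unfolding plines_def by (cases f) auto
  then have "{f \<in> frames. pspan (fst f) (snd f) \<in> plines} = frames"
    by (simp cong: conj_cong)
  then have "openin line_topology plines"
    by (simp add: openin_line_topology)
  then show ?thesis
    by (metis openin_line_topology openin_subset openin_topspace subset_antisym)
qed

lemma quotient_map_pspan:
  "quotient_map (top_of_set frames) line_topology (\<lambda>f. pspan (fst f) (snd f))"
proof -
  have "(\<lambda>f. pspan (fst f) (snd f)) ` frames = plines"
    unfolding plines_def image_def by (simp add: Bex_def) metis
  then show ?thesis
    by (simp add: quotient_map_def openin_line_topology topspace_line_topology)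
qed

definition cubic_surface :: "complex ^ 5 \<Rightarrow> point set" where
  "cubic_surface lam = {p \<in> P3\<^sub>0. \<forall>x\<in>p. (\<Sum>k\<in>UNIV. lam $ k * (x $ k) ^ 3) = 0}"

definition clebsch :: "point set" where
  "clebsch = cubic_surface (\<chi> k. 1)"

definition lines_on :: "point set \<Rightarrow> point set set" where
  "lines_on X = {l \<in> plines. l \<subseteq> X}"


section \<open>Names of the lines on the Clebsch surface\<close>

definition ediff :: "5 \<Rightarrow> 5 \<Rightarrow> complex ^ 5" where
  "ediff i j = axis i 1 - axis j 1"

definition beta :: complex where
  "beta = complex_of_real ((1 - sqrt 5) / 2)"

text \<open>The line does not depend on the choice of the elements \<open>i, j, k, l\<close> naming the edge, nor
  of those naming the pentagon, so both descriptions are well defined.\<close>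

definition L_edge :: "edge \<Rightarrow> point set" where
  "L_edge E = (THE L. \<exists>i j k l. {i, j} \<in> vertices \<and> {k, l} \<in> vertices \<and>
     E = {{i, j}, {k, l}} \<and> L = pspan (ediff i j) (ediff k l))"

definition L_pent :: "edge set \<Rightarrow> point set" where
  "L_pent S = (THE L. \<exists>a b c d e. {a, b, c, d, e} = UNIV \<and> S = Pen a b c d e \<and>
     L = pspan (ediff c a + beta *s ediff e d) (ediff e b + beta *s ediff c d))"


section \<open>Monodromy\<close>

definition continuous_line_path ::
    "(real \<Rightarrow> point set) \<Rightarrow> real \<Rightarrow> real \<Rightarrow> (real \<Rightarrow> point set) \<Rightarrow> bool" where
  "continuous_line_path X s t l \<longleftrightarrow>
     continuous_map (top_of_set {s..t}) line_topology l \<and> (\<forall>u\<in>{s..t}. l u \<in> lines_on (X u))"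

definition monodromy :: "(real \<Rightarrow> point set) \<Rightarrow> real \<Rightarrow> real \<Rightarrow> point set \<Rightarrow> point set" where
  "monodromy X s t l = (THE m. \<exists>p. continuous_line_path X s t p \<and> p s = l \<and> p t = m)"

text \<open>\<open>X\<^sup>i\<^sup>j\<^sub>w\<close> for \<open>A = {i, j}\<close>.\<close>

definition X_family :: "vertex \<Rightarrow> complex \<Rightarrow> point set" where
  "X_family A w = cubic_surface (\<chi> k. if k \<in> A then 1 - 3 * w else 1)"

definition w_star :: complex where
  "w_star = 5 / 27"

definition w_path :: "real \<Rightarrow> real \<Rightarrow> real \<Rightarrow> real \<Rightarrow> complex" where
  "w_path \<epsilon> t\<^sub>0 t\<^sub>3 t =
     (if t \<le> 0 then linepath 0 (w_star - of_real \<epsilon>) ((t - t\<^sub>0) / (0 - t\<^sub>0))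
      else if t \<le> 2 * pi then w_star - of_real \<epsilon> * exp (\<i> * of_real t)
      else linepath (w_star - of_real \<epsilon>) 0 ((t - 2 * pi) / (t\<^sub>3 - 2 * pi)))"

definition g_action :: "vertex \<Rightarrow> real \<Rightarrow> real \<Rightarrow> real \<Rightarrow> point set \<Rightarrow> point set" where
  "g_action A \<epsilon> t\<^sub>0 t\<^sub>3 = monodromy (\<lambda>t. X_family A (w_path \<epsilon> t\<^sub>0 t\<^sub>3 t)) t\<^sub>0 t\<^sub>3"


section \<open>Double-sixes\<close>

definition double_six :: "point set set \<Rightarrow> bool" where
  "double_six D \<longleftrightarrow> card D = 12 \<and> D \<subseteq> lines_on P3\<^sub>0 \<and>
     (\<exists>a b :: nat \<Rightarrow> point set. D = a ` {1..6} \<union> b ` {1..6} \<and>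
       (\<forall>i\<in>{1..6}. \<forall>j\<in>{1..6}.
          (i \<noteq> j \<longrightarrow> a i \<inter> a j = {} \<and> b i \<inter> b j = {}) \<and>
          (a i \<inter> b j \<noteq> {} \<longleftrightarrow> i \<noteq> j)))"

end

theory Submission
  imports Defs
begin

text \<open>Let \<open>A = {i, j}\<close> and let \<open>a, b, c\<close> be the other three indices.  For a vector \<open>v\<close> with
  coordinate sum zero put \<open>s = v\<^sub>i + v\<^sub>j\<close>, \<open>t = v\<^sub>i - v\<^sub>j\<close> and \<open>u\<^sub>k = s + v\<^sub>k\<close> for \<open>k = a, b, c\<close>, so that
  \<open>u\<^sub>a + u\<^sub>b + u\<^sub>c = 2 s\<close>.  In these forms the equation of the surface with parameter \<open>w\<close> is
  \<open>4 u\<^sub>a u\<^sub>b u\<^sub>c = (1 + w) s\<^sup>3 - (1 - 3 w) s t\<^sup>2 = (1 + w) s (s - r t) (s + r t)\<close>, where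
  \<open>r\<^sup>2 = (1 - 3 w) / (1 + w)\<close> (lemma \<open>family_form_factored\<close>).  A product of three linear forms equals
  another one, and the lines can be read off.  Three lines are given by \<open>s = u\<^sub>a = 0\<close>, six by \<open>u\<^sub>a = 0\<close>
  and \<open>s = \<plusminus> r t\<close>, and eighteen by \<open>u\<^sub>a = 2 (1 - y) s\<close>, \<open>u\<^sub>b = y (s - r t)\<close>, \<open>u\<^sub>c = y (s + r t)\<close>, where \<open>y\<close>
  is one of the three roots of \<open>8 y\<^sup>2 (1 - y) = 1 + w\<close> and \<open>(a, b, c)\<close> is one of the six orderings.
  There are no others (proposition \<open>lines_on_X_family\<close>).

  So the monodromy is that of \<open>r\<close> and of the three roots.  On the loop both \<open>1 - 3 w\<close> and \<open>1 + w\<close> have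
  positive real part, so \<open>r\<close> returns to its value.  The critical value of \<open>8 y\<^sup>2 (1 - y)\<close> at
  \<open>y = 2/3\<close> is \<open>32/27 = 1 + 5/27\<close>.  At \<open>w = 5/27\<close> exactly two roots collide, and going once around
  this point exchanges them.  To make this explicit, substitute \<open>w = 5/27 - 32/27 \<sigma>\<^sup>2\<close>.  The trigonometric
  solution of the cubic gives its roots as functions of \<open>\<sigma>\<close> that are continuous for \<open>\<bar>\<sigma>\<bar> < 1\<close>, the
  loop lifts to a path of \<open>\<sigma>\<close> that ends at the negative of its starting value, and \<open>\<sigma> \<mapsto> - \<sigma>\<close>
  exchanges two of the three functions (lemmas \<open>w_path_lift\<close> and \<open>root_minus\<close>).

  The definition of monodromy also needs uniqueness of the path of lines.  The space of lines is
  Hausdorff, because the Pluecker coordinates embed it, and at each time the 27 lines are all the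
  lines and are distinct.  Hence a path of lines decomposes the parameter interval into 27 disjoint
  closed sets, according to the line with which it agrees, and connectedness leaves only one of
  them (lemma \<open>monodromy_eqI\<close>).

  On the Clebsch surface \<open>w = 0\<close>, \<open>r = 1\<close>, and the roots are \<open>(1 - \<beta>)/2\<close>, \<open>1/2\<close> and \<open>\<beta>/2\<close>; the first two are
  the ones that are exchanged.  For the ordering \<open>(a, b, c)\<close> the root \<open>1/2\<close> gives the line of the edge
  \<open>{ib, jc}\<close>, which belongs to the hexagon, and the root \<open>(1 - \<beta>)/2\<close> gives the line of the pentagon through
  \<open>A\<close> and the opposite edge \<open>{jb, ic}\<close> (lemmas \<open>L_edge_graph\<close>, \<open>L_pent_graph\<close>, \<open>Pen_through_eq\<close>).  Two distinct
  lines among these twelve meet iff they have the same root and orderings of opposite parity, or different roots and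
  different orderings of the same parity.  The sides of the double-six therefore consist of the
  even orderings with one root and the odd orderings with the other root.\<close>

section \<open>Linear algebra of projective lines\<close>

lemma span_pair: "vec.span {x, y} = {v. \<exists>a b. v = a *s x + b *s (y :: complex ^ 5)}"
proof -
  have "v \<in> vec.span {x, y} \<longleftrightarrow> (\<exists>a b. v = a *s x + b *s y)" for v
    unfolding vec.span_insert vec.span_empty by (simp add: algebra_simps)
  then show ?thesis by blast
qed

lemma frames_iff:
  "(x, y) \<in> frames \<longleftrightarrow> (\<forall>a b. a *s x + b *s y = 0 \<longrightarrow> a = 0 \<and> b = 0)" (is "_ \<longleftrightarrow> ?R")
proof
  assume "(x, y) \<in> frames"
  then have ne: "x \<noteq> y" and ind: "vec.independent {x, y}"
    by (auto simp: frames_def)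
  show ?R
  proof (intro allI impI)
    fix a b assume eq: "a *s x + b *s y = 0"
    define f where "f = (\<lambda>v. if v = x then a else b)"
    have "(\<Sum>v\<in>{x, y}. f v *s v) = 0" using ne eq by (simp add: f_def)
    moreover have "finite {x, y}" by simp
    ultimately have "\<not> (\<exists>v\<in>{x, y}. f v \<noteq> 0)"
      using ind by (simp only: vec.dependent_finite) (intro notI, erule notE, rule exI[of _ f], simp)
    then have "f x = 0 \<and> f y = 0" by simp
    then show "a = 0 \<and> b = 0" using ne by (simp add: f_def)
  qed
next
  assume R: ?R
  have ne: "x \<noteq> y"
  proof
    assume "x = y"
    then have "1 *s x + (-1) *s y = 0" by (simp add: vec_eq_iff)
    then show False using R by fastforce
  qed
  have "vec.independent {x, y}"
  proof
    assume "vec.dependent {x, y}"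
    then obtain u where u: "(\<Sum>v\<in>{x, y}. u v *s v) = 0" "\<exists>v\<in>{x, y}. u v \<noteq> 0"
      by (subst (asm) vec.dependent_finite) auto
    then have "u x *s x + u y *s y = 0" using ne by simp
    then show False using R u(2) by blast
  qed
  then show "(x, y) \<in> frames" using ne by (simp add: frames_def)
qed

text \<open>The \<open>2 \<times> 2\<close> minors of the matrix with rows \<open>x\<close> and \<open>y\<close>, that is, the Pluecker coordinates of the line
  that \<open>x\<close> and \<open>y\<close> span.\<close>

definition minor :: "complex ^ 5 \<Rightarrow> complex ^ 5 \<Rightarrow> 5 \<Rightarrow> 5 \<Rightarrow> complex" where
  "minor x y m n = x $ m * y $ n - x $ n * y $ m"

lemma minor_combination:
  "minor (a *s x + b *s y) (c *s x + d *s y) m n = (a * d - b * c) * minor x y m n"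
  by (simp add: minor_def algebra_simps)

lemma frames_iff_minor: "(x, y) \<in> frames \<longleftrightarrow> (\<exists>m n. minor x y m n \<noteq> 0)"
proof
  assume fr: "(x, y) \<in> frames"
  show "\<exists>m n. minor x y m n \<noteq> 0"
  proof (rule ccontr)
    assume "\<not> ?thesis"
    then have z: "x $ m * y $ n = x $ n * y $ m" for m n
      by (simp add: minor_def)
    have "(y $ m) *s x + (- x $ m) *s y = 0" for m
      using z[of m] by (simp add: vec_eq_iff algebra_simps)
    then have "x $ m = 0" for m
      using fr unfolding frames_iff by (metis neg_equal_0_iff_equal vector_uminus_component)
    then have "1 *s x + 0 *s y = 0" by (simp add: vec_eq_iff)
    then show False using fr unfolding frames_iff by (metis zero_neq_one)
  qed
next
  assume "\<exists>m n. minor x y m n \<noteq> 0"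
  then obtain m n where mn: "minor x y m n \<noteq> 0" by blast
  show "(x, y) \<in> frames" unfolding frames_iff
  proof (intro allI impI)
    fix a b assume "a *s x + b *s y = 0"
    then have e: "a * x $ k + b * y $ k = 0" for k
      by (metis vector_add_component vector_smult_component zero_index)
    have "a * minor x y m n = y $ n * (a * x $ m + b * y $ m) - y $ m * (a * x $ n + b * y $ n)"
      and "b * minor x y m n = x $ m * (a * x $ n + b * y $ n) - x $ n * (a * x $ m + b * y $ m)"
      by (simp_all add: minor_def algebra_simps)
    then have "a * minor x y m n = 0" "b * minor x y m n = 0"
      by (simp_all only: e mult_zero_right diff_zero)
    then show "a = 0 \<and> b = 0" using mn by simp
  qed
qed

lemma span_single_in_projectivization:
  assumes "vec.subspace V" "v \<in> V" "v \<noteq> 0"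
  shows "vec.span {v} \<in> projectivization V"
proof -
  have "vec.dim (vec.span {v}) = 1"
    using assms(3) vec.dim_eq_card_independent[of "{v}"]
    by (simp add: vec.dim_span vec.independent_insert)
  moreover have "vec.span {v} \<subseteq> V" using assms by (intro vec.span_minimal) auto
  ultimately show ?thesis
    by (simp add: projectivization_def vec.subspace_span)
qed

lemma point_eq_span_single:
  assumes "p \<in> projectivization V"
  obtains v where "v \<in> V" "v \<noteq> 0" "p = vec.span {v}"
proof -
  have p: "vec.subspace p" "vec.dim p = 1" "p \<subseteq> V"
    using assms by (auto simp: projectivization_def)
  obtain B where B: "B \<subseteq> p" "vec.independent B" "p \<subseteq> vec.span B" "card B = vec.dim p"
    using vec.basis_exists[of p] by metis
  then obtain v where v: "B = {v}" using p(2) by (metis card_1_singletonE)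
  have "p = vec.span {v}" using B v p(1) vec.span_minimal by blast
  moreover have "v \<noteq> 0" using B v vec.dependent_zero by blast
  moreover have "v \<in> V" using B v p by auto
  ultimately show ?thesis using that by blast
qed

lemma projectivization_subset_iff:
  assumes "vec.subspace V" "vec.subspace W"
  shows "projectivization V \<subseteq> projectivization W \<longleftrightarrow> V \<subseteq> W"
proof
  assume sub: "projectivization V \<subseteq> projectivization W"
  show "V \<subseteq> W"
  proof
    fix v assume v: "v \<in> V"
    show "v \<in> W"
    proof (cases "v = 0")
      case True then show ?thesis using assms(2) by (simp add: vec.subspace_0)
    next
      case False
      then have "vec.span {v} \<in> projectivization W"
        using span_single_in_projectivization[OF assms(1) v] sub by blast
      then show ?thesis
        using vec.span_base[of v "{v}"] by (auto simp: projectivization_def)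
    qed
  qed
qed (auto simp: projectivization_def)

lemma projectivization_inj:
  assumes "vec.subspace V" "vec.subspace W"
  shows "projectivization V = projectivization W \<longleftrightarrow> V = W"
  using projectivization_subset_iff[OF assms] projectivization_subset_iff[OF assms(2,1)] by blast

lemma projectivization_disjoint_iff:
  assumes "vec.subspace V" "vec.subspace W"
  shows "projectivization V \<inter> projectivization W = {} \<longleftrightarrow> V \<inter> W \<subseteq> {0}"
proof -
  have "projectivization V \<inter> projectivization W = projectivization (V \<inter> W)"
    by (auto simp: projectivization_def)
  moreover have "vec.subspace (V \<inter> W)" using assms by (rule vec.subspace_inter)
  ultimately show ?thesis
    using span_single_in_projectivization[of "V \<inter> W"] point_eq_span_single[of _ "V \<inter> W"]
    by (metis (no_types, lifting) empty_iff equals0I insert_iff subset_iff)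
qed

lemma pspan_in_plines: "(x, y) \<in> frames \<Longrightarrow> pspan x y \<in> plines"
  by (auto simp: plines_def)

lemma pspan_eq_projectivization:
  assumes "\<And>v. v \<in> V \<longleftrightarrow> (\<exists>a b. v = a *s x + b *s y)"
  shows "pspan x y = projectivization V"
proof -
  have "vec.span {x, y} = V" using assms by (auto simp: span_pair)
  then show ?thesis by (simp add: pspan_def)
qed


section \<open>Separation and unique lifting of paths of lines\<close>

text \<open>The Pluecker coordinates \<open>p\<close> of a line are determined only up to a common factor.  The products
  \<open>p\<^sub>m\<^sub>n cnj p\<^sub>k\<^sub>l\<close> divided by the squared norm of \<open>p\<close> depend on the line alone, are continuous, and
  still determine \<open>p\<close> up to a factor.\<close>

definition pluecker :: "(complex ^ 5) \<times> (complex ^ 5) \<Rightarrow> complex ^ 5 ^ 5 ^ 5 ^ 5" where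
  "pluecker f = (\<chi> m n k l. minor (fst f) (snd f) m n * cnj (minor (fst f) (snd f) k l) /
      of_real (\<Sum>i\<in>UNIV. \<Sum>j\<in>UNIV. (cmod (minor (fst f) (snd f) i j))\<^sup>2))"

lemma minor_norm_pos:
  assumes "(x, y) \<in> frames"
  shows "(\<Sum>i\<in>UNIV. \<Sum>j\<in>UNIV. (cmod (minor x y i j))\<^sup>2) > 0"
proof -
  obtain m n where mn: "minor x y m n \<noteq> 0" using assms frames_iff_minor by blast
  have "0 < (cmod (minor x y m n))\<^sup>2" using mn by simp
  also have "\<dots> \<le> (\<Sum>j\<in>UNIV. (cmod (minor x y m j))\<^sup>2)"
    by (rule member_le_sum) auto
  also have "\<dots> \<le> (\<Sum>i\<in>UNIV. \<Sum>j\<in>UNIV. (cmod (minor x y i j))\<^sup>2)"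
    by (rule member_le_sum[where f = "\<lambda>i. \<Sum>j\<in>UNIV. (cmod (minor x y i j))\<^sup>2"]) (auto intro: sum_nonneg)
  finally show ?thesis .
qed

lemma pspan_eqD:
  assumes "pspan x y = pspan x' y'"
  obtains a b c d where "x' = a *s x + b *s y" "y' = c *s x + d *s y"
proof -
  have "vec.span {x, y} = vec.span {x', y'}"
    using assms projectivization_inj[OF vec.subspace_span vec.subspace_span]
    unfolding pspan_def by blast
  then have "x' \<in> vec.span {x, y}" "y' \<in> vec.span {x, y}"
    by (auto intro: vec.span_base)
  then show ?thesis using that unfolding span_pair by blast
qed

lemma pluecker_pspan:
  assumes fr: "(x', y') \<in> frames" and eq: "pspan x y = pspan x' y'"
  shows "pluecker (x, y) = pluecker (x', y')"
proof -
  obtain a b c d where ab: "x' = a *s x + b *s y" and cd: "y' = c *s x + d *s y"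
    using pspan_eqD[OF eq] .
  define D where "D = a * d - b * c"
  have m: "minor x' y' m n = D * minor x y m n" for m n
    by (simp add: ab cd minor_combination D_def)
  have D: "D \<noteq> 0" using fr m frames_iff_minor by fastforce
  have N: "(\<Sum>i\<in>UNIV. \<Sum>j\<in>UNIV. (cmod (minor x' y' i j))\<^sup>2)
      = (cmod D)\<^sup>2 * (\<Sum>i\<in>UNIV. \<Sum>j\<in>UNIV. (cmod (minor x y i j))\<^sup>2)"
    by (simp add: m norm_mult power_mult_distrib sum_distrib_left)
  have DD: "of_real ((cmod D)\<^sup>2) = D * cnj D" by (rule complex_norm_square)
  have "cnj D \<noteq> 0" using D by simp
  then show ?thesis using D
    unfolding pluecker_def fst_conv snd_conv N of_real_mult DD
    by (simp add: vec_eq_iff m mult.assoc mult.left_commute)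
qed

lemma pluecker_inj:
  assumes fr: "(x, y) \<in> frames" and fr': "(x', y') \<in> frames"
    and eq: "pluecker (x, y) = pluecker (x', y')"
  shows "pspan x y = pspan x' y'"
proof -
  \<comment> \<open>The span is cut out by the linear equations that the Pluecker coordinates define.\<close>
  have span_iff: "v \<in> vec.span {x, y} \<longleftrightarrow>
      (\<forall>i j k. v $ i * minor x y j k - v $ j * minor x y i k + v $ k * minor x y i j = 0)"
    if fr: "(x, y) \<in> frames" for x y v
  proof
    assume "v \<in> vec.span {x, y}"
    then obtain a b where "v = a *s x + b *s y" unfolding span_pair by blast
    then show "\<forall>i j k. v $ i * minor x y j k - v $ j * minor x y i k + v $ k * minor x y i j = 0"
      by (simp add: minor_def algebra_simps)
  next
    assume eq: "\<forall>i j k. v $ i * minor x y j k - v $ j * minor x y i k + v $ k * minor x y i j = 0"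
    obtain m n where mn: "minor x y m n \<noteq> 0" using fr frames_iff_minor by blast
    have "v = (minor v y m n / minor x y m n) *s x + (minor x v m n / minor x y m n) *s y"
    proof (rule vec_eq_iff[THEN iffD2], rule allI)
      fix k
      have "v $ k * minor x y m n = minor v y m n * x $ k + minor x v m n * y $ k"
        using eq[rule_format, of m n k] by (simp add: minor_def algebra_simps)
      then show "v $ k = ((minor v y m n / minor x y m n) *s x + (minor x v m n / minor x y m n) *s y) $ k"
        using mn by (simp add: field_simps)
    qed
    then show "v \<in> vec.span {x, y}" unfolding span_pair by blast
  qed
  obtain k l where kl: "minor x y k l \<noteq> 0" using fr frames_iff_minor by blast
  define S where "S = complex_of_real (\<Sum>i\<in>UNIV. \<Sum>j\<in>UNIV. (cmod (minor x y i j))\<^sup>2)"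
  define S' where "S' = complex_of_real (\<Sum>i\<in>UNIV. \<Sum>j\<in>UNIV. (cmod (minor x' y' i j))\<^sup>2)"
  have S: "S \<noteq> 0" "S' \<noteq> 0"
    unfolding S_def S'_def using minor_norm_pos[OF fr] minor_norm_pos[OF fr']
    by (metis less_irrefl of_real_eq_0_iff)+
  have comp: "minor x y m n * cnj (minor x y k l) / S = minor x' y' m n * cnj (minor x' y' k l) / S'" for m n
    using arg_cong[OF eq, of "\<lambda>P. P $ m $ n $ k $ l"]
    by (simp add: pluecker_def S_def S'_def)
  have "minor x' y' k l \<noteq> 0" using comp[of k l] kl S by auto
  \<comment> \<open>The factor by which the two sets of Pluecker coordinates differ, read off from the
    column of a nonvanishing coordinate.\<close>
  define \<mu> where "\<mu> = (cnj (minor x' y' k l) / S') / (cnj (minor x y k l) / S)"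
  have \<mu>: "\<mu> \<noteq> 0" using S kl \<open>minor x' y' k l \<noteq> 0\<close> by (simp add: \<mu>_def)
  have m: "minor x y m n = \<mu> * minor x' y' m n" for m n
    using comp[of m n] S kl by (simp add: \<mu>_def field_simps)
  have "v \<in> vec.span {x, y} \<longleftrightarrow> v \<in> vec.span {x', y'}" for v
  proof -
    have "v $ i * minor x y j k - v $ j * minor x y i k + v $ k * minor x y i j
      = \<mu> * (v $ i * minor x' y' j k - v $ j * minor x' y' i k + v $ k * minor x' y' i j)" for i j k
      by (simp add: m algebra_simps)
    then show ?thesis unfolding span_iff[OF fr] span_iff[OF fr'] using \<mu> by simp
  qed
  then have "vec.span {x, y} = vec.span {x', y'}" by blast
  then show ?thesis by (simp add: pspan_def)
qed

text \<open>The Pluecker matrix descends along the quotient map that defines the topology, and the induced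
  map is injective and continuous into a Hausdorff space.\<close>

lemma Hausdorff_line_topology: "Hausdorff_space line_topology"
proof -
  have cont: "continuous_map (top_of_set frames) euclidean pluecker"
  proof -
    have "continuous_on frames pluecker"
      unfolding pluecker_def minor_def
      using minor_norm_pos[unfolded minor_def]
      by (intro continuous_on_vec_lambda continuous_intros ballI) (fastforce simp del: of_real_sum)+
    then show ?thesis by simp
  qed
  have "\<exists>P. continuous_map line_topology euclidean P \<and>
      (\<forall>f\<in>frames. P (pspan (fst f) (snd f)) = pluecker f)"
  proof (rule quotient_map_lift_exists[OF quotient_map_pspan cont])
    show "pluecker f = pluecker g"
      if "f \<in> topspace (top_of_set frames)" "g \<in> topspace (top_of_set frames)"
        "pspan (fst f) (snd f) = pspan (fst g) (snd g)" for f g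
      using that pluecker_pspan[of "fst g" "snd g" "fst f" "snd f"] by simp
  next
    fix P assume "continuous_map line_topology euclidean P"
      and "\<And>f. f \<in> topspace (top_of_set frames) \<Longrightarrow> P (pspan (fst f) (snd f)) = pluecker f"
    then show ?thesis by (intro exI[of _ P]) simp
  qed
  then obtain P where P: "continuous_map line_topology euclidean P"
    and Pp: "\<forall>f\<in>frames. P (pspan (fst f) (snd f)) = pluecker f"
    by (elim exE conjE)
  have "inj_on P (topspace line_topology)"
  proof (rule inj_onI)
    fix l l' assume l: "l \<in> topspace line_topology" and l': "l' \<in> topspace line_topology"
      and e: "P l = P l'"
    obtain x y where "l = pspan x y" "(x, y) \<in> frames"
      using l by (auto simp: topspace_line_topology plines_def)
    moreover obtain x' y' where "l' = pspan x' y'" "(x', y') \<in> frames"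
      using l' by (auto simp: topspace_line_topology plines_def)
    ultimately
    show "l = l'" using bspec[OF Pp, of "(x, y)"] bspec[OF Pp, of "(x', y')"] e
        pluecker_inj[of x y x' y'] by simp
  qed
  then show ?thesis
    by (rule Hausdorff_space_injective_preimage[OF Hausdorff_space_euclidean P])
qed

lemma continuous_pspan:
  assumes "continuous_on T f" "continuous_on T g" "\<And>u. u \<in> T \<Longrightarrow> (f u, g u) \<in> frames"
  shows "continuous_map (top_of_set T) line_topology (\<lambda>u. pspan (f u) (g u))"
proof -
  have "continuous_on T (\<lambda>u. (f u, g u))" using assms by (intro continuous_on_Pair)
  then have "continuous_map (top_of_set T) (top_of_set frames) (\<lambda>u. (f u, g u))"
    using assms(3) by (auto simp: continuous_map_in_subtopology)
  then have "continuous_map (top_of_set T) line_topology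
      ((\<lambda>f. pspan (fst f) (snd f)) \<circ> (\<lambda>u. (f u, g u)))"
    using quotient_imp_continuous_map[OF quotient_map_pspan] continuous_map_compose by blast
  then show ?thesis by (simp add: o_def)
qed

text \<open>Unique path lifting for a family in which the lines at each time are listed without repetition
  by finitely many continuous paths.  The times at which a given path of lines agrees with the
  \<open>i\<close>-th path of the list form a closed set.  These sets are disjoint and cover the interval, so by
  connectedness the one that contains the starting time is everything.\<close>

lemma monodromy_eqI:
  fixes P :: "'i \<Rightarrow> real \<Rightarrow> point set"
  assumes "s \<le> t" and fin: "finite I"
    and path: "\<And>i. i \<in> I \<Longrightarrow> continuous_line_path X s t (P i)"
    and complete: "\<And>u l. u \<in> {s..t} \<Longrightarrow> l \<in> lines_on (X u) \<Longrightarrow> \<exists>i\<in>I. l = P i u"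
    and distinct: "\<And>u i j. u \<in> {s..t} \<Longrightarrow> i \<in> I \<Longrightarrow> j \<in> I \<Longrightarrow> P i u = P j u \<Longrightarrow> i = j"
    and i: "i \<in> I"
  shows "monodromy X s t (P i s) = P i t"
proof -
  have uniq: "p t = P i t" if p: "continuous_line_path X s t p" and ps: "p s = P i s" for p
  proof -
    let ?T = "top_of_set {s..t}"
    define C where "C = (\<lambda>j. {u \<in> {s..t}. p u = P j u})"
    have closed: "closedin ?T (C j)" if "j \<in> I" for j
      using closedin_continuous_maps_eq[OF Hausdorff_line_topology, of ?T p "P j"] p path[OF that]
      by (simp add: continuous_line_path_def C_def)
    have "closedin ?T (\<Union>j\<in>I - {i}. C j)"
      using closed fin by (intro closedin_Union) auto
    moreover have "{s..t} \<subseteq> C i \<union> (\<Union>j\<in>I - {i}. C j)"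
      using complete p by (fastforce simp: C_def continuous_line_path_def)
    moreover have "C i \<inter> (\<Union>j\<in>I - {i}. C j) = {}"
      using distinct i by (auto simp: C_def)
    moreover have "s \<in> C i" using ps assms(1) by (simp add: C_def)
    moreover have "connected_space ?T"
      by (simp add: connected_space_subtopology connectedin_iff_connected)
    ultimately have "(\<Union>j\<in>I - {i}. C j) = {}"
      using closed[OF i] unfolding connected_space_closedin by (metis empty_iff topspace_euclidean_subtopology)
    then have "t \<in> C i"
      using \<open>{s..t} \<subseteq> C i \<union> (\<Union>j\<in>I - {i}. C j)\<close> assms(1) by auto
    then show ?thesis by (simp add: C_def)
  qed
  show ?thesis unfolding monodromy_def
  proof (rule the_equality)
    show "\<exists>p. continuous_line_path X s t p \<and> p s = P i s \<and> p t = P i t"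
      using path[OF i] by blast
  qed (use uniq in blast)
qed


section \<open>Coordinates\<close>

lemma UNIV_5:
  assumes "distinct [i, j, a, b, c :: 5]"
  shows "UNIV = {i, j, a, b, c}"
proof -
  have "card {i, j, a, b, c} = CARD(5)" using assms by simp
  then show ?thesis
    by (metis card_subset_eq finite_class.finite_UNIV subset_UNIV)
qed

lemma sum_5:
  assumes "distinct [i, j, a, b, c :: 5]"
  shows "(\<Sum>k\<in>UNIV. f k) = f i + f j + f a + f b + (f c :: 'a :: comm_monoid_add)"
  using assms unfolding UNIV_5[OF assms] by (simp add: add.assoc)

text \<open>The indices outside \<open>{i, j}\<close> play symmetric roles: a labelling of the five coordinates may start
  with \<open>i\<close>, \<open>j\<close> followed by any one or two of them.\<close>

lemma extend_labelling_1:
  assumes "distinct [i, j, a, b, c :: 5]" "m \<notin> {i, j}"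
  shows "\<exists>n k. distinct [i, j, m, n, k]"
proof -
  have "m \<in> {a, b, c}" using assms(2) UNIV_5[OF assms(1)] by blast
  then show ?thesis using assms(1) by fastforce
qed

lemma extend_labelling_2:
  assumes "distinct [i, j, a, b, c :: 5]" "m \<notin> {i, j}" "n \<notin> {i, j}" "m \<noteq> n"
  shows "\<exists>k. distinct [i, j, m, n, k]"
proof -
  have "m \<in> {a, b, c}" "n \<in> {a, b, c}" using assms(2,3) UNIV_5[OF assms(1)] by blast+
  then show ?thesis using assms(1,4) by fastforce
qed

lemma vec_eq_iff_5:
  assumes "distinct [i, j, a, b, c :: 5]"
  shows "v = w \<longleftrightarrow> v $ i = w $ i \<and> v $ j = w $ j \<and> v $ a = w $ a \<and> v $ b = w $ b \<and> v $ c = w $ c"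
proof -
  have "(\<forall>k. P k) \<longleftrightarrow> P i \<and> P j \<and> P a \<and> P b \<and> P c" for P
    using UNIV_5[OF assms] by (metis (full_types) UNIV_I empty_iff insert_iff)
  then show ?thesis by (simp add: vec_eq_iff)
qed

definition coord :: "5 \<Rightarrow> 5 \<Rightarrow> 5 \<Rightarrow> 5 \<Rightarrow> 5 \<Rightarrow> complex \<Rightarrow> complex \<Rightarrow> complex \<Rightarrow> complex \<Rightarrow> complex \<Rightarrow> complex ^ 5" where
  "coord i j a b c u v x y z =
     (\<chi> k. if k = i then u else if k = j then v else if k = a then x else if k = b then y else z)"

lemma coord_nth:
  assumes "distinct [i, j, a, b, c]"
  shows "coord i j a b c u v x y z $ i = u" "coord i j a b c u v x y z $ j = v"
    "coord i j a b c u v x y z $ a = x" "coord i j a b c u v x y z $ b = y"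
    "coord i j a b c u v x y z $ c = z"
  using assms by (auto simp: coord_def)

lemma two_dim_subset_eq:
  assumes fr: "(x, y) \<in> frames" and fr': "(x', y') \<in> frames"
    and "x \<in> vec.span {x', y'}" "y \<in> vec.span {x', y'}"
  shows "vec.span {x, y} = vec.span {x', y'}"
proof -
  have ind: "x \<noteq> y" "vec.independent {x, y}" using fr by (auto simp: frames_def)
  have "vec.dim (vec.span {x', y'}) \<le> card {x', y'}"
    by (metis vec.dim_le_card finite.emptyI finite.insertI order_refl vec.dim_span)
  also have "\<dots> = card {x, y}" using ind fr' by (simp add: frames_def)
  finally have "vec.span {x', y'} \<subseteq> vec.span {x, y}"
    using vec.card_ge_dim_independent[of "{x, y}" "vec.span {x', y'}"] ind assms by simp
  moreover have "vec.span {x, y} \<subseteq> vec.span {x', y'}"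
    using assms by (intro vec.span_minimal vec.subspace_span) auto
  ultimately show ?thesis by blast
qed


section \<open>The 27 lines of the family\<close>

text \<open>Names for the 27 lines of a member of the family, uniform in the parameter.  \<open>Edge a\<close> is the line
  \<open>s = u\<^sub>a = 0\<close>.  \<open>Side p q a\<close> is a line with \<open>u\<^sub>a = 0\<close>, where the order of \<open>{p, q} = {i, j}\<close> encodes the sign in
  \<open>s = \<plusminus> r t\<close>.  \<open>Graph a b k\<close> belongs to the ordering that starts with \<open>a, b\<close> and to the \<open>k\<close>-th root; on
  this line \<open>s\<close> and \<open>t\<close> are coordinates and the line is a graph over them.  The equations are written
  with \<open>v\<^sub>k = u\<^sub>k - s\<close>, and the vanishing of the coordinate sum takes the place of an equation for the
  remaining index.\<close>

datatype label = Edge 5 | Side 5 5 5 | Graph 5 5 nat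

fun label_space :: "5 \<Rightarrow> 5 \<Rightarrow> complex \<Rightarrow> (nat \<Rightarrow> complex) \<Rightarrow> label \<Rightarrow> (complex ^ 5) set" where
  "label_space i j r Y (Edge a) = {v. (\<Sum>k\<in>UNIV. v $ k) = 0 \<and> v $ i + v $ j = 0 \<and> v $ a = 0}"
| "label_space i j r Y (Side p q a) = {v. (\<Sum>k\<in>UNIV. v $ k) = 0 \<and>
     v $ a = - (v $ p + v $ q) \<and> v $ p + v $ q = r * (v $ p - v $ q)}"
| "label_space i j r Y (Graph a b k) = {v. (\<Sum>m\<in>UNIV. v $ m) = 0 \<and>
     v $ a = (1 - 2 * Y k) * (v $ i + v $ j) \<and>
     v $ b = (Y k - 1) * (v $ i + v $ j) - Y k * r * (v $ i - v $ j)}"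

definition labels :: "5 \<Rightarrow> 5 \<Rightarrow> label set" where
  "labels i j = {Edge a | a. a \<notin> {i, j}}
     \<union> {Side p q a | p q a. (p, q) \<in> {(i, j), (j, i)} \<and> a \<notin> {i, j}}
     \<union> {Graph a b k | a b k. a \<noteq> b \<and> a \<notin> {i, j} \<and> b \<notin> {i, j} \<and> k < 3}"

lemma labels_cases:
  assumes "l \<in> labels i j"
  obtains (1) a where "l = Edge a" "a \<notin> {i, j}"
    | (2) p q a where "l = Side p q a" "(p, q) \<in> {(i, j), (j, i)}" "a \<notin> {i, j}"
    | (3) a b k where "l = Graph a b k" "a \<notin> {i, j}" "b \<notin> {i, j}" "a \<noteq> b" "k < 3"
  using assms unfolding labels_def by blast

definition label_line :: "5 \<Rightarrow> 5 \<Rightarrow> complex \<Rightarrow> (nat \<Rightarrow> complex) \<Rightarrow> label \<Rightarrow> point set" where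
  "label_line i j r Y l = projectivization (label_space i j r Y l)"

lemma edge_frame:
  assumes d: "distinct [i, j, a, b, c]"
  shows "(coord i j a b c 1 (-1) 0 0 0, coord i j a b c 0 0 0 1 (-1)) \<in> frames"
    and "label_space i j r Y (Edge a) = vec.span {coord i j a b c 1 (-1) 0 0 0, coord i j a b c 0 0 0 1 (-1)}"
proof -
  let ?x = "coord i j a b c 1 (-1) 0 0 0" and ?y = "coord i j a b c 0 0 0 1 (-1)"
  have "minor ?x ?y i b \<noteq> 0" by (simp add: minor_def coord_nth[OF d])
  then show "(?x, ?y) \<in> frames" using frames_iff_minor by blast
  have "v \<in> label_space i j r Y (Edge a) \<longleftrightarrow> (\<exists>\<alpha> \<beta>. v = \<alpha> *s ?x + \<beta> *s ?y)" for v
  proof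
    assume "v \<in> label_space i j r Y (Edge a)"
    then have "(\<Sum>k\<in>UNIV. v $ k) = 0" "v $ i + v $ j = 0" and a: "v $ a = 0"
      by simp_all
    then have "v $ i + v $ j + v $ a + v $ b + v $ c = 0" "v $ i + v $ j = 0" "v $ a = 0"
      by (simp_all only: sum_5[OF d])
    then have "v $ j = - v $ i" "v $ c = - v $ b" by algebra+
    then have "v = v $ i *s ?x + v $ b *s ?y"
      unfolding vec_eq_iff_5[OF d] by (simp add: coord_nth[OF d] a)
    then show "\<exists>\<alpha> \<beta>. v = \<alpha> *s ?x + \<beta> *s ?y" by blast
  qed (auto simp: sum_5[OF d] coord_nth[OF d])
  then show "label_space i j r Y (Edge a) = vec.span {?x, ?y}" by (auto simp: span_pair)
qed

lemma side_frame:
  assumes d: "distinct [p, q, a, b, c]"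
  shows "(coord p q a b c ((r + 1) / 2) ((r - 1) / 2) (- r) 0 0, coord p q a b c 0 0 0 1 (-1)) \<in> frames"
    and "label_space i j r Y (Side p q a) =
      vec.span {coord p q a b c ((r + 1) / 2) ((r - 1) / 2) (- r) 0 0, coord p q a b c 0 0 0 1 (-1)}"
proof -
  let ?x = "coord p q a b c ((r + 1) / 2) ((r - 1) / 2) (- r) 0 0" and ?y = "coord p q a b c 0 0 0 1 (-1)"
  have "minor ?x ?y p b \<noteq> 0 \<or> minor ?x ?y q b \<noteq> 0"
    by (auto simp: minor_def coord_nth[OF d])
  then show "(?x, ?y) \<in> frames" using frames_iff_minor by blast
  have "v \<in> label_space i j r Y (Side p q a) \<longleftrightarrow> (\<exists>\<alpha> \<beta>. v = \<alpha> *s ?x + \<beta> *s ?y)" for v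
  proof
    assume "v \<in> label_space i j r Y (Side p q a)"
    then have "(\<Sum>k\<in>UNIV. v $ k) = 0"
      and "v $ a = - (v $ p + v $ q)" "v $ p + v $ q = r * (v $ p - v $ q)"
      by (simp_all only: label_space.simps mem_Collect_eq)
    then have "v $ p + v $ q + v $ a + v $ b + v $ c = 0"
      and "v $ a = - (v $ p + v $ q)" "v $ p + v $ q = r * (v $ p - v $ q)"
      by (simp_all only: sum_5[OF d])
    note e = this
    define t where "t = v $ p - v $ q"
    have "v $ p * 2 = t * (r + 1)" "v $ q * 2 = t * (r - 1)" unfolding t_def using e(3) by algebra+
    then have "v $ p = t * ((r + 1) / 2)" "v $ q = t * ((r - 1) / 2)" by simp_all
    moreover have "v $ a = - r * t" unfolding t_def using e(2,3) by algebra
    moreover have "v $ c = - v $ b" using e(1,2) by algebra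
    ultimately have "v = t *s ?x + v $ b *s ?y"
      unfolding vec_eq_iff_5[OF d] by (simp add: coord_nth[OF d])
    then show "\<exists>\<alpha> \<beta>. v = \<alpha> *s ?x + \<beta> *s ?y" by blast
  qed (auto simp: sum_5[OF d] coord_nth[OF d] field_simps)
  then show "label_space i j r Y (Side p q a) = vec.span {?x, ?y}" by (auto simp: span_pair)
qed

lemma graph_frame:
  assumes d: "distinct [i, j, a, b, c]"
  shows "(coord i j a b c (1/2) (1/2) (1 - 2 * Y k) (Y k - 1) (Y k - 1),
      coord i j a b c (1/2) (-1/2) 0 (- Y k * r) (Y k * r)) \<in> frames"
    and "label_space i j r Y (Graph a b k) =
      vec.span {coord i j a b c (1/2) (1/2) (1 - 2 * Y k) (Y k - 1) (Y k - 1),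
        coord i j a b c (1/2) (-1/2) 0 (- Y k * r) (Y k * r)}"
proof -
  let ?x = "coord i j a b c (1/2) (1/2) (1 - 2 * Y k) (Y k - 1) (Y k - 1)"
    and ?y = "coord i j a b c (1/2) (-1/2) 0 (- Y k * r) (Y k * r)"
  have "minor ?x ?y i j \<noteq> 0" by (simp add: minor_def coord_nth[OF d])
  then show "(?x, ?y) \<in> frames" using frames_iff_minor by blast
  have "v \<in> label_space i j r Y (Graph a b k) \<longleftrightarrow> (\<exists>\<alpha> \<beta>. v = \<alpha> *s ?x + \<beta> *s ?y)" for v
  proof
    assume *: "v \<in> label_space i j r Y (Graph a b k)"
    then have "v $ a = (1 - 2 * Y k) * (v $ i + v $ j)"
      "v $ b = (Y k - 1) * (v $ i + v $ j) - Y k * r * (v $ i - v $ j)"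
      by simp_all
    moreover have "v $ c = - (v $ i + v $ j + v $ a + v $ b)"
      using * by (simp add: sum_5[OF d] add_eq_0_iff)
    ultimately have "v = (v $ i + v $ j) *s ?x + (v $ i - v $ j) *s ?y"
      unfolding vec_eq_iff_5[OF d] by (simp add: coord_nth[OF d]) (simp add: field_simps)
    then show "\<exists>\<alpha> \<beta>. v = \<alpha> *s ?x + \<beta> *s ?y" by blast
  qed (auto simp: sum_5[OF d] coord_nth[OF d] field_simps)
  then show "label_space i j r Y (Graph a b k) = vec.span {?x, ?y}" by (auto simp: span_pair)
qed

text \<open>Each space is two-dimensional: the bases of the preceding lemmas are explicit and polynomial in
  \<open>r\<close> and the roots, which also gives continuity of the lines in the parameters later on.\<close>

lemma label_frame:
  assumes "distinct [i, j, a, b, c]" "l \<in> labels i j"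
  obtains x y where "(x, y) \<in> frames" "label_space i j r Y l = vec.span {x, y}"
proof -
  note ex = extend_labelling_1[OF assms(1)] and ex2 = extend_labelling_2[OF assms(1)]
  from assms(2) show ?thesis
  proof (cases rule: labels_cases)
    case (1 a')
    then show ?thesis using ex edge_frame that by metis
  next
    case (2 p q a')
    then obtain b' c' where "distinct [p, q, a', b', c']" using ex[of a'] by fastforce
    then show ?thesis using side_frame that 2 by metis
  next
    case (3 a' b' k)
    then show ?thesis using ex2 graph_frame that by metis
  qed
qed

lemma subspace_label_space:
  assumes "distinct [i, j, a, b, c]" "l \<in> labels i j"
  shows "vec.subspace (label_space i j r Y l)"
  using label_frame[OF assms] by (metis vec.subspace_span)

lemma label_line_in_plines:
  assumes "distinct [i, j, a, b, c]" "l \<in> labels i j"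
  shows "label_line i j r Y l \<in> plines"
  using label_frame[OF assms] unfolding label_line_def
  by (metis pspan_def pspan_in_plines)


section \<open>The lines on a member of the family\<close>

lemma cubic_surface_line_iff:
  assumes "vec.subspace V"
  shows "projectivization V \<subseteq> cubic_surface lam \<longleftrightarrow>
    (\<forall>v\<in>V. (\<Sum>k\<in>UNIV. v $ k) = 0 \<and> (\<Sum>k\<in>UNIV. lam $ k * (v $ k) ^ 3) = 0)"
proof
  assume sub: "projectivization V \<subseteq> cubic_surface lam"
  show "\<forall>v\<in>V. (\<Sum>k\<in>UNIV. v $ k) = 0 \<and> (\<Sum>k\<in>UNIV. lam $ k * (v $ k) ^ 3) = 0"
  proof
    fix v assume v: "v \<in> V"
    show "(\<Sum>k\<in>UNIV. v $ k) = 0 \<and> (\<Sum>k\<in>UNIV. lam $ k * (v $ k) ^ 3) = 0"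
    proof (cases "v = 0")
      case False
      have "vec.span {v} \<in> cubic_surface lam"
        using span_single_in_projectivization[OF assms v False] sub by blast
      moreover have "v \<in> vec.span {v}" by (simp add: vec.span_base)
      ultimately show ?thesis
        unfolding cubic_surface_def P3\<^sub>0_def projectivization_def by blast
    qed simp
  qed
next
  assume "\<forall>v\<in>V. (\<Sum>k\<in>UNIV. v $ k) = 0 \<and> (\<Sum>k\<in>UNIV. lam $ k * (v $ k) ^ 3) = 0"
  then show "projectivization V \<subseteq> cubic_surface lam"
    unfolding cubic_surface_def P3\<^sub>0_def projectivization_def by blast
qed

definition family_form :: "5 \<Rightarrow> 5 \<Rightarrow> complex \<Rightarrow> complex ^ 5 \<Rightarrow> complex" where
  "family_form i j w v = (\<Sum>k\<in>UNIV. (if k \<in> {i, j} then 1 - 3 * w else 1) * (v $ k) ^ 3)"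

lemma X_family_line_iff:
  assumes "vec.subspace V"
  shows "projectivization V \<subseteq> X_family {i, j} w \<longleftrightarrow>
    (\<forall>v\<in>V. (\<Sum>k\<in>UNIV. v $ k) = 0 \<and> family_form i j w v = 0)"
  unfolding X_family_def cubic_surface_line_iff[OF assms] family_form_def by simp

text \<open>The factored equation on which everything rests.  It combines
  \<open>4 (v\<^sub>i\<^sup>3 + v\<^sub>j\<^sup>3) = s (s\<^sup>2 + 3 t\<^sup>2)\<close> with the identity
  \<open>x\<^sup>3 + y\<^sup>3 + z\<^sup>3 = (x + y + z)\<^sup>3 - 3 (x + y) (y + z) (z + x)\<close> for the other three coordinates, whose sum
  is \<open>- s\<close>.\<close>

lemma family_form_factored:
  assumes d: "distinct [i, j, a, b, c]" and "(\<Sum>k\<in>UNIV. v $ k) = 0"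
  defines "s \<equiv> v $ i + v $ j"
  shows "4 * family_form i j w v =
    3 * (4 * (s + v $ a) * (s + v $ b) * (s + v $ c)
      - ((1 + w) * s ^ 3 - (1 - 3 * w) * s * (v $ i - v $ j) ^ 2))"
proof -
  have "v $ i + v $ j + v $ a + v $ b + v $ c = 0" using assms(2) by (simp only: sum_5[OF d])
  then have c: "v $ c = - (v $ i + v $ j + v $ a + v $ b)" by algebra
  have ne: "a \<notin> {i, j}" "b \<notin> {i, j}" "c \<notin> {i, j}" using d by auto
  have "family_form i j w v = (1 - 3 * w) * (v $ i) ^ 3 + (1 - 3 * w) * (v $ j) ^ 3
      + (v $ a) ^ 3 + (v $ b) ^ 3 + (v $ c) ^ 3"
    unfolding family_form_def sum_5[OF d] using ne by simp
  then show ?thesis unfolding c s_def by algebra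
qed

lemma label_space_on_family:
  assumes d: "distinct [i, j, a, b, c]" and l: "l \<in> labels i j"
    and r: "r ^ 2 * (1 + w) = 1 - 3 * w"
    and Y: "\<And>k. k < 3 \<Longrightarrow> 8 * (Y k) ^ 2 * (1 - Y k) = 1 + w"
    and v: "v \<in> label_space i j r Y l"
  shows "(\<Sum>k\<in>UNIV. v $ k) = 0 \<and> family_form i j w v = 0"
proof -
  note ex = extend_labelling_1[OF d] and ex2 = extend_labelling_2[OF d]
  have sum: "(\<Sum>k\<in>UNIV. v $ k) = 0" using v by (cases l) auto
  have "family_form i j w v = 0"
  proof -
    from l show ?thesis
    proof (cases rule: labels_cases)
      case (1 a')
      then obtain b' c' where d': "distinct [i, j, a', b', c']" using ex by blast
      have "4 * family_form i j w v = 0"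
        unfolding family_form_factored[OF d' sum] using v 1 by simp
      then show ?thesis by simp
    next
      case (2 p q a')
      then obtain b' c' where d': "distinct [i, j, a', b', c']" using ex by blast
      have e: "v $ a' = - (v $ i + v $ j)" "(v $ i + v $ j) ^ 2 = r ^ 2 * (v $ i - v $ j) ^ 2"
        using v 2 by (auto simp: power_mult_distrib power2_commute add.commute)
      have "(1 + w) * (v $ i + v $ j) ^ 3 - (1 - 3 * w) * (v $ i + v $ j) * (v $ i - v $ j) ^ 2 = 0"
        using e(2) r by algebra
      then have "4 * family_form i j w v = 0"
        unfolding family_form_factored[OF d' sum] e(1) by simp
      then show ?thesis by simp
    next
      case (3 a' b' k)
      then obtain c' where d': "distinct [i, j, a', b', c']" using ex2 by blast
      have a': "v $ a' = (1 - 2 * Y k) * (v $ i + v $ j)"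
        and b': "v $ b' = (Y k - 1) * (v $ i + v $ j) - Y k * r * (v $ i - v $ j)"
        using v 3 by simp_all
      have "v $ i + v $ j + v $ a' + v $ b' + v $ c' = 0" using sum by (simp only: sum_5[OF d'])
      then have c': "v $ c' = (Y k - 1) * (v $ i + v $ j) + Y k * r * (v $ i - v $ j)"
        using a' b' by algebra
      have "4 * family_form i j w v = 0"
        unfolding family_form_factored[OF d' sum] a' b' c'
        using Y[OF \<open>k < 3\<close>] r by algebra
      then show ?thesis by simp
    qed
  qed
  with sum show ?thesis by simp
qed

text \<open>On a line where \<open>s\<close> and \<open>t\<close> are coordinates, write \<open>u\<^sub>k = \<alpha>\<^sub>k s + \<beta>\<^sub>k t\<close>.  Comparing
  coefficients in the factored equation, evaluated at \<open>(1, 0)\<close>, \<open>(1, 1)\<close> and \<open>(1, -1)\<close>, determines all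
  coefficients from a single root of the cubic and a sign.  That one of the \<open>\<beta>\<^sub>k\<close> vanishes is the
  coefficient of \<open>t\<^sup>3\<close>.\<close>

lemma cubic_restricted_to_graph:
  fixes \<alpha>1 \<alpha>2 \<alpha>3 \<beta>1 \<beta>2 \<beta>3 w r :: complex
  assumes id: "\<And>s t. 4 * (\<alpha>1 * s + \<beta>1 * t) * (\<alpha>2 * s + \<beta>2 * t) * (\<alpha>3 * s + \<beta>3 * t)
      = (1 + w) * s ^ 3 - (1 - 3 * w) * s * t ^ 2"
    and \<alpha>: "\<alpha>1 + \<alpha>2 + \<alpha>3 = 2" and \<beta>: "\<beta>1 + \<beta>2 + \<beta>3 = 0" and \<beta>1: "\<beta>1 = 0"
    and r: "r ^ 2 * (1 + w) = 1 - 3 * w" and w: "1 - 3 * w \<noteq> 0"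
  shows "8 * \<alpha>2 ^ 2 * (1 - \<alpha>2) = 1 + w" "\<alpha>1 = 2 - 2 * \<alpha>2" "\<alpha>3 = \<alpha>2"
    "\<beta>2 = - \<alpha>2 * r \<and> \<beta>3 = \<alpha>2 * r \<or> \<beta>2 = \<alpha>2 * r \<and> \<beta>3 = - \<alpha>2 * r"
proof -
  have \<beta>3: "\<beta>3 = - \<beta>2" using \<beta> \<beta>1 by algebra
  have 0: "4 * \<alpha>1 * \<alpha>2 * \<alpha>3 = 1 + w" using id[of 1 0] by simp
  have p: "4 * \<alpha>1 * (\<alpha>2 + \<beta>2) * (\<alpha>3 - \<beta>2) = (1 + w) - (1 - 3 * w)"
    using id[of 1 1] by (simp add: \<beta>1 \<beta>3)
  have m: "4 * \<alpha>1 * (\<alpha>2 - \<beta>2) * (\<alpha>3 + \<beta>2) = (1 + w) - (1 - 3 * w)"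
    using id[of 1 "-1"] by (simp add: \<beta>1 \<beta>3)
  have q: "4 * \<alpha>1 * \<beta>2 ^ 2 = 1 - 3 * w" using 0 p m by algebra
  then have nz: "\<alpha>1 \<noteq> 0" "\<beta>2 \<noteq> 0" using w by auto
  have "8 * (\<alpha>1 * (\<beta>2 * (\<alpha>3 - \<alpha>2))) = 0" using p m by algebra
  then show \<alpha>3: "\<alpha>3 = \<alpha>2" using nz by simp
  show \<alpha>1: "\<alpha>1 = 2 - 2 * \<alpha>2"
  proof -
    have "\<alpha>1 = (\<alpha>1 + \<alpha>2 + \<alpha>3) - 2 * \<alpha>2" by (simp add: \<alpha>3)
    then show ?thesis by (simp only: \<alpha>)
  qed
  show y: "8 * \<alpha>2 ^ 2 * (1 - \<alpha>2) = 1 + w" using 0 unfolding \<alpha>1 \<alpha>3 by algebra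
  have "4 * \<alpha>1 * \<beta>2 ^ 2 = 4 * \<alpha>1 * (\<alpha>2 * r) ^ 2" using q r y unfolding \<alpha>1 by algebra
  then have "\<beta>2 ^ 2 = (\<alpha>2 * r) ^ 2" using nz(1) by simp
  then show "\<beta>2 = - \<alpha>2 * r \<and> \<beta>3 = \<alpha>2 * r \<or> \<beta>2 = \<alpha>2 * r \<and> \<beta>3 = - \<alpha>2 * r"
    unfolding power2_eq_iff \<beta>3 by auto
qed

text \<open>The basis \<open>x, z\<close> of the line is dual to the linear forms \<open>s\<close> and \<open>t\<close>, so for \<open>k = a, b, c\<close> their
  coordinates are the coefficients \<open>\<alpha>\<^sub>k - 1\<close> and \<open>\<beta>\<^sub>k\<close> of the preceding lemma.\<close>

lemma line_as_graph:
  assumes d: "distinct [i, j, a, b, c]"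
    and r: "r ^ 2 * (1 + w) = 1 - 3 * w" and w: "1 - 3 * w \<noteq> 0"
    and Y: "\<And>y. 8 * y ^ 2 * (1 - y) = 1 + w \<Longrightarrow> \<exists>k<3. y = Y k"
    and on: "\<And>v. v \<in> vec.span {x, z} \<Longrightarrow> (\<Sum>k\<in>UNIV. v $ k) = 0 \<and> family_form i j w v = 0"
    and x: "x $ i + x $ j = 1" "x $ i - x $ j = 0" and z: "z $ i + z $ j = 0" "z $ i - z $ j = 1"
  shows "\<exists>l\<in>labels i j. {x, z} \<subseteq> label_space i j r Y l"
proof -
  have memb: "p *s x + q *s z \<in> vec.span {x, z}" for p q unfolding span_pair by blast
  have xs: "x \<in> vec.span {x, z}" "z \<in> vec.span {x, z}" by (auto intro: vec.span_base)
  note sx = conjunct1[OF on[OF xs(1)]] and sz = conjunct1[OF on[OF xs(2)]]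
  have tx: "1 + x $ a + x $ b + x $ c = 0" using sx x(1) by (simp only: sum_5[OF d])
  have tz: "z $ a + z $ b + z $ c = 0" using sz z(1) by (simp only: sum_5[OF d]) simp
  have id: "4 * ((1 + x $ a) * s + z $ a * t) * ((1 + x $ b) * s + z $ b * t) * ((1 + x $ c) * s + z $ c * t)
      = (1 + w) * s ^ 3 - (1 - 3 * w) * s * t ^ 2" for s t
  proof -
    let ?v = "s *s x + t *s z"
    note o = on[OF memb[of s t]]
    have "?v $ i + ?v $ j = s * (x $ i + x $ j) + t * (z $ i + z $ j)"
      "?v $ i - ?v $ j = s * (x $ i - x $ j) + t * (z $ i - z $ j)"
      by (simp_all add: algebra_simps)
    then have sv: "?v $ i + ?v $ j = s" "?v $ i - ?v $ j = t" unfolding x z by simp_all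
    have "3 * (4 * (s + ?v $ a) * (s + ?v $ b) * (s + ?v $ c) - ((1 + w) * s ^ 3 - (1 - 3 * w) * s * t ^ 2)) = 0"
      using family_form_factored[OF d conjunct1[OF o], of w] conjunct2[OF o] unfolding sv by simp
    moreover have "s + ?v $ k = (1 + x $ k) * s + z $ k * t" for k
      by (simp add: algebra_simps)
    moreover have "3 * X = 0 \<longleftrightarrow> X = 0" for X :: complex by simp
    ultimately show ?thesis by (simp only: right_minus_eq)
  qed
  have "z $ a * z $ b * z $ c = 0" using id[of 0 1] by simp
  then have cases: "z $ a = 0 \<or> z $ b = 0 \<or> z $ c = 0" by simp
  have main: "\<exists>l\<in>labels i j. {x, z} \<subseteq> label_space i j r Y l"
    if d': "distinct [i, j, a', b', c']" and za: "z $ a' = 0"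
      and id': "\<And>s t. 4 * ((1 + x $ a') * s + z $ a' * t) * ((1 + x $ b') * s + z $ b' * t) * ((1 + x $ c') * s + z $ c' * t)
      = (1 + w) * s ^ 3 - (1 - 3 * w) * s * t ^ 2"
      and sum': "1 + x $ a' + x $ b' + x $ c' = 0" "z $ a' + z $ b' + z $ c' = 0" for a' b' c'
  proof -
    have \<alpha>: "(1 + x $ a') + (1 + x $ b') + (1 + x $ c') = 2" using sum'(1) by algebra
    note C = cubic_restricted_to_graph[OF id' \<alpha> sum'(2) za r w]
    obtain k where k: "k < 3" "1 + x $ b' = Y k" using Y[OF C(1)] by blast
    have xa: "x $ a' = 1 - 2 * Y k" "x $ b' = Y k - 1" "x $ c' = Y k - 1"
      using C(2,3) k(2) by (simp_all add: algebra_simps)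
    from C(4) show ?thesis
    proof
      assume zb: "z $ b' = - (1 + x $ b') * r \<and> z $ c' = (1 + x $ b') * r"
      have "Graph a' b' k \<in> labels i j" using d' k by (auto simp: labels_def)
      moreover have "{x, z} \<subseteq> label_space i j r Y (Graph a' b' k)"
        using zb za xa sx sz x z k by simp
      ultimately show ?thesis by blast
    next
      assume zb: "z $ b' = (1 + x $ b') * r \<and> z $ c' = - (1 + x $ b') * r"
      have "Graph a' c' k \<in> labels i j" using d' k by (auto simp: labels_def)
      moreover have "{x, z} \<subseteq> label_space i j r Y (Graph a' c' k)"
        using zb za xa sx sz x z k by simp
      ultimately show ?thesis by blast
    qed
  qed
  show ?thesis
  proof (use cases in \<open>elim disjE\<close>)
    assume "z $ a = 0" then show ?thesis using main[of a b c] d id tx tz by simp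
  next
    assume zb: "z $ b = 0"
    have d': "distinct [i, j, b, a, c]" using d by auto
    show ?thesis
    proof (rule main[OF d' zb])
      show "4 * ((1 + x $ b) * s + z $ b * t) * ((1 + x $ a) * s + z $ a * t) * ((1 + x $ c) * s + z $ c * t)
        = (1 + w) * s ^ 3 - (1 - 3 * w) * s * t ^ 2" for s t
        using id[of s t] by (simp only: mult_ac)
    qed (use tx tz in \<open>simp_all only: add_ac\<close>)
  next
    assume zc: "z $ c = 0"
    have d': "distinct [i, j, c, a, b]" using d by auto
    show ?thesis
    proof (rule main[OF d' zc])
      show "4 * ((1 + x $ c) * s + z $ c * t) * ((1 + x $ a) * s + z $ a * t) * ((1 + x $ b) * s + z $ b * t)
        = (1 + w) * s ^ 3 - (1 - 3 * w) * s * t ^ 2" for s t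
        using id[of s t] by (simp only: mult_ac)
    qed (use tx tz in \<open>simp_all only: add_ac\<close>)
  qed
qed

text \<open>The case that \<open>s\<close> and \<open>t\<close> are linearly dependent on the line.  Then both vanish at some vector \<open>z\<close> of
  the line, which is a multiple of \<open>e\<^sub>b - e\<^sub>c\<close> up to the naming of indices.  Along \<open>x + \<lambda> z\<close> the left side of the
  factored equation has the leading coefficient \<open>- 4 u\<^sub>a\<close> in a rescaled \<open>\<lambda>\<close>, while the right side is
  constant.  Hence \<open>u\<^sub>a = 0\<close>, and one of the three factors on the right vanishes too.\<close>

lemma line_not_graph:
  assumes d: "distinct [i, j, a, b, c]"
    and r: "r ^ 2 * (1 + w) = 1 - 3 * w" and w: "1 + w \<noteq> 0"
    and on: "\<And>v. v \<in> vec.span {z, x} \<Longrightarrow> (\<Sum>k\<in>UNIV. v $ k) = 0 \<and> family_form i j w v = 0"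
    and z: "z \<noteq> 0" "z $ i = 0" "z $ j = 0" "z $ a = 0"
  shows "\<exists>l\<in>labels i j. {z, x} \<subseteq> label_space i j r Y l"
proof -
  have zs: "z \<in> vec.span {z, x}" "x \<in> vec.span {z, x}" by (auto intro: vec.span_base)
  note sz = conjunct1[OF on[OF zs(1)]] and sx = conjunct1[OF on[OF zs(2)]]
  have "z $ i + z $ j + z $ a + z $ b + z $ c = 0" using sz by (simp only: sum_5[OF d])
  then have zc: "z $ c = - z $ b" using z by (simp add: add_eq_0_iff)
  have zb: "z $ b \<noteq> 0" using z zc vec_eq_iff_5[OF d, of z 0] by auto
  define s where "s = x $ i + x $ j"
  define R where "R = (1 + w) * s ^ 3 - (1 - 3 * w) * s * (x $ i - x $ j) ^ 2"
  have id: "4 * (s + x $ a) * (s + x $ b + t) * (s + x $ c - t) = R" for t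
  proof -
    let ?v = "(t / z $ b) *s z + 1 *s x"
    have v: "?v \<in> vec.span {z, x}" unfolding span_pair by blast
    have e: "?v $ i = x $ i" "?v $ j = x $ j" "?v $ a = x $ a" "?v $ b = x $ b + t" "?v $ c = x $ c - t"
      using z zb by (simp_all add: zc)
    have "3 * (4 * (s + x $ a) * (s + x $ b + t) * (s + x $ c - t) - R) = 0"
      using family_form_factored[OF d conjunct1[OF on[OF v]], of w] conjunct2[OF on[OF v]]
      unfolding e s_def R_def by (simp add: algebra_simps)
    then show ?thesis by simp
  qed
  \<comment> \<open>The second difference in \<open>t\<close> isolates the quadratic coefficient.\<close>
  have "8 * (s + x $ a) = 2 * (4 * (s + x $ a) * (s + x $ b + 0) * (s + x $ c - 0))
      - 4 * (s + x $ a) * (s + x $ b + 1) * (s + x $ c - 1)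
      - 4 * (s + x $ a) * (s + x $ b + (-1)) * (s + x $ c - (-1))"
    by (simp add: algebra_simps)
  also have "\<dots> = 0" unfolding id by simp
  finally have xa: "s + x $ a = 0" unfolding mult_eq_0_iff by simp
  then have xa': "x $ a = - (x $ i + x $ j)" unfolding s_def by (simp only: eq_neg_iff_add_eq_0 add.commute)
  have "s * (1 + w) * ((s - r * (x $ i - x $ j)) * (s + r * (x $ i - x $ j))) = R"
    unfolding R_def using r by algebra
  also have "R = 0" using id[of 0] xa by simp
  finally have "s = 0 \<or> s - r * (x $ i - x $ j) = 0 \<or> s + r * (x $ i - x $ j) = 0"
    using w unfolding mult_eq_0_iff by blast
  moreover have "s + r * (x $ i - x $ j) = s - r * (x $ j - x $ i)" by (simp add: algebra_simps)
  ultimately consider "s = 0" | "s = r * (x $ i - x $ j)" | "s = r * (x $ j - x $ i)"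
    unfolding right_minus_eq by (metis right_minus_eq)
  then show ?thesis
  proof cases
    case 1
    have "Edge a \<in> labels i j" using d by (auto simp: labels_def)
    moreover have "{z, x} \<subseteq> label_space i j r Y (Edge a)" using 1 z xa sz sx by (simp add: s_def)
    ultimately show ?thesis by blast
  next
    case 2
    have "Side i j a \<in> labels i j" using d by (auto simp: labels_def)
    moreover have "z \<in> label_space i j r Y (Side i j a)" using z sz by simp
    moreover have "x $ i + x $ j = r * (x $ i - x $ j)" "x $ a = - (x $ i + x $ j)"
      using 2 xa' by (simp_all only: s_def add.commute)
    then have "x \<in> label_space i j r Y (Side i j a)"
      using sx by (simp only: label_space.simps mem_Collect_eq simp_thms)
    ultimately show ?thesis by (metis empty_subsetI insert_subset)
  next
    case 3
    have "Side j i a \<in> labels i j" using d by (auto simp: labels_def)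
    moreover have "z \<in> label_space i j r Y (Side j i a)" using z sz by simp
    moreover have "x $ j + x $ i = r * (x $ j - x $ i)" "x $ a = - (x $ j + x $ i)"
      using 3 xa' by (simp_all only: s_def add.commute)
    then have "x \<in> label_space i j r Y (Side j i a)"
      using sx by (simp only: label_space.simps mem_Collect_eq simp_thms)
    ultimately show ?thesis by (metis empty_subsetI insert_subset)
  qed
qed


lemma span_pair_change:
  assumes fr: "(x, y) \<in> frames" and "x' \<in> vec.span {x, y}" "y' \<in> vec.span {x, y}"
    and "(x', y') \<in> frames"
  shows "vec.span {x, y} = vec.span {x', y'}"
  using two_dim_subset_eq[OF assms(4) fr assms(2,3)] by simp

text \<open>Completeness: a line on the surface is one of the 27.  The determinant \<open>D\<close> of the forms \<open>s, t\<close> on a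
  basis decides which of the two preceding lemmas applies.  It is enough to place two independent
  vectors of the line in a labelled space, since both spaces are two-dimensional.\<close>

lemma line_space_label:
  assumes d: "distinct [i, j, a, b, c]"
    and r: "r ^ 2 * (1 + w) = 1 - 3 * w" and w: "1 + w \<noteq> 0" "1 - 3 * w \<noteq> 0"
    and Y: "\<And>y. 8 * y ^ 2 * (1 - y) = 1 + w \<Longrightarrow> \<exists>k<3. y = Y k"
    and fr: "(x, y) \<in> frames"
    and on: "\<And>v. v \<in> vec.span {x, y} \<Longrightarrow> (\<Sum>k\<in>UNIV. v $ k) = 0 \<and> family_form i j w v = 0"
  shows "\<exists>l\<in>labels i j. vec.span {x, y} = label_space i j r Y l"
proof -
  have conclude: ?thesis
    if fr': "(x', y') \<in> frames" and xy': "x' \<in> vec.span {x, y}" "y' \<in> vec.span {x, y}"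
      and ex: "\<exists>l\<in>labels i j. {x', y'} \<subseteq> label_space i j r Y l" for x' y'
  proof -
    obtain l where l: "l \<in> labels i j" "{x', y'} \<subseteq> label_space i j r Y l" using ex by blast
    obtain p q where pq: "(p, q) \<in> frames" "label_space i j r Y l = vec.span {p, q}"
      using label_frame[OF d l(1)] by metis
    have "vec.span {x', y'} = vec.span {p, q}"
      using l(2) pq by (intro two_dim_subset_eq[OF fr' pq(1)]) auto
    then show ?thesis using span_pair_change[OF fr xy' fr'] pq(2) l(1) by metis
  qed
  define S where "S = (\<lambda>v :: complex ^ 5. v $ i + v $ j)"
  define T where "T = (\<lambda>v :: complex ^ 5. v $ i - v $ j)"
  have lin: "S (p *s u + q *s v) = p * S u + q * S v" "T (p *s u + q *s v) = p * T u + q * T v" for p q u v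
    by (simp_all add: S_def T_def algebra_simps)
  define D where "D = S x * T y - S y * T x"
  show ?thesis
  proof (cases "D = 0")
    case False
    define x' where "x' = (T y / D) *s x + (- T x / D) *s y"
    define y' where "y' = (- S y / D) *s x + (S x / D) *s y"
    have S': "S x' = 1" "T x' = 0" "S y' = 0" "T y' = 1"
      unfolding x'_def y'_def lin using False
      by (simp_all add: divide_simps) (simp_all add: D_def algebra_simps)
    have xy': "x' \<in> vec.span {x, y}" "y' \<in> vec.span {x, y}"
      unfolding span_pair x'_def y'_def by blast+
    have fr': "(x', y') \<in> frames" unfolding frames_iff
    proof (intro allI impI)
      fix p q assume "p *s x' + q *s y' = 0"
      then show "p = 0 \<and> q = 0" using lin[of p x' q y'] by (simp add: S') (simp add: S_def T_def)
    qed
    have sp: "vec.span {x, y} = vec.span {x', y'}" by (rule span_pair_change[OF fr xy' fr'])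
    show ?thesis
    proof (rule conclude[OF fr' xy'], rule line_as_graph[OF d r w(2) Y])
      show "x' $ i + x' $ j = 1" "x' $ i - x' $ j = 0" "y' $ i + y' $ j = 0" "y' $ i - y' $ j = 1"
        using S' by (simp_all add: S_def T_def)
    qed (use on sp in auto)
  next
    case True
    \<comment> \<open>Some nonzero vector of the line has vanishing coordinates at \<open>i\<close> and \<open>j\<close>.\<close>
    have "\<exists>p q. (p \<noteq> 0 \<or> q \<noteq> 0) \<and> p * S x + q * S y = 0 \<and> p * T x + q * T y = 0" (is "\<exists>p q. ?G p q")
    proof -
      consider "S x \<noteq> 0 \<or> S y \<noteq> 0" | "T x \<noteq> 0 \<or> T y \<noteq> 0" | "S x = 0" "S y = 0" "T x = 0" "T y = 0"
        by blast
      then show ?thesis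
      proof cases
        case 1 then show ?thesis using True
          by (intro exI[of "\<lambda>p. \<exists>q. ?G p q" "- S y"] exI[of _ "S x"]) (auto simp: D_def algebra_simps)
      next
        case 2 then show ?thesis using True
          by (intro exI[of "\<lambda>p. \<exists>q. ?G p q" "- T y"] exI[of _ "T x"]) (auto simp: D_def algebra_simps)
      next
        case 3 then show ?thesis by (intro exI[of _ 1]) auto
      qed
    qed
    then obtain p q where pq: "p \<noteq> 0 \<or> q \<noteq> 0" "p * S x + q * S y = 0" "p * T x + q * T y = 0" by blast
    define z where "z = p *s x + q *s y"
    have z0: "z \<noteq> 0" using pq(1) fr unfolding frames_iff z_def by blast
    have "S z = 0" "T z = 0" unfolding z_def lin using pq by simp_all
    then have zij: "z $ i = 0" "z $ j = 0" by (simp_all add: S_def T_def)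
    have zin: "z \<in> vec.span {x, y}" unfolding span_pair z_def by blast
    obtain u where u: "u \<in> vec.span {x, y}" "(z, u) \<in> frames"
    proof (cases "q = 0")
      case True
      have "(z, y) \<in> frames" unfolding frames_iff
      proof (intro allI impI)
        fix a b assume "a *s z + b *s y = 0"
        then have "(a * p) *s x + b *s y = 0" by (simp add: z_def True)
        then show "a = 0 \<and> b = 0" using fr pq(1) True unfolding frames_iff by fastforce
      qed
      then show ?thesis using that vec.span_base[of y "{x, y}"] by blast
    next
      case False
      have "(z, x) \<in> frames" unfolding frames_iff
      proof (intro allI impI)
        fix a b assume "a *s z + b *s x = 0"
        then have "(a * p + b) *s x + (a * q) *s y = 0"
          by (simp add: z_def vec_eq_iff algebra_simps)
        then have "a * p + b = 0" "a * q = 0" using fr unfolding frames_iff by blast+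
        then show "a = 0 \<and> b = 0" using False by auto
      qed
      then show ?thesis using that vec.span_base[of x "{x, y}"] by blast
    qed
    have sp: "vec.span {x, y} = vec.span {z, u}" by (rule span_pair_change[OF fr zin u(1) u(2)])
    have on': "\<And>v. v \<in> vec.span {z, u} \<Longrightarrow> (\<Sum>k\<in>UNIV. v $ k) = 0 \<and> family_form i j w v = 0"
      using on sp by simp
    have "4 * ((z $ i + z $ j) + z $ a) * ((z $ i + z $ j) + z $ b) * ((z $ i + z $ j) + z $ c) = 0"
      using family_form_factored[OF d, of z w] on[OF zin] by (simp add: zij)
    then have "z $ a = 0 \<or> z $ b = 0 \<or> z $ c = 0" by (simp add: zij)
    then obtain a' b' c' where d': "distinct [i, j, a', b', c']" and za: "z $ a' = 0"
    proof (elim disjE)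
      assume "z $ a = 0" then show ?thesis using that[of a b c] d by simp
    next
      assume "z $ b = 0" then show ?thesis using that[of b a c] d by auto
    next
      assume "z $ c = 0" then show ?thesis using that[of c a b] d by auto
    qed
    show ?thesis
      by (rule conclude[OF u(2) zin u(1)], rule line_not_graph[OF d' r w(1) on' z0 zij za])
  qed
qed

proposition lines_on_X_family:
  assumes d: "distinct [i, j, a, b, c]"
    and r: "r ^ 2 * (1 + w) = 1 - 3 * w" and w: "1 + w \<noteq> 0" "1 - 3 * w \<noteq> 0"
    and Y: "\<And>y. 8 * y ^ 2 * (1 - y) = 1 + w \<longleftrightarrow> (\<exists>k<3. y = Y k)"
  shows "lines_on (X_family {i, j} w) = label_line i j r Y ` labels i j"
proof (intro equalityI subsetI)
  fix L assume "L \<in> lines_on (X_family {i, j} w)"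
  then obtain x y where fr: "(x, y) \<in> frames" and L: "L = pspan x y" "L \<subseteq> X_family {i, j} w"
    by (auto simp: lines_on_def plines_def)
  then have "\<forall>v\<in>vec.span {x, y}. (\<Sum>k\<in>UNIV. v $ k) = 0 \<and> family_form i j w v = 0"
    using X_family_line_iff[OF vec.subspace_span, of "{x, y}" i j w] unfolding pspan_def by blast
  then obtain l where "l \<in> labels i j" "vec.span {x, y} = label_space i j r Y l"
    using line_space_label[OF d r w _ fr, of Y] Y by blast
  then show "L \<in> label_line i j r Y ` labels i j"
    unfolding L(1) pspan_def label_line_def by auto
next
  fix L assume "L \<in> label_line i j r Y ` labels i j"
  then obtain l where l: "l \<in> labels i j" and L: "L = label_line i j r Y l" by blast
  have "8 * (Y k) ^ 2 * (1 - Y k) = 1 + w" if "k < 3" for k using Y that by blast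
  then have "L \<subseteq> X_family {i, j} w"
    unfolding L label_line_def X_family_line_iff[OF subspace_label_space[OF d l]]
    using label_space_on_family[OF d l r] by blast
  then show "L \<in> lines_on (X_family {i, j} w)"
    using label_line_in_plines[OF d l] L by (simp add: lines_on_def)
qed


text \<open>The label can be recovered from the line.  On \<open>Edge\<close> and \<open>Side\<close> lines, and only on these, there is
  a nonzero vector with \<open>v\<^sub>i = v\<^sub>j = 0\<close>, and it vanishes exactly at one further index \<open>a\<close>; the forms \<open>s\<close> and \<open>t\<close>
  then tell the kind and the sign.  On a \<open>Graph\<close> line the coefficients of \<open>s\<close> and \<open>t\<close> in the coordinates
  give the ordering and the root.\<close>

lemma label_space_inj:
  assumes d: "distinct [i, j, a, b, c]" and r: "r \<noteq> 0"
    and Y: "inj_on Y {..<3}" "\<And>k. k < 3 \<Longrightarrow> Y k \<noteq> 0"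
  shows "inj_on (label_space i j r Y) (labels i j)"
proof (rule inj_onI)
  fix l l' assume l: "l \<in> labels i j" and l': "l' \<in> labels i j"
    and eq: "label_space i j r Y l = label_space i j r Y l'"
  note ex = extend_labelling_1[OF d] and ex2 = extend_labelling_2[OF d]
  have lab: "(\<exists>a. m = Edge a \<and> a \<notin> {i, j}) \<or> (\<exists>p q a. m = Side p q a \<and> (p, q) \<in> {(i, j), (j, i)} \<and> a \<notin> {i, j})
    \<or> (\<exists>a b k. m = Graph a b k \<and> a \<notin> {i, j} \<and> b \<notin> {i, j} \<and> a \<noteq> b \<and> k < 3)" if "m \<in> labels i j" for m
    using that unfolding labels_def by blast
  \<comment> \<open>A line of the first two kinds contains a vector supported on two of the last three coordinates.\<close>
  have vertex: "\<exists>v. v \<in> label_space i j r Y m \<and> v $ i = 0 \<and> v $ j = 0 \<and> (\<forall>k. k \<notin> {i, j} \<longrightarrow> (v $ k = 0 \<longleftrightarrow> k = a'))"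
    if m: "m = Edge a' \<or> (\<exists>p q. m = Side p q a' \<and> (p, q) \<in> {(i, j), (j, i)})" and a': "a' \<notin> {i, j}" for m a'
  proof -
    obtain b' c' where d': "distinct [i, j, a', b', c']" using ex[OF a'] by blast
    have "k \<in> {i, j, a', b', c'}" for k using UNIV_5[OF d'] by blast
    then have "\<forall>k. k \<notin> {i, j} \<longrightarrow> (coord i j a' b' c' 0 0 0 1 (-1) $ k = 0 \<longleftrightarrow> k = a')"
      using coord_nth[OF d', of 0 0 0 1 "-1"] d' by fastforce
    moreover have "coord i j a' b' c' 0 0 0 1 (-1) \<in> label_space i j r Y m"
      using m by (auto simp: sum_5[OF d'] coord_nth[OF d'])
    ultimately show ?thesis using coord_nth[OF d', of 0 0 0 1 "-1"] by blast
  qed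
  have graph_vertex: "v = 0"
    if v: "v \<in> label_space i j r Y (Graph a' b' k)" "v $ i = 0" "v $ j = 0"
      and ab: "a' \<notin> {i, j}" "b' \<notin> {i, j}" "a' \<noteq> b'"
    for v a' b' k
  proof -
    obtain c' where d': "distinct [i, j, a', b', c']" using ex2[OF ab] by blast
    have "v $ a' = 0" "v $ b' = 0" using v by simp_all
    moreover have "(\<Sum>k\<in>UNIV. v $ k) = 0" using v by simp
    ultimately show ?thesis using v unfolding vec_eq_iff_5[OF d'] by (simp add: sum_5[OF d'])
  qed
  have not_graph: "False"
    if m: "m = Edge a' \<or> (\<exists>p q. m = Side p q a' \<and> (p, q) \<in> {(i, j), (j, i)})" and a': "a' \<notin> {i, j}"
      and g: "a1 \<notin> {i, j}" "b1 \<notin> {i, j}" "a1 \<noteq> b1"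
      and e: "label_space i j r Y m = label_space i j r Y (Graph a1 b1 k)" for m a' a1 b1 k
  proof -
    obtain v where v: "v \<in> label_space i j r Y m" "v $ i = 0" "v $ j = 0"
      "\<forall>k. k \<notin> {i, j} \<longrightarrow> (v $ k = 0 \<longleftrightarrow> k = a')" using vertex[OF m a'] by blast
    then have "v = 0" using graph_vertex[OF _ _ _ g] e by blast
    then have "\<forall>k. k \<notin> {i, j} \<longrightarrow> k = a'" using v(4) by simp
    then show False using g by metis
  qed
  have same_vertex: "a' = a''"
    if m: "m = Edge a' \<or> (\<exists>p q. m = Side p q a' \<and> (p, q) \<in> {(i, j), (j, i)})" and a': "a' \<notin> {i, j}"
      and m': "m' = Edge a'' \<or> (\<exists>p q. m' = Side p q a'' \<and> (p, q) \<in> {(i, j), (j, i)})" and a'': "a'' \<notin> {i, j}"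
      and e: "label_space i j r Y m = label_space i j r Y m'" for m m' a' a''
  proof -
    obtain v where v: "v \<in> label_space i j r Y m" "v $ i = 0" "v $ j = 0"
      "\<forall>k. k \<notin> {i, j} \<longrightarrow> (v $ k = 0 \<longleftrightarrow> k = a')" using vertex[OF m a'] by blast
    then have "v \<in> label_space i j r Y m'" using e by simp
    then have "v $ a'' = 0" using m' v by auto
    then show ?thesis using v a'' by auto
  qed
  have side_vec: "\<exists>v \<in> label_space i j r Y (Side p q a'). v $ p + v $ q = r \<and> v $ p - v $ q = 1"
    if pq: "(p, q) \<in> {(i, j), (j, i)}" and a': "a' \<notin> {i, j}" for p q a'
  proof -
    obtain b' c' where "distinct [i, j, a', b', c']" using ex[OF a'] by blast
    then have d': "distinct [p, q, a', b', c']" using pq by auto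
    show ?thesis
      by (rule bexI[of _ "coord p q a' b' c' ((r + 1) / 2) ((r - 1) / 2) (- r) 0 0"])
        (auto simp: sum_5[OF d'] coord_nth[OF d'] field_simps)
  qed
  from lab[OF l] lab[OF l'] show "l = l'"
  proof (elim disjE exE conjE)
    fix a1 a2 assume *: "l = Edge a1" "a1 \<notin> {i, j}" "l' = Edge a2" "a2 \<notin> {i, j}"
    then show "l = l'" using same_vertex[of l a1 l' a2] eq by simp
  next
    fix a1 p q a2 assume *: "l = Edge a1" "a1 \<notin> {i, j}" "l' = Side p q a2" "(p, q) \<in> {(i, j), (j, i)}" "a2 \<notin> {i, j}"
    obtain v where v: "v \<in> label_space i j r Y l'" "v $ p + v $ q = r" using side_vec[OF *(4,5)] * by blast
    then have "v \<in> label_space i j r Y l" using eq by simp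
    then have "r = 0" using * v by (auto simp: add.commute)
    then show "l = l'" using r by simp
  next
    fix a1 a2 b2 k assume "l = Edge a1" "a1 \<notin> {i, j}" "l' = Graph a2 b2 k" "a2 \<notin> {i, j}" "b2 \<notin> {i, j}" "a2 \<noteq> b2"
    then show "l = l'" using not_graph[of l a1 a2 b2 k] eq by simp
  next
    fix a1 p q a2 assume *: "l' = Edge a1" "a1 \<notin> {i, j}" "l = Side p q a2" "(p, q) \<in> {(i, j), (j, i)}" "a2 \<notin> {i, j}"
    obtain v where v: "v \<in> label_space i j r Y l" "v $ p + v $ q = r" using side_vec[OF *(4,5)] * by blast
    then have "v \<in> label_space i j r Y l'" using eq by simp
    then have "r = 0" using * v by (auto simp: add.commute)
    then show "l = l'" using r by simp
  next
    fix p q a1 p' q' a2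
    assume *: "l = Side p q a1" "(p, q) \<in> {(i, j), (j, i)}" "a1 \<notin> {i, j}"
      "l' = Side p' q' a2" "(p', q') \<in> {(i, j), (j, i)}" "a2 \<notin> {i, j}"
    have a: "a1 = a2" by (rule same_vertex[OF _ *(3) _ *(6) eq]) (use * in auto)
    obtain v where v: "v \<in> label_space i j r Y l" "v $ p + v $ q = r" "v $ p - v $ q = 1"
      by (rule bexE[OF side_vec[OF *(2,3), folded *(1)]]) blast
    have "v \<in> label_space i j r Y l'" using v(1) eq by simp
    then have v': "v $ p' + v $ q' = r * (v $ p' - v $ q')" unfolding *(4) by simp
    have "(p', q') = (p, q)"
    proof (rule ccontr)
      assume "(p', q') \<noteq> (p, q)"
      then have "p' = q" "q' = p" using * by auto
      moreover have "v $ q - v $ p = -1" using v(3) by (metis minus_diff_eq)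
      ultimately have "r = r * (-1)" using v' v(2) by (simp add: add.commute)
      then show False using r by simp
    qed
    then show "l = l'" using * a by simp
  next
    fix p q a1 a2 b2 k
    assume "l = Side p q a1" "(p, q) \<in> {(i, j), (j, i)}" "a1 \<notin> {i, j}"
      "l' = Graph a2 b2 k" "a2 \<notin> {i, j}" "b2 \<notin> {i, j}" "a2 \<noteq> b2"
    then show "l = l'" using not_graph[of l a1 a2 b2 k] eq by blast
  next
    fix a1 a2 b2 k assume "l' = Edge a1" "a1 \<notin> {i, j}" "l = Graph a2 b2 k" "a2 \<notin> {i, j}" "b2 \<notin> {i, j}" "a2 \<noteq> b2"
    then show "l = l'" using not_graph[of l' a1 a2 b2 k] eq by simp
  next
    fix p q a1 a2 b2 k
    assume "l' = Side p q a1" "(p, q) \<in> {(i, j), (j, i)}" "a1 \<notin> {i, j}"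
      "l = Graph a2 b2 k" "a2 \<notin> {i, j}" "b2 \<notin> {i, j}" "a2 \<noteq> b2"
    then show "l = l'" using not_graph[of l' a1 a2 b2 k] eq by metis
  next
    fix a1 b1 k a2 b2 k'
    assume *: "l = Graph a1 b1 k" "a1 \<notin> {i, j}" "b1 \<notin> {i, j}" "a1 \<noteq> b1" "k < 3"
      "l' = Graph a2 b2 k'" "a2 \<notin> {i, j}" "b2 \<notin> {i, j}" "a2 \<noteq> b2" "k' < 3"
    obtain c1 where d': "distinct [i, j, a1, b1, c1]" using ex2 * by blast
    have cases2: "a2 \<in> {a1, b1, c1}" "b2 \<in> {a1, b1, c1}" using * UNIV_5[OF d'] by blast+
    define u where "u = coord i j a1 b1 c1 (1/2) (1/2) (1 - 2 * Y k) (Y k - 1) (Y k - 1)"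
    define v where "v = coord i j a1 b1 c1 (1/2) (-1/2) 0 (- Y k * r) (Y k * r)"
    have "u \<in> label_space i j r Y l" "v \<in> label_space i j r Y l"
      unfolding *(1) u_def v_def by (simp_all add: sum_5[OF d'] coord_nth[OF d'])
    then have uv: "u \<in> label_space i j r Y l'" "v \<in> label_space i j r Y l'" using eq by simp_all
    have nz: "Y k * r \<noteq> 0" using Y(2) r * by simp
    have "v $ a2 = 0" using uv(2) by (simp add: * v_def coord_nth[OF d'])
    then have a: "a2 = a1" using cases2(1) nz by (auto simp: v_def coord_nth[OF d'])
    have "u $ a2 = 1 - 2 * Y k'" using uv(1) by (simp add: * u_def coord_nth[OF d'])
    then have "Y k = Y k'" unfolding a by (simp add: u_def coord_nth[OF d'])
    then have k: "k = k'" using Y(1) * by (auto dest: inj_onD)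
    have "v $ b2 = - Y k * r" using uv(2) k by (simp add: * v_def coord_nth[OF d'])
    then have "b2 \<noteq> c1" using nz by (auto simp: v_def coord_nth[OF d'])
    then have "b2 = b1" using cases2(2) a *(9) by auto
    then show "l = l'" using * a k by simp
  qed
qed

lemma label_line_inj:
  assumes "distinct [i, j, a, b, c]" "r \<noteq> 0" "inj_on Y {..<3}" "\<And>k. k < 3 \<Longrightarrow> Y k \<noteq> 0"
  shows "inj_on (label_line i j r Y) (labels i j)"
proof (rule inj_onI)
  fix l l' assume l: "l \<in> labels i j" "l' \<in> labels i j" and "label_line i j r Y l = label_line i j r Y l'"
  then have "label_space i j r Y l = label_space i j r Y l'"
    using projectivization_inj subspace_label_space[OF assms(1)] unfolding label_line_def by blast
  then show "l = l'" using label_space_inj[OF assms] l by (simp add: inj_on_eq_iff)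
qed


section \<open>The roots of the cubic\<close>

text \<open>Viete's solution.  With \<open>y = (1 + 2 cos \<theta>)/3\<close> the equation \<open>8 y\<^sup>2 (1 - y) = 32/27 (1 - \<sigma>\<^sup>2)\<close> becomes
  \<open>cos (3 \<theta>) = 2 \<sigma>\<^sup>2 - 1 = cos (2 arccos \<sigma>)\<close>.  In terms of \<open>\<sigma>\<close>, a square root of a multiple of
  \<open>5/27 - w\<close>, no branch point is left at the collision \<open>\<sigma> = 0\<close>.\<close>

definition cubic_root :: "complex \<Rightarrow> nat \<Rightarrow> complex" where
  "cubic_root \<sigma> k = (1 + 2 * cos (2 / 3 * Arccos \<sigma> - of_nat k * (2 * of_real pi / 3))) / 3"

lemma cos_sin_2pi3: "cos (2 * complex_of_real pi / 3) = - 1 / 2" "sin (2 * complex_of_real pi / 3) = of_real (sqrt 3) / 2"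
proof -
  have "2 * complex_of_real pi / 3 = of_real (2 * pi / 3)" by simp
  then show "cos (2 * complex_of_real pi / 3) = - 1 / 2" "sin (2 * complex_of_real pi / 3) = of_real (sqrt 3) / 2"
    by (simp_all only: cos_of_real sin_of_real cos_120 sin_120) simp_all
qed

lemma cos_sin_4pi3: "cos (4 * complex_of_real pi / 3) = - 1 / 2" "sin (4 * complex_of_real pi / 3) = - of_real (sqrt 3) / 2"
proof -
  have *: "4 * complex_of_real pi / 3 = 2 * (2 * complex_of_real pi / 3)" by simp
  show "cos (4 * complex_of_real pi / 3) = - 1 / 2" "sin (4 * complex_of_real pi / 3) = - of_real (sqrt 3) / 2"
    unfolding * cos_double sin_double cos_sin_2pi3
    by (simp_all add: power_divide flip: of_real_power)
qed

lemma root_simps: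
  defines "C \<equiv> \<lambda>\<sigma>. cos (2 / 3 * Arccos \<sigma>)" and "S \<equiv> \<lambda>\<sigma>. sin (2 / 3 * Arccos \<sigma>)"
  shows "cubic_root \<sigma> 0 = (1 + 2 * C \<sigma>) / 3"
    "cubic_root \<sigma> 1 = (1 - C \<sigma> + of_real (sqrt 3) * S \<sigma>) / 3"
    "cubic_root \<sigma> 2 = (1 - C \<sigma> - of_real (sqrt 3) * S \<sigma>) / 3"
  unfolding cubic_root_def C_def S_def
  by (simp_all add: cos_diff cos_sin_2pi3 cos_sin_4pi3) (simp_all add: field_simps)?

lemma root_vieta:
  shows "cubic_root \<sigma> 0 + cubic_root \<sigma> 1 + cubic_root \<sigma> 2 = 1"
    "cubic_root \<sigma> 0 * cubic_root \<sigma> 1 + cubic_root \<sigma> 0 * cubic_root \<sigma> 2 + cubic_root \<sigma> 1 * cubic_root \<sigma> 2 = 0"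
    "cubic_root \<sigma> 0 * cubic_root \<sigma> 1 * cubic_root \<sigma> 2 = - 4 / 27 * (1 - \<sigma>\<^sup>2)"
proof -
  define \<theta> where "\<theta> = 2 / 3 * Arccos \<sigma>"
  define q where "q = complex_of_real (sqrt 3)"
  have q: "q ^ 2 = 3" by (simp add: q_def flip: of_real_power)
  have cs: "(sin \<theta>) ^ 2 = 1 - (cos \<theta>) ^ 2" by (rule sin_squared_eq)
  have "2 * \<sigma>\<^sup>2 - 1 = cos (2 * Arccos \<sigma>)" by (simp add: cos_double_cos)
  also have "2 * Arccos \<sigma> = 3 * \<theta>" by (simp add: \<theta>_def)
  also have "cos (3 * \<theta>) = 4 * cos \<theta> ^ 3 - 3 * cos \<theta>" by (rule cos_treble_cos)
  finally have s: "2 * \<sigma>\<^sup>2 - 1 = 4 * cos \<theta> ^ 3 - 3 * cos \<theta>" .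
  note rs = root_simps[of \<sigma>, folded \<theta>_def q_def]
  show "cubic_root \<sigma> 0 + cubic_root \<sigma> 1 + cubic_root \<sigma> 2 = 1" unfolding rs by (simp add: field_simps)
  have "9 * (cubic_root \<sigma> 0 * cubic_root \<sigma> 1 + cubic_root \<sigma> 0 * cubic_root \<sigma> 2 + cubic_root \<sigma> 1 * cubic_root \<sigma> 2)
    = (1 + 2 * cos \<theta>) * (2 - 2 * cos \<theta>) + ((1 - cos \<theta>) ^ 2 - q ^ 2 * (sin \<theta>) ^ 2)"
    unfolding rs by (simp add: field_simps power2_eq_square)
  also have "\<dots> = 0" unfolding q cs by algebra
  finally show "cubic_root \<sigma> 0 * cubic_root \<sigma> 1 + cubic_root \<sigma> 0 * cubic_root \<sigma> 2 + cubic_root \<sigma> 1 * cubic_root \<sigma> 2 = 0"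
    unfolding mult_eq_0_iff by simp
  have "27 * (cubic_root \<sigma> 0 * cubic_root \<sigma> 1 * cubic_root \<sigma> 2)
    = (1 + 2 * cos \<theta>) * ((1 - cos \<theta>) ^ 2 - q ^ 2 * (sin \<theta>) ^ 2)"
    unfolding rs by (simp add: field_simps power2_eq_square)
  also have "\<dots> = - 4 * (1 - \<sigma>\<^sup>2)" unfolding q cs using s by algebra
  finally show "cubic_root \<sigma> 0 * cubic_root \<sigma> 1 * cubic_root \<sigma> 2 = - 4 / 27 * (1 - \<sigma>\<^sup>2)" by (simp add: field_simps)
qed

lemma ex_less_3: "(\<exists>k<3. P k) \<longleftrightarrow> P 0 \<or> P 1 \<or> P (2 :: nat)"
  by (auto simp: numeral_3_eq_3 less_Suc_eq numeral_2_eq_2)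

lemma lessThan_3: "{..<3} = {0, 1, 2 :: nat}"
  by auto

text \<open>By Vieta's formulas the three functions are all the roots.\<close>

lemma root_iff:
  "8 * y ^ 2 * (1 - y) = 32 / 27 * (1 - \<sigma>\<^sup>2) \<longleftrightarrow> (\<exists>k<3. y = cubic_root \<sigma> k)"
proof -
  define y0 where "y0 = cubic_root \<sigma> 0"
  define y1 where "y1 = cubic_root \<sigma> 1"
  define y2 where "y2 = cubic_root \<sigma> 2"
  note v = root_vieta[of \<sigma>, folded y0_def y1_def y2_def]
  have "8 * y ^ 2 * (1 - y) - 32 / 27 * (1 - \<sigma>\<^sup>2) = 8 * y ^ 2 * ((y0 + y1 + y2) - y)
      - 8 * (y0 * y1 + y0 * y2 + y1 * y2) * y + 8 * (y0 * y1 * y2)"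
    unfolding v by (simp add: algebra_simps)
  also have "\<dots> = - 8 * ((y - y0) * (y - y1) * (y - y2))"
    by (simp add: algebra_simps power2_eq_square)
  finally have e: "8 * y ^ 2 * (1 - y) - 32 / 27 * (1 - \<sigma>\<^sup>2) = - 8 * ((y - y0) * (y - y1) * (y - y2))" .
  have "8 * y ^ 2 * (1 - y) = 32 / 27 * (1 - \<sigma>\<^sup>2) \<longleftrightarrow> 8 * y ^ 2 * (1 - y) - 32 / 27 * (1 - \<sigma>\<^sup>2) = 0"
    by (rule right_minus_eq[symmetric])
  also have "\<dots> \<longleftrightarrow> (y = y0 \<or> y = y1 \<or> y = y2)" unfolding e by simp
  finally show ?thesis unfolding ex_less_3 y0_def y1_def y2_def .
qed

text \<open>A double root \<open>y\<close> satisfies \<open>y (2 - 3 y) = 0\<close>: the two critical points \<open>0\<close> and \<open>2/3\<close> correspond to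
  \<open>\<sigma>\<^sup>2 = 1\<close> and to \<open>\<sigma> = 0\<close>.\<close>

lemma double_root:
  fixes y z \<sigma> :: complex
  assumes "y + y + z = 1" "y * y + y * z + y * z = 0" "y * y * z = - 4 / 27 * (1 - \<sigma>\<^sup>2)"
  shows "\<sigma> = 0 \<or> \<sigma>\<^sup>2 = 1"
proof -
  have z: "z = 1 - 2 * y" using assms(1) by (simp add: eq_diff_eq algebra_simps)
  have "y * (2 - 3 * y) = 0" using assms(2) unfolding z by (simp add: algebra_simps)
  then consider "y = 0" | "y = 2 / 3" by (auto simp: eq_divide_eq mult.commute)
  then show ?thesis
  proof cases
    case 1 then show ?thesis using assms(3) by simp
  next
    case 2 then show ?thesis using assms(3) unfolding z 2 by (simp add: field_simps)
  qed
qed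

lemma root_inj:
  assumes "\<sigma> \<noteq> 0" "\<sigma>\<^sup>2 \<noteq> 1"
  shows "inj_on (cubic_root \<sigma>) {..<3}"
proof -
  define y0 where "y0 = cubic_root \<sigma> 0"
  define y1 where "y1 = cubic_root \<sigma> 1"
  define y2 where "y2 = cubic_root \<sigma> 2"
  note v = root_vieta[of \<sigma>, folded y0_def y1_def y2_def]
  note no = double_root[of _ _ \<sigma>]
  have "y0 \<noteq> y1" using no[of y0 y2] v assms by (auto simp: ac_simps)
  moreover have "y0 \<noteq> y2" using no[of y0 y1] v assms by (auto simp: ac_simps)
  moreover have "y1 \<noteq> y2" using no[of y1 y0] v assms by (auto simp: ac_simps)
  ultimately show ?thesis unfolding lessThan_3 y0_def y1_def y2_def by (auto simp: inj_on_def)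
qed

lemma root_nonzero:
  assumes "\<sigma>\<^sup>2 \<noteq> 1" "k < 3"
  shows "cubic_root \<sigma> k \<noteq> 0"
proof -
  have "cubic_root \<sigma> 0 * cubic_root \<sigma> 1 * cubic_root \<sigma> 2 \<noteq> 0" unfolding root_vieta using assms(1) by simp
  moreover have "k = 0 \<or> k = 1 \<or> k = 2" using assms(2) by auto
  ultimately show ?thesis by auto
qed

lemma continuous_on_root:
  assumes "continuous_on T \<sigma>" "\<And>t. t \<in> T \<Longrightarrow> cmod (\<sigma> t) < 1"
  shows "continuous_on T (\<lambda>t. cubic_root (\<sigma> t) k)"
proof -
  have A: "continuous_on (ball 0 1) Arccos"
  proof (rule continuous_on_Arccos)
    fix z :: complex assume "z \<in> ball 0 1"
    then show "\<bar>Re z\<bar> < 1" using abs_Re_le_cmod[of z] by simp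
  qed
  have "continuous_on T (\<lambda>t. Arccos (\<sigma> t))"
    by (rule continuous_on_compose2[OF A assms(1)]) (use assms(2) in auto)
  moreover have "continuous_on UNIV (\<lambda>z :: complex. (1 + 2 * cos (2 / 3 * z - c)) / 3)" for c
    by (auto intro!: continuous_intros)
  ultimately show ?thesis unfolding cubic_root_def
    using continuous_on_compose2[of UNIV _ T "\<lambda>t. Arccos (\<sigma> t)"] by blast
qed

definition swap01 :: "nat \<Rightarrow> nat" where
  "swap01 k = (if k = 0 then 1 else if k = 1 then 0 else k)"

text \<open>The source of the monodromy: \<open>arccos (- x) = pi - arccos x\<close> replaces \<open>\<theta>\<close> by \<open>2 pi/3 - \<theta>\<close>, and since
  the cosine is even this exchanges the first two roots and fixes the third.\<close>

lemma root_minus: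
  assumes x: "\<bar>x\<bar> \<le> 1" and k: "k < 3"
  shows "cubic_root (- of_real x) k = cubic_root (of_real x) (swap01 k)"
proof -
  define \<theta> where "\<theta> = 2 / 3 * Arccos (of_real x)"
  have e: "Arccos (- of_real x) = of_real pi - Arccos (of_real x)"
    using of_real_arccos[of x] of_real_arccos[of "-x"] x arccos_minus[of x] by simp
  then have m: "2 / 3 * Arccos (- of_real x) = 2 * of_real pi / 3 - \<theta>"
    unfolding e \<theta>_def by (simp add: field_simps)
  have "k = 0 \<or> k = 1 \<or> k = 2" using k by auto
  then show ?thesis
  proof (elim disjE)
    assume "k = 0"
    then show ?thesis unfolding cubic_root_def swap01_def m \<theta>_def[symmetric]
      by (simp add: cos_diff mult.commute)
  next
    assume "k = 1"
    then show ?thesis unfolding cubic_root_def swap01_def m \<theta>_def[symmetric] by simp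
  next
    assume "k = 2"
    have "cos (2 * of_real pi / 3 - \<theta> - of_nat 2 * (2 * of_real pi / 3)) = cos (- (2 * of_real pi / 3 + \<theta>))"
      by (rule arg_cong[of _ _ cos]) simp
    also have "\<dots> = cos (\<theta> - 4 * of_real pi / 3)"
      unfolding cos_minus cos_add cos_diff cos_sin_2pi3 cos_sin_4pi3 by simp
    also have "\<dots> = cos (\<theta> - of_nat 2 * (2 * of_real pi / 3))" by simp
    finally show ?thesis unfolding cubic_root_def swap01_def m \<theta>_def[symmetric] \<open>k = 2\<close> by simp
  qed
qed

text \<open>The value of \<open>\<sigma>\<close> at the base point: \<open>5/27 - 32/27 \<sigma>\<^sup>2 = 0\<close>.\<close>

definition \<sigma>0 :: real where "\<sigma>0 = sqrt (5 / 32)"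

definition clebsch_root :: "nat \<Rightarrow> complex" where
  "clebsch_root k = (if k = 0 then (1 - beta) / 2 else if k = 1 then 1 / 2 else beta / 2)"

lemma beta_squared: "beta\<^sup>2 = beta + 1"
proof -
  have "((1 - sqrt 5) / 2)\<^sup>2 = (1 - sqrt 5) / 2 + 1" by (simp add: power2_eq_square field_simps)
  then show ?thesis unfolding beta_def by (metis of_real_1 of_real_add of_real_power)
qed

text \<open>Here the cubic factors as \<open>(2 y - 1) (4 y\<^sup>2 - 2 y - 1)\<close>.  Its roots are told apart by size: the angle
  \<open>\<alpha>\<close> lies between \<open>0\<close> and \<open>pi/3\<close>, so the first one exceeds \<open>2/3\<close> and the second one exceeds the third.\<close>

lemma root_\<sigma>0:
  assumes "k < 3"
  shows "cubic_root (of_real \<sigma>0) k = clebsch_root k"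
proof -
  define \<alpha> where "\<alpha> = 2 / 3 * arccos \<sigma>0"
  have s: "0 < \<sigma>0" "\<sigma>0 < 1" "\<sigma>0\<^sup>2 = 5 / 32" by (simp_all add: \<sigma>0_def)
  have \<alpha>: "0 < \<alpha>" "\<alpha> < pi / 3"
    using s arccos_lt_bounded[of \<sigma>0] arccos_less_arccos[of 0 \<sigma>0] by (simp_all add: \<alpha>_def arccos_0)
  have A: "2 / 3 * Arccos (of_real \<sigma>0) = of_real \<alpha>"
    using s of_real_arccos[of \<sigma>0] by (simp add: \<alpha>_def)
  define y0 where "y0 = (1 + 2 * cos \<alpha>) / 3"
  define y1 where "y1 = (1 - cos \<alpha> + sqrt 3 * sin \<alpha>) / 3"
  define y2 where "y2 = (1 - cos \<alpha> - sqrt 3 * sin \<alpha>) / 3"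
  have r: "cubic_root (of_real \<sigma>0) 0 = of_real y0" "cubic_root (of_real \<sigma>0) 1 = of_real y1" "cubic_root (of_real \<sigma>0) 2 = of_real y2"
    unfolding root_simps A y0_def y1_def y2_def by (simp_all add: cos_of_real sin_of_real)
  have "cos \<alpha> > 1 / 2" using cos_monotone_0_pi[of \<alpha> "pi / 3"] \<alpha> by (simp add: cos_60)
  then have y0: "y0 > 2 / 3" by (simp add: y0_def)
  have "sin \<alpha> > 0" using \<alpha> by (intro sin_gt_zero) auto
  then have y12: "y1 > y2" by (simp add: y1_def y2_def divide_strict_right_mono)
  have v1: "y0 + y1 + y2 = 1" and v2: "y0 * y1 + y0 * y2 + y1 * y2 = 0" and v3: "y0 * y1 * y2 = - 1 / 8"
  proof -
    note v = root_vieta[of "of_real \<sigma>0", unfolded r]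
    have "of_real (y0 + y1 + y2) = complex_of_real 1" using v(1) by simp
    then show "y0 + y1 + y2 = 1" by (simp only: of_real_eq_iff)
    have "of_real (y0 * y1 + y0 * y2 + y1 * y2) = complex_of_real 0" using v(2) by simp
    then show "y0 * y1 + y0 * y2 + y1 * y2 = 0" by (simp only: of_real_eq_iff)
    have "of_real (y0 * y1 * y2) = complex_of_real (- 4 / 27 * (1 - \<sigma>0\<^sup>2))" using v(3) by simp
    then show "y0 * y1 * y2 = - 1 / 8" unfolding s by (simp only: of_real_eq_iff) simp
  qed
  have "(y0 - 1 / 2) * (y0 - (1 + sqrt 5) / 4) * (y0 - (1 - sqrt 5) / 4) = 0"
  proof -
    have y2': "y2 = 1 - y0 - y1" using v1 by simp
    have "(y0 - 1 / 2) * (y0 - (1 + sqrt 5) / 4) * (y0 - (1 - sqrt 5) / 4) = y0 ^ 3 - y0 ^ 2 + 1 / 8"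
      by (simp add: field_simps power3_eq_cube power2_eq_square)
    also have "\<dots> = 0" using v2 v3 unfolding y2' by algebra
    finally show ?thesis .
  qed
  moreover have neg: "(1 - sqrt 5) / 4 < 0" by simp
  moreover have "y0 - 1 / 2 \<noteq> 0" using y0 by auto
  moreover have "y0 - (1 - sqrt 5) / 4 \<noteq> 0"
  proof
    assume "y0 - (1 - sqrt 5) / 4 = 0"
    then have "y0 = (1 - sqrt 5) / 4" by simp
    then show False using y0 neg by linarith
  qed
  ultimately have y0e: "y0 = (1 + sqrt 5) / 4" by simp
  have "(y1 - 1 / 2) * (y1 - (1 - sqrt 5) / 4) = 0"
  proof -
    have y2': "y2 = 1 - y0 - y1" using v1 by simp
    have "y0 * y1 + y0 * (1 - y0 - y1) + y1 * (1 - y0 - y1) = 0" using v2 unfolding y2' .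
    then show ?thesis unfolding y0e by (simp add: field_simps)
  qed
  then consider "y1 = 1 / 2" | "y1 = (1 - sqrt 5) / 4" by force
  then have "y1 = 1 / 2 \<and> y2 = (1 - sqrt 5) / 4"
  proof cases
    case 1
    have "y2 = 1 - y0 - y1" using v1 by simp
    then show ?thesis unfolding y0e 1 by (simp add: field_simps)
  next
    case 2
    have "y2 = 1 - y0 - y1" using v1 by simp
    then have "y2 = 1 / 2" unfolding y0e 2 by (simp add: field_simps)
    moreover have "(1 - sqrt 5) / 4 < 1 / 2" by (rule order.strict_trans[OF neg]) simp
    ultimately show ?thesis using y12 2 by simp
  qed
  then have y1e: "y1 = 1 / 2" and y2e: "y2 = (1 - sqrt 5) / 4" by auto
  have "k = 0 \<or> k = 1 \<or> k = 2" using assms by auto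
  then show ?thesis
  proof (elim disjE)
    assume "k = 0" then show ?thesis using r(1) unfolding y0e by (simp add: clebsch_root_def beta_def field_simps)
  next
    assume "k = 1" then show ?thesis using r(2) unfolding y1e by (simp add: clebsch_root_def)
  next
    assume "k = 2" then show ?thesis using r(3) unfolding y2e by (simp add: clebsch_root_def beta_def field_simps)
  qed
qed


section \<open>Continuation of the lines along the loop\<close>

text \<open>The path \<open>\<sigma>\<close> is a square root of \<open>27/32 (5/27 - w)\<close> along the loop: positive real on the way in, turning
  by half a circle while \<open>w\<close> makes a full circle, and hence negative real on the way back.  The bound on \<open>\<epsilon>\<close>
  keeps the real part of \<open>w\<close> below \<open>1/3\<close>, where \<open>1 - 3 w\<close> vanishes.\<close>

lemma w_path_lift:
  assumes e: "0 < \<epsilon>" "\<epsilon> < 1 / 27" and t: "t0 < 0" "2 * pi < t3"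
  obtains \<sigma> where "continuous_on {t0..t3} \<sigma>" "\<sigma> t0 = of_real \<sigma>0" "\<sigma> t3 = - of_real \<sigma>0"
    "\<And>u. u \<in> {t0..t3} \<Longrightarrow> w_path \<epsilon> t0 t3 u = 5 / 27 - 32 / 27 * (\<sigma> u)\<^sup>2"
    "\<And>u. u \<in> {t0..t3} \<Longrightarrow> cmod (\<sigma> u) < 1 \<and> \<sigma> u \<noteq> 0"
    "\<And>u. u \<in> {t0..t3} \<Longrightarrow> 0 \<le> Re (w_path \<epsilon> t0 t3 u) \<and> Re (w_path \<epsilon> t0 t3 u) < 1 / 3"
proof -
  \<comment> \<open>The value of \<open>\<sigma>\<^sup>2\<close> at the fraction \<open>x\<close> of the segment from \<open>0\<close> to \<open>w_star - \<epsilon>\<close>.\<close>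
  define R where "R = (\<lambda>x. 27 / 32 * (5 / 27 - x * (5 / 27 - \<epsilon>)))"
  define f where "f = (\<lambda>u. of_real (sqrt (R ((u - t0) / (0 - t0)))) :: complex)"
  define g where "g = (\<lambda>u. of_real (sqrt (27 / 32 * \<epsilon>)) * exp (\<i> * of_real u / 2) :: complex)"
  define h where "h = (\<lambda>u. - of_real (sqrt (R (1 - (u - 2 * pi) / (t3 - 2 * pi)))) :: complex)"
  define \<sigma> where "\<sigma> = (\<lambda>u. if u \<le> 0 then f u else if u \<le> 2 * pi then g u else h u)"
  have cont: "continuous_on UNIV f" "continuous_on UNIV g" "continuous_on UNIV h"
    using t unfolding f_def g_def h_def R_def by (auto intro!: continuous_intros)
  have R1: "R 1 = 27 / 32 * \<epsilon>" "R 0 = 5 / 32" by (simp_all add: R_def)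
  have gh: "g (2 * pi) = h (2 * pi)"
  proof -
    have "\<i> * complex_of_real (2 * pi) / 2 = of_real pi * \<i>" by simp
    then show ?thesis unfolding g_def h_def by (simp only: exp_pi_i) (simp add: R1)
  qed
  have fg: "f 0 = g 0" using t by (simp add: f_def g_def R1)
  have "continuous_on UNIV (\<lambda>u. if u \<le> 2 * pi then g u else h u)"
    by (rule continuous_on_cases_le) (auto intro: continuous_on_subset[OF cont(2)] continuous_on_subset[OF cont(3)] simp: gh)
  note gh_cont = this
  have "continuous_on UNIV \<sigma>" unfolding \<sigma>_def
    by (rule continuous_on_cases_le[OF continuous_on_subset[OF cont(1)] continuous_on_subset[OF gh_cont]])
      (auto simp: fg)
  then have "continuous_on {t0..t3} \<sigma>" by (rule continuous_on_subset) simp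
  moreover have "\<sigma> t0 = of_real \<sigma>0" using t by (simp add: \<sigma>_def f_def R1 \<sigma>0_def)
  moreover have "\<sigma> t3 = - of_real \<sigma>0"
  proof -
    have "\<not> t3 \<le> 0" "\<not> t3 \<le> 2 * pi" using t pi_gt_zero by linarith+
    then show ?thesis using t by (simp add: \<sigma>_def h_def R1 \<sigma>0_def)
  qed
  moreover have real_part: "cmod (of_real (sqrt (R x))) < 1 \<and> complex_of_real (sqrt (R x)) \<noteq> 0 \<and>
      (complex_of_real (sqrt (R x)))\<^sup>2 = of_real (R x) \<and> 0 \<le> x * (5 / 27 - \<epsilon>) \<and> x * (5 / 27 - \<epsilon>) < 1 / 3"
    if x: "0 \<le> x" "x \<le> 1" for x
  proof -
    define m where "m = x * (5 / 27 - \<epsilon>)"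
    have "m \<le> 1 * (5 / 27 - \<epsilon>)" unfolding m_def using x e by (intro mult_right_mono) auto
    moreover have "0 \<le> m" unfolding m_def using x e by (intro mult_nonneg_nonneg) auto
    moreover have "R x = 27 / 32 * (5 / 27 - m)" by (simp add: R_def m_def)
    ultimately have "0 < R x" "R x < 1" "0 \<le> m \<and> m < 1 / 3"
      using e by simp_all
    then show ?thesis by (simp add: m_def flip: of_real_power)
  qed
  moreover have "w_path \<epsilon> t0 t3 u = 5 / 27 - 32 / 27 * (\<sigma> u)\<^sup>2 \<and> cmod (\<sigma> u) < 1 \<and> \<sigma> u \<noteq> 0 \<and>
     0 \<le> Re (w_path \<epsilon> t0 t3 u) \<and> Re (w_path \<epsilon> t0 t3 u) < 1 / 3" if u: "u \<in> {t0..t3}" for u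
  proof -
    consider "u \<le> 0" | "0 < u" "u \<le> 2 * pi" | "2 * pi < u" by linarith
    then show ?thesis
    proof cases
      case 1
      define x where "x = (u - t0) / (0 - t0)"
      have x: "0 \<le> x" "x \<le> 1" using 1 u t by (simp_all add: x_def field_simps)
      have \<sigma>: "\<sigma> u = of_real (sqrt (R x))" using 1 by (simp add: \<sigma>_def f_def x_def)
      have w: "w_path \<epsilon> t0 t3 u = of_real (x * (5 / 27 - \<epsilon>))"
        unfolding w_path_def x_def[symmetric] linepath_def w_star_def
        using 1 by (simp add: scaleR_conv_of_real)
      show ?thesis unfolding \<sigma> w using real_part[OF x] by (simp add: R_def field_simps)
    next
      case 2
      have \<sigma>: "\<sigma> u = of_real (sqrt (27 / 32 * \<epsilon>)) * exp (\<i> * of_real u / 2)"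
        using 2 by (simp add: \<sigma>_def g_def)
      have "(exp (\<i> * of_real u / 2))\<^sup>2 = exp (\<i> * complex_of_real u)"
        by (simp add: power2_eq_square flip: exp_add)
      then have \<sigma>2: "(\<sigma> u)\<^sup>2 = of_real (27 / 32 * \<epsilon>) * exp (\<i> * of_real u)"
        unfolding \<sigma> power_mult_distrib using e by (simp flip: of_real_power)
      have w: "w_path \<epsilon> t0 t3 u = 5 / 27 - of_real \<epsilon> * exp (\<i> * of_real u)"
        using 2 by (simp add: w_path_def w_star_def)
      have "Re (w_path \<epsilon> t0 t3 u) = 5 / 27 - \<epsilon> * cos u" by (simp add: w Re_exp)
      moreover have "\<bar>\<epsilon> * cos u\<bar> \<le> \<epsilon>" using e by (simp add: abs_mult mult_left_le)
      ultimately have "0 \<le> Re (w_path \<epsilon> t0 t3 u) \<and> Re (w_path \<epsilon> t0 t3 u) < 1 / 3"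
        using e unfolding abs_le_iff by linarith
      moreover have "cmod (\<sigma> u) = sqrt (27 / 32 * \<epsilon>)" unfolding \<sigma> using e by (simp add: norm_mult)
      moreover have "w_path \<epsilon> t0 t3 u = 5 / 27 - 32 / 27 * (\<sigma> u)\<^sup>2" unfolding w \<sigma>2 by simp
      moreover have "sqrt (27 / 32 * \<epsilon>) < 1" "sqrt (27 / 32 * \<epsilon>) > 0" using e by simp_all
      ultimately show ?thesis by (metis norm_zero less_irrefl)
    next
      case 3
      define x where "x = 1 - (u - 2 * pi) / (t3 - 2 * pi)"
      have x: "0 \<le> x" "x \<le> 1" using 3 u t by (simp_all add: x_def field_simps)
      have n: "\<not> u \<le> 0" "\<not> u \<le> 2 * pi" using 3 pi_gt_zero by linarith+
      have \<sigma>: "\<sigma> u = - of_real (sqrt (R x))" using n by (simp add: \<sigma>_def h_def x_def)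
      have w: "w_path \<epsilon> t0 t3 u = of_real (x * (5 / 27 - \<epsilon>))"
        using n by (simp add: w_path_def w_star_def linepath_def x_def scaleR_conv_of_real)
      show ?thesis unfolding \<sigma> w using real_part[OF x] by (simp add: R_def field_simps)
    qed
  qed
  ultimately show ?thesis using that[of \<sigma>] by blast
qed

lemma continuous_on_coord:
  assumes "continuous_on T u" "continuous_on T v" "continuous_on T x" "continuous_on T y" "continuous_on T z"
  shows "continuous_on T (\<lambda>t. coord i j a b c (u t) (v t) (x t) (y t) (z t))"
proof -
  have "continuous_on T (\<lambda>t. if k = i then u t else if k = j then v t else if k = a then x t
      else if k = b then y t else z t)" for k
    using assms by (cases "k = i"; cases "k = j"; cases "k = a"; cases "k = b") simp_all
  then show ?thesis unfolding coord_def by (rule continuous_on_vec_lambda)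
qed

lemma labels_eq:
  assumes d: "distinct [i, j, a, b, c]"
  shows "labels i j = Edge ` {a, b, c} \<union> (\<lambda>((p, q), m). Side p q m) ` ({(i, j), (j, i)} \<times> {a, b, c})
    \<union> (\<lambda>((m, n), k). Graph m n k) ` ({(a, b), (a, c), (b, a), (b, c), (c, a), (c, b)} \<times> {..<3})"
proof -
  have n: "m \<notin> {i, j} \<longleftrightarrow> m \<in> {a, b, c}" for m
  proof -
    have "m \<in> {i, j, a, b, c}" using UNIV_5[OF d] by blast
    then show ?thesis using d by auto
  qed
  have "{Edge m | m. m \<notin> {i, j}} = Edge ` {a, b, c}" unfolding n by blast
  moreover have "{Side p q m | p q m. (p, q) \<in> {(i, j), (j, i)} \<and> m \<notin> {i, j}}
      = (\<lambda>((p, q), m). Side p q m) ` ({(i, j), (j, i)} \<times> {a, b, c})"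
    unfolding n by (auto simp: image_iff)
  moreover have pairs: "{(m, n'). m \<noteq> n' \<and> m \<notin> {i, j} \<and> n' \<notin> {i, j}} = {(a, b), (a, c), (b, a), (b, c), (c, a), (c, b)}"
    unfolding n using d by auto
  have "{Graph m n k | m n k. m \<noteq> n \<and> m \<notin> {i, j} \<and> n \<notin> {i, j} \<and> k < 3}
      = (\<lambda>((m, n), k). Graph m n k) ` ({(a, b), (a, c), (b, a), (b, c), (c, a), (c, b)} \<times> {..<3})"
    unfolding pairs[symmetric] by (auto simp: image_iff)
  ultimately show ?thesis unfolding labels_def by simp
qed

lemma card_labels:
  assumes d: "distinct [i, j, a, b, c]"
  shows "card (labels i j) = 27" "finite (labels i j)"
proof -
  let ?E = "Edge ` {a, b, c}" and ?S = "(\<lambda>((p, q), m). Side p q m) ` ({(i, j), (j, i)} \<times> {a, b, c})"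
    and ?G = "(\<lambda>((m, n), k). Graph m n k) ` ({(a, b), (a, c), (b, a), (b, c), (c, a), (c, b)} \<times> {..<3})"
  have "card ?E = 3" using d by (subst card_image) (auto simp: inj_on_def)
  moreover have "card ?S = 6" using d by (subst card_image) (auto simp: inj_on_def)
  moreover have "card ?G = 18" using d by (subst card_image) (auto simp: inj_on_def)
  moreover have "?E \<inter> ?S = {}" "(?E \<union> ?S) \<inter> ?G = {}" by auto
  moreover have fin: "finite ?E" "finite ?S" "finite ?G" by auto
  ultimately have "card (?E \<union> ?S) = 9" by (simp only: card_Un_disjoint)
  then have "card (?E \<union> ?S \<union> ?G) = 27"
    using \<open>card ?G = 18\<close> \<open>(?E \<union> ?S) \<inter> ?G = {}\<close> fin by (subst card_Un_disjoint) (simp_all only: finite_Un simp_thms)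
  then show "card (labels i j) = 27" "finite (labels i j)" unfolding labels_eq[OF d] using fin by simp_all
qed

lemma label_line_continuous:
  assumes d: "distinct [i, j, a, b, c]" and l: "l \<in> labels i j"
    and r: "continuous_on T r" and Y: "\<And>k. continuous_on T (\<lambda>t. Y t k)"
  shows "continuous_map (top_of_set T) line_topology (\<lambda>t. label_line i j (r t) (Y t) l)"
proof -
  note ex = extend_labelling_1[OF d] and ex2 = extend_labelling_2[OF d]
  have lift: ?thesis if "continuous_on T x" "continuous_on T y" "\<And>t. (x t, y t) \<in> frames"
    "\<And>t. label_space i j (r t) (Y t) l = vec.span {x t, y t}" for x y
    using continuous_pspan[of T x y] that unfolding label_line_def pspan_def by simp
  from l show ?thesis
  proof (cases rule: labels_cases)
    case (1 a')
    then obtain b' c' where d': "distinct [i, j, a', b', c']" using ex by blast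
    show ?thesis
      by (rule lift[OF _ _ edge_frame(1)[OF d'] edge_frame(2)[OF d', folded 1(1)]]) simp_all
  next
    case (2 p q a')
    then obtain b' c' where "distinct [i, j, a', b', c']" using ex by blast
    then have d': "distinct [p, q, a', b', c']" using 2 by auto
    show ?thesis
    proof (rule lift)
      show "(coord p q a' b' c' ((r t + 1) / 2) ((r t - 1) / 2) (- r t) 0 0, coord p q a' b' c' 0 0 0 1 (-1)) \<in> frames"
        for t by (rule side_frame(1)[OF d'])
      show "label_space i j (r t) (Y t) l =
          vec.span {coord p q a' b' c' ((r t + 1) / 2) ((r t - 1) / 2) (- r t) 0 0, coord p q a' b' c' 0 0 0 1 (-1)}"
        for t unfolding 2(1) by (rule side_frame(2)[OF d'])
    qed (auto intro!: continuous_on_coord continuous_intros r)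
  next
    case (3 a' b' k)
    then obtain c' where d': "distinct [i, j, a', b', c']" using ex2 by blast
    show ?thesis
    proof (rule lift)
      show "(coord i j a' b' c' (1/2) (1/2) (1 - 2 * Y t k) (Y t k - 1) (Y t k - 1),
          coord i j a' b' c' (1/2) (-1/2) 0 (- Y t k * r t) (Y t k * r t)) \<in> frames"
        for t by (rule graph_frame(1)[OF d'])
      show "label_space i j (r t) (Y t) l =
          vec.span {coord i j a' b' c' (1/2) (1/2) (1 - 2 * Y t k) (Y t k - 1) (Y t k - 1),
            coord i j a' b' c' (1/2) (-1/2) 0 (- Y t k * r t) (Y t k * r t)}"
        for t unfolding 3(1) by (rule graph_frame(2)[OF d'])
    qed (auto intro!: continuous_on_coord continuous_intros r Y)
  qed
qed

fun swap_label :: "label \<Rightarrow> label" where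
  "swap_label (Graph a b k) = Graph a b (swap01 k)"
| "swap_label l = l"

lemma label_line_cong:
  assumes "l \<in> labels i j" "\<And>k. k < 3 \<Longrightarrow> Y k = Y' k"
  shows "label_line i j r Y l = label_line i j r Y' l"
  using assms by (auto simp: labels_def label_line_def)

abbreviation clebsch_line :: "5 \<Rightarrow> 5 \<Rightarrow> label \<Rightarrow> point set" where
  "clebsch_line i j \<equiv> label_line i j 1 clebsch_root"

lemma lines_on_clebsch:
  assumes d: "distinct [i, j, a, b, c]"
  shows "lines_on clebsch = clebsch_line i j ` labels i j" "inj_on (clebsch_line i j) (labels i j)"
proof -
  have "\<sigma>0 \<noteq> 0" unfolding \<sigma>0_def by simp
  then have s: "complex_of_real \<sigma>0 \<noteq> 0" "(complex_of_real \<sigma>0)\<^sup>2 = 5 / 32"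
    by simp (simp add: \<sigma>0_def flip: of_real_power)
  have cr: "cubic_root (of_real \<sigma>0) k = clebsch_root k" if "k < 3" for k
    using root_\<sigma>0 that .
  have "clebsch = X_family {i, j} 0" by (simp add: clebsch_def X_family_def cong: if_cong)
  moreover have "8 * y ^ 2 * (1 - y) = 1 + 0 \<longleftrightarrow> (\<exists>k<3. y = clebsch_root k)" for y
    using root_iff[of y "of_real \<sigma>0"] cr unfolding s by (simp add: ex_less_3)
  ultimately show "lines_on clebsch = clebsch_line i j ` labels i j"
    using lines_on_X_family[OF d, of 1 0 clebsch_root] by simp
  have "inj_on (cubic_root (of_real \<sigma>0)) {..<3}" by (rule root_inj[OF s(1)]) (simp add: s)
  then have "inj_on clebsch_root {..<3}" using cr by (simp add: inj_on_def)
  moreover have "clebsch_root k \<noteq> 0" if "k < 3" for k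
    using root_nonzero[of "of_real \<sigma>0" k] cr that s by simp
  ultimately show "inj_on (clebsch_line i j) (labels i j)"
    using label_line_inj[OF d, of 1 clebsch_root] by simp
qed

text \<open>The continuation of the line with label \<open>l\<close> is the line with the same label at each time, for the
  continuous choices \<open>csqrt (1 - 3 w) / csqrt (1 + w)\<close> of \<open>r\<close> and \<open>cubic_root \<sigma>\<close> of the roots.  At the
  end \<open>r\<close> is back at \<open>1\<close>, while \<open>\<sigma>\<close> has changed its sign.\<close>

proposition g_action_clebsch_line:
  assumes d: "distinct [i, j, a, b, c]" and l: "l \<in> labels i j"
    and e: "0 < \<epsilon>" "\<epsilon> < 1 / 27" and t: "t0 < 0" "2 * pi < t3"
  shows "g_action {i, j} \<epsilon> t0 t3 (clebsch_line i j l) = clebsch_line i j (swap_label l)"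
proof -
  obtain \<sigma> where \<sigma>: "continuous_on {t0..t3} \<sigma>" "\<sigma> t0 = of_real \<sigma>0" "\<sigma> t3 = - of_real \<sigma>0"
    and w: "\<And>u. u \<in> {t0..t3} \<Longrightarrow> w_path \<epsilon> t0 t3 u = 5 / 27 - 32 / 27 * (\<sigma> u)\<^sup>2"
    and nz: "\<And>u. u \<in> {t0..t3} \<Longrightarrow> cmod (\<sigma> u) < 1 \<and> \<sigma> u \<noteq> 0"
    and Re: "\<And>u. u \<in> {t0..t3} \<Longrightarrow> 0 \<le> Re (w_path \<epsilon> t0 t3 u) \<and> Re (w_path \<epsilon> t0 t3 u) < 1 / 3"
    using w_path_lift[OF e t] by blast
  define W where "W = w_path \<epsilon> t0 t3"
  define r where "r = (\<lambda>u. csqrt (1 - 3 * W u) / csqrt (1 + W u))"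
  have t03: "t0 \<le> t3" using t pi_gt_zero by linarith
  have Wp: "0 < Re (1 - 3 * W u)" "0 < Re (1 + W u)" if "u \<in> {t0..t3}" for u
    using Re[OF that] by (simp_all add: W_def)
  then have W0: "1 - 3 * W u \<noteq> 0" "1 + W u \<noteq> 0" if "u \<in> {t0..t3}" for u
    using that by (metis less_irrefl zero_complex.sel(1))+
  have contW: "continuous_on {t0..t3} W"
    by (rule continuous_on_cong[THEN iffD1, OF refl, of _ "\<lambda>u. 5 / 27 - 32 / 27 * (\<sigma> u)\<^sup>2"])
      (auto simp: W_def w intro!: continuous_intros \<sigma>(1))
  have contr: "continuous_on {t0..t3} r"
    unfolding r_def
  proof (intro continuous_on_divide ballI)
    have csqrt: "continuous_on {z. 0 < Re z} csqrt"
      by (rule continuous_on_subset[OF continuous_on_csqrt]) (auto simp: complex_nonpos_Reals_iff)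
    show "continuous_on {t0..t3} (\<lambda>u. csqrt (1 - 3 * W u))"
      by (rule continuous_on_compose2[OF csqrt]) (auto intro!: continuous_intros contW simp: Wp[simplified])
    show "continuous_on {t0..t3} (\<lambda>u. csqrt (1 + W u))"
      by (rule continuous_on_compose2[OF csqrt]) (auto intro!: continuous_intros contW simp: Wp[simplified])
    show "csqrt (1 + W u) \<noteq> 0" if "u \<in> {t0..t3}" for u using W0[OF that] by simp
  qed
  have r2: "(r u)\<^sup>2 * (1 + W u) = 1 - 3 * W u" "r u \<noteq> 0" if "u \<in> {t0..t3}" for u
    using W0[OF that] by (simp_all add: r_def power_divide)
  have contY: "continuous_on {t0..t3} (\<lambda>u. cubic_root (\<sigma> u) k)" for k
    by (rule continuous_on_root[OF \<sigma>(1)]) (use nz in auto)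
  have sq: "(\<sigma> u)\<^sup>2 \<noteq> 1" "\<sigma> u \<noteq> 0" if "u \<in> {t0..t3}" for u
  proof -
    have "cmod ((\<sigma> u)\<^sup>2) < 1" using nz[OF that] by (simp add: norm_power power_less_one_iff)
    then show "(\<sigma> u)\<^sup>2 \<noteq> 1" by force
  qed (use nz[OF that] in simp)
  define P where "P = (\<lambda>l u. label_line i j (r u) (cubic_root (\<sigma> u)) l)"
  have lines: "lines_on (X_family {i, j} (W u)) = (\<lambda>l. P l u) ` labels i j" if u: "u \<in> {t0..t3}" for u
  proof -
    have one_plus_W: "32 / 27 * (1 - (\<sigma> u)\<^sup>2) = 1 + W u" using w[OF u] by (simp add: W_def field_simps)
    have "8 * y ^ 2 * (1 - y) = 1 + W u \<longleftrightarrow> (\<exists>k<3. y = cubic_root (\<sigma> u) k)" for y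
      by (rule root_iff[of y "\<sigma> u", unfolded one_plus_W])
    then show ?thesis
      unfolding P_def using lines_on_X_family[OF d r2(1)[OF u] W0(2,1)[OF u]] by blast
  qed
  have "monodromy (\<lambda>u. X_family {i, j} (W u)) t0 t3 (P l t0) = P l t3"
  proof (rule monodromy_eqI[where I = "labels i j"])
    show "continuous_line_path (\<lambda>u. X_family {i, j} (W u)) t0 t3 (P m)" if "m \<in> labels i j" for m
      unfolding continuous_line_path_def
      using lines that label_line_continuous[OF d that contr contY] by (auto simp: P_def)
    show "\<exists>m\<in>labels i j. L = P m u" if "u \<in> {t0..t3}" "L \<in> lines_on (X_family {i, j} (W u))" for u L
      using lines that by blast
    show "m = n" if u: "u \<in> {t0..t3}" and "m \<in> labels i j" "n \<in> labels i j" "P m u = P n u" for u m n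
      using label_line_inj[OF d r2(2)[OF u] root_inj[OF sq(2,1)[OF u]] root_nonzero[OF sq(1)[OF u]]] that
      by (auto simp: P_def dest: inj_onD)
  qed (use t03 card_labels[OF d] l in auto)
  moreover have ends: "t0 \<in> {t0..t3}" "t3 \<in> {t0..t3}" using t03 by auto
  have s: "(complex_of_real \<sigma>0)\<^sup>2 = 5 / 32" by (simp add: \<sigma>0_def flip: of_real_power)
  have "W t0 = 0" "W t3 = 0" unfolding W_def w[OF ends(1)] w[OF ends(2)] \<sigma> power2_minus s by simp_all
  then have r1: "r t0 = 1" "r t3 = 1" by (simp_all add: r_def)
  have "P l t0 = clebsch_line i j l"
    unfolding P_def r1 \<sigma> by (rule label_line_cong[OF l]) (rule root_\<sigma>0)
  moreover have "P l t3 = clebsch_line i j (swap_label l)"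
  proof -
    have "0 \<le> \<sigma>0" "\<sigma>0 \<le> 1" by (simp_all add: \<sigma>0_def)
    have *: "cubic_root (- of_real \<sigma>0) k = clebsch_root (swap01 k)" if "k < 3" for k
    proof -
      have "swap01 k < 3" using that by (simp add: swap01_def)
      then show ?thesis using root_minus[of \<sigma>0 k] root_\<sigma>0 \<open>0 \<le> \<sigma>0\<close> \<open>\<sigma>0 \<le> 1\<close> that by simp
    qed
    have "P l t3 = label_line i j 1 (\<lambda>k. clebsch_root (swap01 k)) l"
      unfolding P_def r1 \<sigma> by (rule label_line_cong[OF l]) (rule *)
    then show ?thesis by (cases l) (simp_all add: label_line_def)
  qed
  ultimately show ?thesis by (simp add: g_action_def W_def)
qed


section \<open>The names of the lines\<close>

lemma clebsch_root_vals: "clebsch_root 0 = (1 - beta) / 2" "clebsch_root 1 = 1 / 2" "clebsch_root 2 = beta / 2"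
  by (simp_all add: clebsch_root_def)

lemma pspan_ediff:
  assumes d: "distinct [i, j, k, l, m]"
  shows "pspan (ediff i j) (ediff k l) = projectivization {v. v $ i + v $ j = 0 \<and> v $ k + v $ l = 0 \<and> v $ m = 0}"
proof (rule pspan_eq_projectivization)
  fix v
  have n: "ediff i j $ i = 1" "ediff i j $ j = -1" "ediff i j $ k = 0" "ediff i j $ l = 0" "ediff i j $ m = 0"
    "ediff k l $ i = 0" "ediff k l $ j = 0" "ediff k l $ k = 1" "ediff k l $ l = -1" "ediff k l $ m = 0"
    using d by (auto simp: ediff_def axis_def)
  show "v \<in> {v. v $ i + v $ j = 0 \<and> v $ k + v $ l = 0 \<and> v $ m = 0}
      \<longleftrightarrow> (\<exists>a b. v = a *s ediff i j + b *s ediff k l)"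
  proof
    assume "v \<in> {v. v $ i + v $ j = 0 \<and> v $ k + v $ l = 0 \<and> v $ m = 0}"
    then have "v $ j = - v $ i" "v $ l = - v $ k" "v $ m = 0" by (auto simp: add_eq_0_iff)
    then have "v = v $ i *s ediff i j + v $ k *s ediff k l"
      unfolding vec_eq_iff_5[OF d] by (simp add: n)
    then show "\<exists>a b. v = a *s ediff i j + b *s ediff k l" by blast
  qed (auto simp: n)
qed

lemma L_edge_eq:
  assumes d: "distinct [i, j, k, l, m]"
  shows "L_edge {{i, j}, {k, l}} = pspan (ediff i j) (ediff k l)"
  unfolding L_edge_def
proof (rule the_equality)
  show "\<exists>i' j' k' l'. {i', j'} \<in> vertices \<and> {k', l'} \<in> vertices \<and>
    {{i, j}, {k, l}} = {{i', j'}, {k', l'}} \<and> pspan (ediff i j) (ediff k l) = pspan (ediff i' j') (ediff k' l')"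
    using d by (simp add: vertices_def) (metis card_2_iff)
next
  fix L
  assume "\<exists>i' j' k' l'. {i', j'} \<in> vertices \<and> {k', l'} \<in> vertices \<and>
    {{i, j}, {k, l}} = {{i', j'}, {k', l'}} \<and> L = pspan (ediff i' j') (ediff k' l')"
  then obtain i' j' k' l' where e: "{{i, j}, {k, l}} = {{i', j'}, {k', l'}}"
    and L: "L = pspan (ediff i' j') (ediff k' l')" by blast
  from e have "{i, j} = {i', j'} \<and> {k, l} = {k', l'} \<or> {i, j} = {k', l'} \<and> {k, l} = {i', j'}"
    by (simp add: doubleton_eq_iff)
  then have c: "((i', j') \<in> {(i, j), (j, i)} \<and> (k', l') \<in> {(k, l), (l, k)}) \<or>
      ((i', j') \<in> {(k, l), (l, k)} \<and> (k', l') \<in> {(i, j), (j, i)})"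
    by (auto simp: doubleton_eq_iff)
  then have d': "distinct [i', j', k', l', m]" using d by auto
  have "{v :: complex ^ 5. v $ i' + v $ j' = 0 \<and> v $ k' + v $ l' = 0 \<and> v $ m = 0}
      = {v. v $ i + v $ j = 0 \<and> v $ k + v $ l = 0 \<and> v $ m = 0}"
    using c by (auto simp: add.commute)
  then show "L = pspan (ediff i j) (ediff k l)" unfolding L pspan_ediff[OF d'] pspan_ediff[OF d] by simp
qed

text \<open>For \<open>y = 1/2\<close> and \<open>r = 1\<close> the equations of the line reduce to \<open>v\<^sub>a = 0\<close> and \<open>v\<^sub>b = - v\<^sub>i\<close>.\<close>

lemma L_edge_graph:
  assumes d: "distinct [i, j, a, b, c]"
  shows "L_edge {{i, b}, {j, c}} = clebsch_line i j (Graph a b 1)"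
proof -
  have d': "distinct [i, b, j, c, a]" using d by auto
  have "label_space i j 1 clebsch_root (Graph a b 1) = {v. v $ i + v $ b = 0 \<and> v $ j + v $ c = 0 \<and> v $ a = 0}"
  proof (intro set_eqI)
    fix v :: "complex ^ 5"
    show "v \<in> label_space i j 1 clebsch_root (Graph a b 1) \<longleftrightarrow>
      v \<in> {v. v $ i + v $ b = 0 \<and> v $ j + v $ c = 0 \<and> v $ a = 0}"
    proof -
      have "(1 / 2 - 1) * (v $ i + v $ j) - 1 / 2 * 1 * (v $ i - v $ j) = - v $ i" by (simp add: field_simps)
      then have "v \<in> label_space i j 1 clebsch_root (Graph a b 1) \<longleftrightarrow>
          v $ i + v $ j + v $ a + v $ b + v $ c = 0 \<and> v $ a = 0 \<and> v $ b = - v $ i"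
        by (simp add: sum_5[OF d] clebsch_root_def)
      also have "\<dots> \<longleftrightarrow> v $ i + v $ b = 0 \<and> v $ j + v $ c = 0 \<and> v $ a = 0"
        (is "?P \<longleftrightarrow> ?Q")
      proof
        assume ?P
        then have "v $ i + v $ j + v $ a + v $ b + v $ c = 0" and e: "v $ a = 0" "v $ b = - v $ i" by blast+
        then have "v $ j + v $ c = 0" by simp
        then show ?Q by (simp add: e)
      next
        assume ?Q
        then have "v $ j + v $ c = 0" "v $ a = 0" and b: "v $ b = - v $ i" by (auto simp: add_eq_0_iff)
        then show ?P by simp
      qed
      finally show ?thesis by simp
    qed
  qed
  then show ?thesis unfolding L_edge_eq[OF d'] pspan_ediff[OF d'] label_line_def by simp
qed

text \<open>The row span of the \<open>2 \<times> 5\<close> matrix that describes the line of a pentagon: the first two coordinates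
  are free and the columns of the matrix give the other three.\<close>

definition pent_space :: "5 \<Rightarrow> 5 \<Rightarrow> 5 \<Rightarrow> 5 \<Rightarrow> 5 \<Rightarrow> (complex ^ 5) set" where
  "pent_space a b c d e = {v. v $ c = - v $ a - beta * v $ b \<and> v $ d = beta * (v $ a + v $ b) \<and>
     v $ e = - beta * v $ a - v $ b}"

lemma pspan_pent:
  assumes d: "distinct [a, b, c, d, e]"
  shows "pspan (ediff c a + beta *s ediff e d) (ediff e b + beta *s ediff c d)
    = projectivization (pent_space a b c d e)"
proof (rule pspan_eq_projectivization)
  fix v
  let ?x = "ediff c a + beta *s ediff e d" and ?y = "ediff e b + beta *s ediff c d"
  have n: "?x $ a = -1" "?x $ b = 0" "?x $ c = 1" "?x $ d = - beta" "?x $ e = beta"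
    "?y $ a = 0" "?y $ b = -1" "?y $ c = beta" "?y $ d = - beta" "?y $ e = 1"
    using d by (auto simp: ediff_def axis_def)
  show "v \<in> pent_space a b c d e \<longleftrightarrow> (\<exists>p q. v = p *s ?x + q *s ?y)"
  proof
    assume "v \<in> pent_space a b c d e"
    then have e: "v $ c = - v $ a - beta * v $ b" "v $ d = beta * (v $ a + v $ b)" "v $ e = - beta * v $ a - v $ b"
      by (simp_all only: pent_space_def mem_Collect_eq)
    have "v = (- v $ a) *s ?x + (- v $ b) *s ?y"
      unfolding vec_eq_iff_5[OF d] vector_add_component[of "(- v $ a) *s ?x"] vector_smult_component n e
      by (simp add: algebra_simps)
    then show "\<exists>p q. v = p *s ?x + q *s ?y" by blast
  next
    assume "\<exists>p q. v = p *s ?x + q *s ?y"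
    then obtain p q where v: "v = p *s ?x + q *s ?y" by blast
    have "v $ a = - p" "v $ b = - q" "v $ c = p + beta * q" "v $ d = - beta * p - beta * q" "v $ e = beta * p + q"
      unfolding v vector_add_component[of "p *s ?x"] vector_smult_component n by (simp_all add: mult.commute)
    then show "v \<in> pent_space a b c d e" by (simp add: pent_space_def algebra_simps)
  qed
qed

text \<open>Invariance under rotation is the equation \<open>\<beta>\<^sup>2 = \<beta> + 1\<close>.\<close>

lemma pent_space_rotate_subset: "pent_space a b c d e \<subseteq> pent_space b c d e a"
proof
  fix v assume "v \<in> pent_space a b c d e"
  then have e: "v $ c = - v $ a - beta * v $ b" "v $ d = beta * (v $ a + v $ b)" "v $ e = - beta * v $ a - v $ b"
    by (auto simp: pent_space_def)
  have "v $ d = - v $ b - beta * v $ c" unfolding e using beta_squared by algebra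
  moreover have "v $ e = beta * (v $ b + v $ c)" unfolding e using beta_squared by algebra
  moreover have "v $ a = - beta * v $ b - v $ c" unfolding e by simp
  ultimately show "v \<in> pent_space b c d e a" by (simp add: pent_space_def)
qed

text \<open>Four more rotations return to the beginning, so the inclusion is an equality.\<close>

lemma pent_space_rotate: "pent_space b c d e a = pent_space a b c d e"
  using pent_space_rotate_subset[of a b c d e] pent_space_rotate_subset[of b c d e a]
    pent_space_rotate_subset[of c d e a b] pent_space_rotate_subset[of d e a b c]
    pent_space_rotate_subset[of e a b c d] by blast

lemma pent_space_reverse: "pent_space e d c b a = pent_space a b c d e"
proof -
  have "pent_space a b c d e \<subseteq> pent_space e d c b a" for a b c d e
  proof
    fix v assume "v \<in> pent_space a b c d e"
    then have e: "v $ c = - v $ a - beta * v $ b" "v $ d = beta * (v $ a + v $ b)" "v $ e = - beta * v $ a - v $ b"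
      by (auto simp: pent_space_def)
    have "v $ c = - v $ e - beta * v $ d" unfolding e using beta_squared by algebra
    moreover have "v $ b = beta * (v $ e + v $ d)" unfolding e using beta_squared by algebra
    moreover have "v $ a = - beta * v $ e - v $ d" unfolding e using beta_squared by algebra
    ultimately show "v \<in> pent_space e d c b a" by (simp add: pent_space_def)
  qed
  then show ?thesis by blast
qed

lemma range_cyclic_edge_5:
  "cycle_edges [A, B, C, D, E] = {{A, B}, {B, C}, {C, D}, {D, E}, {E, A}}"
proof -
  have "range (cyclic_edge [A, B, C, D, E]) = cyclic_edge [A, B, C, D, E] ` {0, 1, 2, 3, 4}"
  proof -
    have "cyclic_edge [A, B, C, D, E] i = cyclic_edge [A, B, C, D, E] (i mod 5)" for i
      by (simp add: cyclic_edge_def mod_Suc_eq)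
    moreover have "i mod 5 \<in> {0, 1, 2, 3, 4}" for i :: nat by auto
    ultimately have "cyclic_edge [A, B, C, D, E] i \<in> cyclic_edge [A, B, C, D, E] ` {0, 1, 2, 3, 4}" for i
      by (metis imageI)
    then show ?thesis by blast
  qed
  then show ?thesis by (simp add: cycle_edges_def cyclic_edge_def)
qed

lemma Union_Pen: "\<Union>(Pen a b c d e) = {{a, b}, {b, c}, {c, d}, {d, e}, {e, a}}"
  unfolding Pen_def range_cyclic_edge_5 by auto

text \<open>A pentagon determines its labelling up to the dihedral group.  Its vertices are the edges of a
  5-cycle on the five indices; the ordered pair \<open>(a', b')\<close> is one of the ten oriented edges of this
  cycle, and each further index is then forced.\<close>

lemma pentagon_dihedral:
  assumes d: "distinct [a, b, c, d, e]" and d': "distinct [a', b', c', d', e']"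
    and V: "{{a', b'}, {b', c'}, {c', d'}, {d', e'}, {e', a'}} = {{a, b}, {b, c}, {c, d}, {d, e}, {e, a :: 5}}"
  shows "[a', b', c', d', e'] \<in> {[a, b, c, d, e], [b, c, d, e, a], [c, d, e, a, b], [d, e, a, b, c], [e, a, b, c, d],
    [e, d, c, b, a], [d, c, b, a, e], [c, b, a, e, d], [b, a, e, d, c], [a, e, d, c, b]}"
proof -
  let ?V = "{{a, b}, {b, c}, {c, d}, {d, e}, {e, a}}"
  have V': "{a', b'} \<in> ?V" "{b', c'} \<in> ?V" "{c', d'} \<in> ?V" "{d', e'} \<in> ?V"
    unfolding V[symmetric] by simp_all
  have step: "(x, y) \<in> {(a, b), (b, c), (c, d), (d, e), (e, a), (b, a), (c, b), (d, c), (e, d), (a, e)}"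
    if "{x, y} \<in> ?V" for x y
    using that by (auto simp: doubleton_eq_iff)
  have n: "a' \<noteq> c'" "b' \<noteq> d'" "c' \<noteq> e'" using d' by auto
  have d2: "a \<noteq> b" "a \<noteq> c" "a \<noteq> d" "a \<noteq> e" "b \<noteq> c" "b \<noteq> d" "b \<noteq> e" "c \<noteq> d" "c \<noteq> e" "d \<noteq> e"
    using d by auto
  note d3 = d2 d2[symmetric]
  have 3: "(a', b', c') \<in> {(a, b, c), (b, c, d), (c, d, e), (d, e, a), (e, a, b),
      (c, b, a), (d, c, b), (e, d, c), (a, e, d), (b, a, e)}"
    using step[OF V'(1)] by (elim insertE emptyE) (use step[OF V'(2)] n(1) d3 in auto)
  then have 4: "(a', b', c', d') \<in> {(a, b, c, d), (b, c, d, e), (c, d, e, a), (d, e, a, b), (e, a, b, c),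
      (c, b, a, e), (d, c, b, a), (e, d, c, b), (a, e, d, c), (b, a, e, d)}"
    by (elim insertE emptyE) (use step[OF V'(3)] n(2) d3 in auto)
  then show ?thesis by (elim insertE emptyE) (use step[OF V'(4)] n(3) d3 in auto)
qed

lemma L_pent_Pen:
  assumes d: "distinct [a, b, c, d, e]"
  shows "L_pent (Pen a b c d e) = projectivization (pent_space a b c d e)"
  unfolding L_pent_def
proof (rule the_equality)
  show "\<exists>a' b' c' d' e'. {a', b', c', d', e'} = UNIV \<and> Pen a b c d e = Pen a' b' c' d' e' \<and>
    projectivization (pent_space a b c d e)
      = pspan (ediff c' a' + beta *s ediff e' d') (ediff e' b' + beta *s ediff c' d')"
    using pspan_pent[OF d] UNIV_5[OF d] by metis
next
  fix L assume "\<exists>a' b' c' d' e'. {a', b', c', d', e'} = UNIV \<and> Pen a b c d e = Pen a' b' c' d' e' \<and>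
    L = pspan (ediff c' a' + beta *s ediff e' d') (ediff e' b' + beta *s ediff c' d')"
  then obtain a' b' c' d' e' where U: "{a', b', c', d', e'} = (UNIV :: 5 set)"
    and P: "Pen a b c d e = Pen a' b' c' d' e'"
    and L: "L = pspan (ediff c' a' + beta *s ediff e' d') (ediff e' b' + beta *s ediff c' d')" by blast
  have "card (set [a', b', c', d', e']) = CARD(5)" using U by simp
  then have d': "distinct [a', b', c', d', e']" by (intro card_distinct) simp
  have "{{a', b'}, {b', c'}, {c', d'}, {d', e'}, {e', a'}} = {{a, b}, {b, c}, {c, d}, {d, e}, {e, a}}"
    using P Union_Pen by metis
  note orbit = pentagon_dihedral[OF d d' this]
  have rotate: "pent_space b c d e a = pent_space a b c d e" "pent_space c d e a b = pent_space a b c d e"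
    "pent_space d e a b c = pent_space a b c d e" "pent_space e a b c d = pent_space a b c d e"
    using pent_space_rotate[of b c d e a] pent_space_rotate[of c d e a b]
      pent_space_rotate[of d e a b c] pent_space_rotate[of e a b c d] by simp_all
  note dihedral = rotate pent_space_reverse[of e d c b a] pent_space_reverse[of a e d c b, unfolded rotate]
    pent_space_reverse[of b a e d c, unfolded rotate] pent_space_reverse[of c b a e d, unfolded rotate]
    pent_space_reverse[of d c b a e, unfolded rotate]
  from orbit
  have "pent_space a' b' c' d' e' = pent_space a b c d e"
    by (elim insertE emptyE) (simp_all only: list.inject simp_thms dihedral)
  then show "L = projectivization (pent_space a b c d e)" unfolding L pspan_pent[OF d'] by simp
qed

text \<open>For \<open>y = (1 - \<beta>)/2\<close> and \<open>r = 1\<close> the equations of the line reduce to \<open>v\<^sub>a = \<beta> (v\<^sub>i + v\<^sub>j)\<close> and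
  \<open>v\<^sub>b = - v\<^sub>i - \<beta> v\<^sub>j\<close>, which together with the zero coordinate sum describe the row span for the
  pentagon with vertices \<open>ci, ij, jb, ba, ac\<close>.\<close>

lemma L_pent_graph:
  assumes d: "distinct [i, j, a, b, c]"
  shows "L_pent (Pen c i j b a) = clebsch_line i j (Graph a b 0)"
proof -
  have d': "distinct [c, i, j, b, a]" using d by auto
  have "pent_space c i j b a = label_space i j 1 clebsch_root (Graph a b 0)"
  proof (intro set_eqI iffI)
    fix v assume "v \<in> pent_space c i j b a"
    then have e: "v $ j = - v $ c - beta * v $ i" "v $ b = beta * (v $ c + v $ i)" "v $ a = - beta * v $ c - v $ i"
      by (auto simp: pent_space_def)
    have "v $ i + v $ j + v $ a + v $ b + v $ c = 0" unfolding e by algebra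
    moreover have "v $ a = (1 - (1 - beta)) * (v $ i + v $ j)" unfolding e using beta_squared by algebra
    then have "v $ a = (1 - 2 * ((1 - beta) / 2)) * (v $ i + v $ j)" by (simp add: field_simps)
    moreover have "v $ b = ((1 - beta) / 2 - 1) * (v $ i + v $ j) - (1 - beta) / 2 * 1 * (v $ i - v $ j)"
    proof -
      have "((1 - beta) / 2 - 1) * (v $ i + v $ j) - (1 - beta) / 2 * 1 * (v $ i - v $ j) = - v $ i - beta * v $ j"
        by (simp add: field_simps)
      also have "\<dots> = v $ b" unfolding e using beta_squared by algebra
      finally show ?thesis ..
    qed
    ultimately show "v \<in> label_space i j 1 clebsch_root (Graph a b 0)"
      by (simp only: label_space.simps mem_Collect_eq clebsch_root_vals sum_5[OF d] simp_thms)
  next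
    fix v assume "v \<in> label_space i j 1 clebsch_root (Graph a b 0)"
    then have "(\<Sum>k\<in>UNIV. v $ k) = 0" "v $ a = (1 - 2 * ((1 - beta) / 2)) * (v $ i + v $ j)"
      "v $ b = ((1 - beta) / 2 - 1) * (v $ i + v $ j) - (1 - beta) / 2 * 1 * (v $ i - v $ j)"
      by (simp_all only: label_space.simps mem_Collect_eq clebsch_root_vals)
    note raw = this
    have sum: "v $ i + v $ j + v $ a + v $ b + v $ c = 0" using raw(1) by (simp only: sum_5[OF d])
    have "1 - 2 * ((1 - beta) / 2) = beta" by (simp add: field_simps)
    then have a: "v $ a = beta * (v $ i + v $ j)" using raw(2) by (simp only:)
    note raw(3)
    also have "((1 - beta) / 2 - 1) * (v $ i + v $ j) - (1 - beta) / 2 * 1 * (v $ i - v $ j) = - v $ i - beta * v $ j"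
      by (simp add: field_simps)
    finally have b: "v $ b = - v $ i - beta * v $ j" .
    have j: "v $ j = - v $ c - beta * v $ i" using sum a b by algebra
    moreover have "v $ b = beta * (v $ c + v $ i)" unfolding b j using beta_squared by algebra
    moreover have "v $ a = - beta * v $ c - v $ i" unfolding a j using beta_squared by algebra
    ultimately show "v \<in> pent_space c i j b a" by (simp add: pent_space_def)
  qed
  then show ?thesis unfolding L_pent_Pen[OF d'] label_line_def by simp
qed


section \<open>Pentagons and the hexagon\<close>

lemma edges_iff: "{A, B} \<in> edges \<longleftrightarrow> adjacent A B"
proof
  assume "{A, B} \<in> edges"
  then obtain C D where "{A, B} = {C, D}" "adjacent C D" by (auto simp: edges_def)
  then show "adjacent A B" by (auto simp: doubleton_eq_iff adjacent_def)
qed (auto simp: edges_def)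

lemma Pen_in_pentagons:
  assumes d: "distinct [a, b, c, d, e]"
  shows "Pen a b c d e \<in> pentagons"
proof -
  let ?vs = "[{a, b}, {c, d}, {e, a}, {b, c}, {d, e}]"
  have c: "{{a, b}, {c, d}, {e, a}, {b, c}, {d, e}} \<subseteq> vertices" using d by (auto simp: vertices_def)
  have "distinct ?vs" using d by (auto simp: doubleton_eq_iff)
  moreover have "cyclic_edge ?vs i \<in> edges" for i
  proof -
    have "cyclic_edge ?vs i \<in> Pen a b c d e" by (simp add: Pen_def cycle_edges_def)
    moreover have "Pen a b c d e \<subseteq> edges"
      unfolding Pen_def range_cyclic_edge_5 using c d by (auto simp: edges_iff adjacent_def)
    ultimately show ?thesis by blast
  qed
  ultimately have "is_cycle 5 ?vs" using c by (simp add: is_cycle_def)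
  then show ?thesis unfolding pentagons_def Pen_def by blast
qed

text \<open>A pentagon through a given edge, listed from this edge on.  The vertex \<open>A\<close> opposite to the edge is
  the only one outside the edge that is adjacent to neither of its ends.\<close>

lemma pentagon_vertices:
  assumes S: "S \<in> pentagons" and E: "{B, C} \<in> S"
  obtains B' C' U A V where "{B, C} = {B', C'}" "S = {{B', C'}, {C', U}, {U, A}, {A, V}, {V, B'}}"
    "distinct [B', C', U, A, V]"
    "adjacent B' C'" "adjacent C' U" "adjacent U A" "adjacent A V" "adjacent V B'"
proof -
  obtain vs where vs: "is_cycle 5 vs" "S = cycle_edges vs" using S by (auto simp: pentagons_def)
  then have len: "length vs = 5" and dist: "distinct vs" and ed: "\<And>i. cyclic_edge vs i \<in> edges"
    by (auto simp: is_cycle_def)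
  obtain v0 v1 v2 v3 v4 where v: "vs = [v0, v1, v2, v3, v4]"
    using len by (auto simp: numeral_eq_Suc length_Suc_conv)
  have S': "S = {{v0, v1}, {v1, v2}, {v2, v3}, {v3, v4}, {v4, v0}}"
    using vs(2) unfolding v range_cyclic_edge_5 .
  have "S \<subseteq> edges" using ed vs(2) by (auto simp: cycle_edges_def)
  then have adj: "adjacent v0 v1" "adjacent v1 v2" "adjacent v2 v3" "adjacent v3 v4" "adjacent v4 v0"
    unfolding S' by (simp_all add: edges_iff)
  have d: "distinct [v0, v1, v2, v3, v4]" using dist v by simp
  have "{B, C} = {v0, v1} \<or> {B, C} = {v1, v2} \<or> {B, C} = {v2, v3} \<or> {B, C} = {v3, v4} \<or> {B, C} = {v4, v0}"
    using E unfolding S' by (simp only: insert_iff empty_iff simp_thms)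
  then consider "{B, C} = {v0, v1}" | "{B, C} = {v1, v2}" | "{B, C} = {v2, v3}"
    | "{B, C} = {v3, v4}" | "{B, C} = {v4, v0}" by (elim disjE)
  then show ?thesis
  proof cases
    case 1 show ?thesis by (rule that[of v0 v1 v2 v3 v4]) (use 1 S' adj d in auto)
  next
    case 2 show ?thesis by (rule that[of v1 v2 v3 v4 v0]) (use 2 S' adj d in auto)
  next
    case 3 show ?thesis by (rule that[of v2 v3 v4 v0 v1]) (use 3 S' adj d in auto)
  next
    case 4 show ?thesis by (rule that[of v3 v4 v0 v1 v2]) (use 4 S' adj d in auto)
  next
    case 5 show ?thesis by (rule that[of v4 v0 v1 v2 v3]) (use 5 S' adj d in auto)
  qed
qed

lemma vertex_in_complement:
  assumes d: "distinct [i, j, a, b, c]" and U: "U \<in> vertices" "U \<inter> {i, j} = {}" "c \<notin> U"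
  shows "U = {a, b}"
proof -
  have "U \<subseteq> {a, b}" using U UNIV_5[OF d] by blast
  moreover have "card U = card {a, b}" using U(1) d by (simp add: vertices_def)
  ultimately show ?thesis by (intro card_subset_eq) auto
qed

text \<open>Both ends of the edge meet \<open>{i, j}\<close>, and so do not neighbour it: \<open>{i, j}\<close> must be the vertex opposite to
  the edge.  The remaining two vertices are pairs disjoint from two known ones, which leaves a single
  choice for each.\<close>

lemma Pen_through_eq:
  assumes d: "distinct [i, j, a, b, c]"
  shows "Pen_through {i, j} {{j, b}, {i, c}} = Pen c i j b a"
proof -
  have d': "distinct [c, i, j, b, a]" using d by auto
  have P: "Pen c i j b a = {{{c, i}, {j, b}}, {{j, b}, {a, c}}, {{a, c}, {i, j}}, {{i, j}, {b, a}}, {{b, a}, {c, i}}}"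
    by (simp add: Pen_def range_cyclic_edge_5)
  show ?thesis unfolding Pen_through_def
  proof (rule the_equality)
    have "{{j, b}, {i, c}} = {{c, i}, {j, b}}" by (auto simp: insert_commute)
    then show "Pen c i j b a \<in> pentagons \<and> {i, j} \<in> \<Union>(Pen c i j b a) \<and> {{j, b}, {i, c}} \<in> Pen c i j b a"
      using Pen_in_pentagons[OF d'] by (simp add: P)
  next
    fix S assume "S \<in> pentagons \<and> {i, j} \<in> \<Union>S \<and> {{j, b}, {i, c}} \<in> S"
    then have S: "S \<in> pentagons" "{i, j} \<in> \<Union>S" "{{j, b}, {i, c}} \<in> S" by blast+
    obtain B C U A V where BC: "{{j, b}, {i, c}} = {B, C}" and S': "S = {{B, C}, {C, U}, {U, A}, {A, V}, {V, B}}"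
      and adj: "adjacent B C" "adjacent C U" "adjacent U A" "adjacent A V" "adjacent V B"
      using pentagon_vertices[OF S(1,3)] by metis
    have "{i, j} \<in> {B, C, U, A, V}" using S(2) unfolding S' by blast
    moreover have cases: "B = {j, b} \<and> C = {i, c} \<or> B = {i, c} \<and> C = {j, b}"
      using BC by (auto simp: doubleton_eq_iff)
    then have "{i, j} \<noteq> B" "{i, j} \<noteq> C" using d by (auto simp: doubleton_eq_iff)
    moreover have "{i, j} \<noteq> U" "{i, j} \<noteq> V" using adj cases by (auto simp: adjacent_def)
    ultimately have A: "A = {i, j}" by blast
    have da: "distinct [i, j, a, b, c]" "distinct [i, j, a, c, b]" using d by auto
    have U: "U \<in> vertices" "V \<in> vertices" "U \<inter> {i, j} = {}" "V \<inter> {i, j} = {}" "U \<inter> C = {}" "V \<inter> B = {}"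
      using adj A by (auto simp: adjacent_def)
    from cases show "S = Pen c i j b a"
    proof (elim disjE conjE)
      assume BC: "B = {j, b}" "C = {i, c}"
      have "U = {a, b}" using vertex_in_complement[OF da(1)] U BC by auto
      moreover have "V = {a, c}" using vertex_in_complement[OF da(2)] U BC by auto
      ultimately show ?thesis unfolding S' P A BC by (simp add: insert_commute)
    next
      assume BC: "B = {i, c}" "C = {j, b}"
      have "U = {a, c}" using vertex_in_complement[OF da(2)] U BC by auto
      moreover have "V = {a, b}" using vertex_in_complement[OF da(1)] U BC by auto
      ultimately show ?thesis unfolding S' P A BC by (simp add: insert_commute)
    qed
  qed
qed

text \<open>The vertices of the hexagon are the pairs with exactly one element in \<open>A = {p, q}\<close>.  Adjacent ones are
  disjoint, so the elements \<open>p\<close> and \<open>q\<close> alternate; disjointness and distinctness force the second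
  elements one after the other.  Opposite edges have the form \<open>{pb, qc}\<close> and \<open>{qb, pc}\<close>.\<close>

lemma hexagon_normal_form:
  assumes A: "A \<in> vertices" and hex: "is_cycle 6 hex"
    and set: "set hex = {B \<in> vertices. B \<noteq> A \<and> \<not> adjacent A B}"
  obtains p q x y z where "distinct [p, q, x, y, z]" "A = {p, q}"
    "hex = [{p, x}, {q, y}, {p, z}, {q, x}, {p, y}, {q, z}]"
proof -
  from hex have len: "length hex = 6" and dist: "distinct hex" and ed: "\<And>i. cyclic_edge hex i \<in> edges"
    by (auto simp: is_cycle_def)
  obtain h0 h1 h2 h3 h4 h5 where h: "hex = [h0, h1, h2, h3, h4, h5]"
    using len by (auto simp: numeral_eq_Suc length_Suc_conv)
  have disj: "h0 \<inter> h1 = {}" "h1 \<inter> h2 = {}" "h2 \<inter> h3 = {}" "h3 \<inter> h4 = {}" "h4 \<inter> h5 = {}"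
    using ed[of 0] ed[of 1] ed[of 2] ed[of 3] ed[of 4]
    by (simp_all add: h cyclic_edge_def edges_iff adjacent_def)
  have split: "\<exists>m n. m \<in> A \<and> n \<notin> A \<and> B = {m, n}" if "B \<in> set hex" for B
  proof -
    have B: "card B = 2" "card A = 2" "B \<noteq> A" "B \<inter> A \<noteq> {}"
      using that A set by (auto simp: vertices_def adjacent_def)
    then obtain m where m: "m \<in> A" "m \<in> B" by blast
    obtain n where n: "B = {m, n}" "n \<noteq> m" using B(1) m(2) by (metis card_2_iff insert_commute insertE singletonD)
    have "n \<notin> A"
    proof
      assume "n \<in> A"
      then have "B \<subseteq> A" using m n by blast
      then show False using B by (metis card_subset_eq card.infinite zero_neq_numeral)
    qed
    then show ?thesis using m n by blast
  qed
  obtain p x where px: "p \<in> A" "x \<notin> A" "h0 = {p, x}" using split[of h0] h by auto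
  obtain u v where uv: "A = {u, v}" "u \<noteq> v" using A by (auto simp: vertices_def card_2_iff)
  obtain q where q: "A = {p, q}" "q \<noteq> p"
  proof (cases "p = u")
    case True then show ?thesis using that[of v] uv by simp
  next
    case False then show ?thesis using that[of u] uv px(1) by (simp add: insert_commute)
  qed
  have split': "\<exists>n. n \<notin> {p, q} \<and> (B = {p, n} \<or> B = {q, n})" if "B \<in> set hex" for B
    using split[OF that] q by blast
  obtain y where y: "y \<notin> {p, q}" "h1 = {q, y}" using split'[of h1] h disj(1) px by auto
  obtain z where z: "z \<notin> {p, q}" "h2 = {p, z}" using split'[of h2] h disj(2) y by auto
  have "x \<noteq> y" using disj(1) px y by auto
  moreover have "z \<noteq> y" using disj(2) z y by auto
  moreover have "z \<noteq> x" using dist px z by (auto simp: h)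
  ultimately have d: "distinct [p, q, x, y, z]" using q px y z by auto
  have n: "n \<in> {x, y, z}" if "n \<notin> {p, q}" for n using UNIV_5[OF d] that by blast
  obtain x' where x': "x' \<notin> {p, q}" "h3 = {q, x'}" using split'[of h3] h disj(3) z by auto
  have "x' \<noteq> z" "x' \<noteq> y" using disj(3) dist x' y z by (auto simp: h)
  then have h3: "h3 = {q, x}" using n x' by blast
  obtain y' where y': "y' \<notin> {p, q}" "h4 = {p, y'}" using split'[of h4] h disj(4) h3 by auto
  have "y' \<noteq> x" "y' \<noteq> z" using dist y' px z by (auto simp: h)
  then have h4: "h4 = {p, y}" using n y' by blast
  obtain z' where z': "z' \<notin> {p, q}" "h5 = {q, z'}" using split'[of h5] h disj(5) h4 by auto
  have "z' \<noteq> x" "z' \<noteq> y" using dist z' h3 y by (auto simp: h)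
  then have "h5 = {q, z}" using n z' by blast
  then show ?thesis using that[OF d q(1)] h px y z h3 h4 by simp
qed


section \<open>The double-six\<close>

text \<open>A vector of a \<open>Graph\<close> line is determined by its values of \<open>s\<close> and \<open>t\<close>.\<close>

lemma graph_lines_disjoint:
  assumes d: "distinct [i, j, a, b, c]" and g: "(a', b') \<in> {(a, b), (b, c), (c, a), (a, c), (c, b), (b, a)}"
    and l: "\<And>v. v \<in> label_space i j 1 clebsch_root (Graph a b k) \<Longrightarrow>
      v \<in> label_space i j 1 clebsch_root (Graph a' b' k') \<Longrightarrow> v $ i + v $ j = 0 \<and> v $ i - v $ j = 0"
    and k: "k < 3" "k' < 3"
  shows "clebsch_line i j (Graph a b k) \<inter> clebsch_line i j (Graph a' b' k') = {}"
proof -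
  have L: "Graph a b k \<in> labels i j" "Graph a' b' k' \<in> labels i j" using d g k by (auto simp: labels_def)
  have "v = 0" if v: "v \<in> label_space i j 1 clebsch_root (Graph a b k)"
    "v \<in> label_space i j 1 clebsch_root (Graph a' b' k')" for v
  proof -
    have e: "v $ i + v $ j = 0" "v $ i - v $ j = 0" using l[OF v] by blast+
    then have "v $ i = 0" "v $ j = 0" by auto
    moreover have "v $ a = 0" "v $ b = 0" using v(1) e by simp_all
    moreover have "(\<Sum>k\<in>UNIV. v $ k) = 0" using v(1) by simp
    ultimately show "v = 0" unfolding vec_eq_iff_5[OF d] by (simp add: sum_5[OF d])
  qed
  then show ?thesis
    unfolding label_line_def projectivization_disjoint_iff[OF subspace_label_space[OF d L(1)] subspace_label_space[OF d L(2)]]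
    by blast
qed

lemma clebsch_graph_coords:
  assumes d: "distinct [i, j, a, b, c]" and v: "v \<in> label_space i j 1 clebsch_root (Graph a b k)"
  defines "s \<equiv> v $ i + v $ j" and "t \<equiv> v $ i - v $ j" and "y \<equiv> clebsch_root k"
  shows "v $ a = (1 - 2 * y) * s" "v $ b = (y - 1) * s - y * t" "v $ c = (y - 1) * s + y * t"
proof -
  have "(\<Sum>k\<in>UNIV. v $ k) = 0" using v by simp
  then have "v $ i + v $ j + v $ a + v $ b + v $ c = 0" by (simp only: sum_5[OF d])
  moreover show a: "v $ a = (1 - 2 * y) * s" and b: "v $ b = (y - 1) * s - y * t"
    using v by (simp_all add: s_def t_def y_def)
  ultimately show "v $ c = (y - 1) * s + y * t" unfolding s_def by algebra
qed

lemma beta_neq: "beta \<noteq> 0" "beta \<noteq> 1" "beta \<noteq> 2" "beta \<noteq> - 1 / 3"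
proof -
  have *: "beta \<noteq> r" if "r\<^sup>2 \<noteq> r + 1" for r using beta_squared that by auto
  show "beta \<noteq> 0" "beta \<noteq> 1" "beta \<noteq> 2" "beta \<noteq> - 1 / 3"
    by (rule *; simp add: power2_eq_square)+
qed

lemma clebsch_root_single:
  assumes "k < 2"
  shows "clebsch_root k \<noteq> 0" "3 * clebsch_root k \<noteq> 2"
proof -
  have "k = 0 \<or> k = 1" using assms by auto
  moreover have "3 * ((1 - beta) / 2) \<noteq> 2"
  proof
    assume h: "3 * ((1 - beta) / 2) = 2"
    have "beta = 1 - 3 * ((1 - beta) / 2) * (2 / 3)" by (simp add: field_simps)
    also have "\<dots> = - 1 / 3" unfolding h by simp
    finally have "beta = - 1 / 3" .
    then show False using beta_neq by simp
  qed
  ultimately show "clebsch_root k \<noteq> 0" "3 * clebsch_root k \<noteq> 2"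
    using beta_neq by (auto simp: clebsch_root_def)
qed

text \<open>The last equation is what \<open>y\<^sup>2 (1 - y) = y'\<^sup>2 (1 - y')\<close> becomes after division by \<open>y - y'\<close>; it decides
  which lines with different roots meet.\<close>

lemma clebsch_root_pair:
  assumes "k < 2" "k' < 2" "k \<noteq> k'"
  defines "y \<equiv> clebsch_root k" and "y' \<equiv> clebsch_root k'"
  shows "y \<noteq> y'" "y + y' \<noteq> 0" "y + y' \<noteq> 1" "y + y' = y * y + y * y' + y' * y'"
proof -
  have "k = 0 \<and> k' = 1 \<or> k = 1 \<and> k' = 0" using assms by auto
  moreover have "(1 - beta) / 2 \<noteq> 1 / 2" "(1 - beta) / 2 + 1 / 2 \<noteq> 0" "(1 - beta) / 2 + 1 / 2 \<noteq> 1"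
    using beta_neq by (auto simp: field_simps)
  moreover have "(1 - beta) / 2 + 1 / 2 = (1 - beta) / 2 * ((1 - beta) / 2) + (1 - beta) / 2 * (1 / 2) + 1 / 2 * (1 / 2)"
    using beta_squared by (simp add: field_simps power2_eq_square)
  ultimately show "y \<noteq> y'" "y + y' \<noteq> 0" "y + y' \<noteq> 1" "y + y' = y * y + y * y' + y' * y'"
    unfolding y_def y'_def by (auto simp: clebsch_root_def add.commute add.left_commute mult.commute)
qed

text \<open>Orderings that differ by a cyclic rotation, with the same root: a common vector satisfies \<open>t = 0\<close> and
  \<open>(2 - 3 y) s = 0\<close>, and \<open>y\<close> is not the double root \<open>2/3\<close>.\<close>

lemma graph_lines_skew:
  assumes d: "distinct [i, j, a, b, c]" and k: "k < 2"
  shows "clebsch_line i j (Graph a b k) \<inter> clebsch_line i j (Graph b c k) = {}"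
proof (rule graph_lines_disjoint[OF d])
  fix v assume v: "v \<in> label_space i j 1 clebsch_root (Graph a b k)" "v \<in> label_space i j 1 clebsch_root (Graph b c k)"
  define s t y where "s = v $ i + v $ j" and "t = v $ i - v $ j" and "y = clebsch_root k"
  have d': "distinct [i, j, b, c, a]" using d by auto
  note e = clebsch_graph_coords[OF d v(1), folded s_def t_def y_def]
  note e' = clebsch_graph_coords[OF d' v(2), folded s_def t_def y_def]
  have y: "y \<noteq> 0" "3 * y \<noteq> 2" using clebsch_root_single[OF k] by (simp_all add: y_def)
  have "2 * (y * t) = 0" using e(3) e'(2) by algebra
  then have t: "t = 0" using y by simp
  have "(2 - 3 * y) * s = 0" using e(1) e'(3) unfolding t by algebra
  then have "s = 0" using y by simp
  then show "v $ i + v $ j = 0 \<and> v $ i - v $ j = 0" using t by (simp add: s_def t_def)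
qed (use k in auto)

text \<open>For equal orderings, or orderings that differ by a transposition, and different roots \<open>y, y'\<close> the
  coordinates of a common vector give \<open>s = 0\<close> or \<open>s = \<plusminus> t\<close>, and then multiples of \<open>y - y'\<close>, \<open>y + y'\<close> or
  \<open>1 - y - y'\<close> by \<open>s\<close> or \<open>t\<close> vanish; none of these three numbers is zero.\<close>

lemma graph_lines_skew_other_root:
  assumes d: "distinct [i, j, a, b, c]" and k: "k < 2" "k' < 2" "k \<noteq> k'"
    and g: "(a', b') \<in> {(a, b), (a, c), (c, b), (b, a)}"
  shows "clebsch_line i j (Graph a b k) \<inter> clebsch_line i j (Graph a' b' k') = {}"
proof (rule graph_lines_disjoint[OF d])
  fix v assume v: "v \<in> label_space i j 1 clebsch_root (Graph a b k)" "v \<in> label_space i j 1 clebsch_root (Graph a' b' k')"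
  define s t y y' where "s = v $ i + v $ j" and "t = v $ i - v $ j" and "y = clebsch_root k" and "y' = clebsch_root k'"
  note e = clebsch_graph_coords[OF d v(1), folded s_def t_def y_def]
  have y0: "y \<noteq> 0" using clebsch_root_single[OF k(1)] by (simp add: y_def)
  note y = clebsch_root_pair[OF k, folded y_def y'_def]
  have e': "v $ a' = (1 - 2 * y') * s" "v $ b' = (y' - 1) * s - y' * t"
    using v(2) by (simp_all add: s_def t_def y'_def)
  have nz: "1 - y - y' \<noteq> 0"
  proof
    assume "1 - y - y' = 0"
    then have "y + y' = 1" by algebra
    then show False using y(3) by simp
  qed
  from g have "s = 0 \<and> t = 0"
  proof (elim insertE emptyE)
    assume "(a', b') = (a, b)"
    then have e'': "v $ a = (1 - 2 * y') * s" "v $ b = (y' - 1) * s - y' * t" using e' by auto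
    have "2 * ((y - y') * s) = 0" using e(1) e''(1) by algebra
    then have s: "s = 0" using y by simp
    have "(y - y') * t = 0" using e(2) e''(2) unfolding s by algebra
    then show ?thesis using s y by simp
  next
    assume *: "(a', b') = (a, c)"
    have "v $ a = (1 - 2 * y') * s" "v $ c = (y' - 1) * s - y' * t" using e' * by auto
    note e'' = this
    have "2 * ((y - y') * s) = 0" using e(1) e''(1) by algebra
    then have s: "s = 0" using y by simp
    have "(y + y') * t = 0" using e(3) e''(2) unfolding s by algebra
    then show ?thesis using s y by simp
  next
    assume *: "(a', b') = (c, b)"
    have e'': "v $ c = (1 - 2 * y') * s" "v $ b = (y' - 1) * s - y' * t" using e' * by auto
    have "(y - y') * (s - t) = 0" using e(2) e''(2) by algebra
    then have t: "t = s" using y by simp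
    have "2 * ((1 - y - y') * s) = 0" using e(3) e''(1) unfolding t by algebra
    then have "s = 0" using nz by (metis mult_eq_0_iff zero_neq_numeral)
    then show ?thesis using t by simp
  next
    assume *: "(a', b') = (b, a)"
    have e'': "v $ b = (1 - 2 * y') * s" "v $ a = (y' - 1) * s - y' * t" using e' * by auto
    have 1: "2 * s - 2 * y * s = y' * s - y' * t" using e(1) e''(2) by algebra
    have 2: "y * s - y * t = 2 * s - 2 * y' * s" using e(2) e''(1) by algebra
    have "(y - y') * (s + t) = 0" using 1 2 by algebra
    then have t: "t = - s" using y by (simp add: add_eq_0_iff)
    have "2 * ((1 - y - y') * s) = 0" using 1 unfolding t by algebra
    then have "s = 0" using nz by (metis mult_eq_0_iff zero_neq_numeral)
    then show ?thesis using t by simp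
  qed
  then show "v $ i + v $ j = 0 \<and> v $ i - v $ j = 0" by (simp only: s_def t_def)
qed (use k g in auto)

text \<open>The point of a \<open>Graph\<close> line with parameters \<open>(s, t)\<close> lies on another one as soon as it satisfies the two
  equations of the latter.\<close>

lemma graph_lines_meetI:
  assumes d: "distinct [i, j, a, b, c]" and k: "k < 3" "k' < 3"
    and g: "(a', b') \<in> {(a, b), (b, c), (c, a), (a, c), (c, b), (b, a)}"
    and st: "s \<noteq> 0 \<or> t \<noteq> 0"
  defines "y \<equiv> clebsch_root k" and "y' \<equiv> clebsch_root k'"
  defines "v \<equiv> coord i j a b c ((s + t) / 2) ((s - t) / 2) ((1 - 2 * y) * s) ((y - 1) * s - y * t) ((y - 1) * s + y * t)"
  assumes v: "v $ a' = (1 - 2 * y') * s" "v $ b' = (y' - 1) * s - y' * t"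
  shows "clebsch_line i j (Graph a b k) \<inter> clebsch_line i j (Graph a' b' k') \<noteq> {}"
proof -
  have L: "Graph a b k \<in> labels i j" "Graph a' b' k' \<in> labels i j" using d g k by (auto simp: labels_def)
  note c = coord_nth[OF d, of "(s + t) / 2" "(s - t) / 2" "(1 - 2 * y) * s" "(y - 1) * s - y * t" "(y - 1) * s + y * t", folded v_def]
  have sv: "v $ i + v $ j = s" "v $ i - v $ j = t" unfolding c by (simp_all add: field_simps)
  have sum: "(\<Sum>k\<in>UNIV. v $ k) = 0" unfolding sum_5[OF d] c by (simp add: field_simps)
  have "v \<in> label_space i j 1 clebsch_root (Graph a b k)"
    using sum c(3,4) sv by (simp add: y_def)
  moreover have "v \<in> label_space i j 1 clebsch_root (Graph a' b' k')"
    using sum v sv by (simp add: y'_def)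
  moreover have "v \<noteq> 0" using sv st by auto
  ultimately show ?thesis
    unfolding label_line_def projectivization_disjoint_iff[OF subspace_label_space[OF d L(1)] subspace_label_space[OF d L(2)]]
    by blast
qed

text \<open>Orderings that differ by a cyclic rotation, with different roots.  The parameters
  \<open>(y', 2 - 2 y - y')\<close> of the common point solve the equation at \<open>a\<close>, and the equation at \<open>b\<close> is the
  symmetric relation between the roots.\<close>

lemma graph_lines_meet_other_root:
  assumes d: "distinct [i, j, a, b, c]" and k: "k < 2" "k' < 2" "k \<noteq> k'"
  shows "clebsch_line i j (Graph a b k) \<inter> clebsch_line i j (Graph b c k') \<noteq> {}"
proof -
  define y y' where "y = clebsch_root k" and "y' = clebsch_root k'"
  note y = clebsch_root_pair[OF k, folded y_def y'_def]
  have y0: "y' \<noteq> 0" using clebsch_root_single[OF k(2)] by (simp add: y'_def)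
  have b: "(y - 1) * y' - y * (2 - 2 * y - y') = (1 - 2 * y') * y'" using y(4) by algebra
  have c: "(y - 1) * y' + y * (2 - 2 * y - y') = (y' - 1) * y' - y' * (2 - 2 * y - y')" using y(4) by algebra
  show ?thesis
    by (rule graph_lines_meetI[OF d, of k k' b c y' "2 - 2 * y - y'"])
      (use k y0 b c in \<open>auto simp only: coord_nth[OF d] y_def[symmetric] y'_def[symmetric]\<close>)
qed

text \<open>For orderings that differ by a transposition and the same root \<open>y\<close> the common point has the
  parameters \<open>(1, 0)\<close> or \<open>(y, \<plusminus> (2 - 3 y))\<close>, depending on the index that keeps its place.\<close>

lemma graph_lines_meet:
  assumes d: "distinct [i, j, a, b, c]" and k: "k < 2" and g: "(a', b') \<in> {(a, c), (c, b), (b, a)}"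
  shows "clebsch_line i j (Graph a b k) \<inter> clebsch_line i j (Graph a' b' k) \<noteq> {}"
proof -
  define y where "y = clebsch_root k"
  have y0: "y \<noteq> 0" using clebsch_root_single[OF k] by (simp add: y_def)
  from g show ?thesis
  proof (elim insertE emptyE)
    assume *: "(a', b') = (a, c)"
    show ?thesis
      by (rule graph_lines_meetI[OF d, of k k a' b' 1 0]) (use * k in \<open>simp_all add: coord_nth[OF d]\<close>)
  next
    assume *: "(a', b') = (c, b)"
    then show ?thesis
      by (intro graph_lines_meetI[OF d, of k k a' b' y "2 - 3 * y"])
        (use k y0 in \<open>simp_all add: coord_nth[OF d] y_def[symmetric] algebra_simps\<close>)
  next
    assume *: "(a', b') = (b, a)"
    then show ?thesis
      by (intro graph_lines_meetI[OF d, of k k a' b' y "3 * y - 2"])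
        (use k y0 in \<open>simp_all add: coord_nth[OF d] y_def[symmetric] algebra_simps\<close>)
  qed
qed

text \<open>The labels of the twelve lines whose roots are exchanged.\<close>

definition pair_labels :: "5 \<Rightarrow> 5 \<Rightarrow> label set" where
  "pair_labels p q = {Graph a b k | a b k. a \<noteq> b \<and> a \<notin> {p, q} \<and> b \<notin> {p, q} \<and> k < 2}"

lemma pair_labels_eq:
  assumes d: "distinct [p, q, x, y, z]"
  shows "pair_labels p q = (\<lambda>((m, n), k). Graph m n k) ` ({(x, y), (x, z), (y, x), (y, z), (z, x), (z, y)} \<times> {..<2})"
proof -
  have n: "m \<notin> {p, q} \<longleftrightarrow> m \<in> {x, y, z}" for m
  proof -
    have "m \<in> {p, q, x, y, z}" using UNIV_5[OF d] by blast
    then show ?thesis using d by auto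
  qed
  have pairs: "{(m, n'). m \<noteq> n' \<and> m \<notin> {p, q} \<and> n' \<notin> {p, q}} = {(x, y), (x, z), (y, x), (y, z), (z, x), (z, y)}"
    unfolding n using d by auto
  show ?thesis unfolding pair_labels_def pairs[symmetric] by (auto simp: image_iff)
qed

text \<open>One side consists of the cyclic orderings of \<open>(x, y, z)\<close> with the first root and of the other three
  orderings with the second root; the opposite side has the roots exchanged.\<close>

lemma pair_labels_double_six:
  assumes d: "distinct [p, q, x, y, z]"
  shows "double_six (clebsch_line p q ` pair_labels p q)"
proof -
  define L where "L = (\<lambda>m n k. clebsch_line p q (Graph m n k))"
  let ?D = "clebsch_line p q ` pair_labels p q"
  have sub: "pair_labels p q \<subseteq> labels p q" by (fastforce simp: pair_labels_def labels_def)
  have "card ?D = card (pair_labels p q)"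
    using inj_on_subset[OF lines_on_clebsch(2)[OF d] sub] by (rule card_image)
  also have "\<dots> = 12" unfolding pair_labels_eq[OF d] using d by (subst card_image) (auto simp: inj_on_def)
  finally have card: "card ?D = 12" .
  have "?D \<subseteq> lines_on clebsch" using lines_on_clebsch(1)[OF d] sub by auto
  then have lines: "?D \<subseteq> lines_on P3\<^sub>0" by (auto simp: lines_on_def clebsch_def cubic_surface_def)
  have perms: "distinct [p, q, x, y, z]" "distinct [p, q, x, z, y]" "distinct [p, q, y, x, z]"
    "distinct [p, q, y, z, x]" "distinct [p, q, z, x, y]" "distinct [p, q, z, y, x]" using d by auto
  define a where "a = (\<lambda>n. [L x y 0, L y z 0, L z x 0, L x z 1, L z y 1, L y x 1] ! (n - 1))"
  define b where "b = (\<lambda>n. [L x y 1, L y z 1, L z x 1, L x z 0, L z y 0, L y x 0] ! (n - 1))"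
  have I: "{1..6} = {1, 2, 3, 4, 5, 6 :: nat}" by auto
  have av: "a 1 = L x y 0" "a 2 = L y z 0" "a 3 = L z x 0" "a 4 = L x z 1" "a 5 = L z y 1" "a 6 = L y x 1"
    and bv: "b 1 = L x y 1" "b 2 = L y z 1" "b 3 = L z x 1" "b 4 = L x z 0" "b 5 = L z y 0" "b 6 = L y x 0"
    by (simp_all add: a_def b_def)
  have D: "?D = a ` {1..6} \<union> b ` {1..6}"
  proof -
    have two: "{..<2} = {0, 1 :: nat}" by auto
    have "?D = {L x y 0, L x y 1, L x z 0, L x z 1, L y x 0, L y x 1, L y z 0, L y z 1,
        L z x 0, L z x 1, L z y 0, L z y 1}"
      unfolding pair_labels_eq[OF d] two L_def by (simp add: insert_Times_insert)
    then show ?thesis unfolding I image_insert image_empty av bv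
      by (intro equalityI)
        (simp_all only: Un_insert_left Un_empty_left insert_subset insert_iff empty_subsetI simp_thms)
  qed
  have skew: "L m n k \<inter> L n o' k = {}" "L n o' k \<inter> L m n k = {}"
    if "distinct [p, q, m, n, o']" "k < 2" for m n o' k
    using graph_lines_skew[OF that] unfolding L_def by auto
  have skew': "L m n k \<inter> L m n k' = {}" "L m n k \<inter> L m o' k' = {}" "L m n k \<inter> L o' n k' = {}" "L m n k \<inter> L n m k' = {}"
    if "distinct [p, q, m, n, o']" "k < 2" "k' < 2" "k \<noteq> k'" for m n o' k k'
    using graph_lines_skew_other_root[OF that] unfolding L_def by simp_all
  have meet: "L m n k \<inter> L m o' k \<noteq> {}" "L m n k \<inter> L o' n k \<noteq> {}" "L m n k \<inter> L n m k \<noteq> {}"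
    if "distinct [p, q, m, n, o']" "k < 2" for m n o' k
    using graph_lines_meet[OF that] unfolding L_def by simp_all
  have meet': "L m n k \<inter> L n o' k' \<noteq> {}" "L n o' k' \<inter> L m n k \<noteq> {}"
    if "distinct [p, q, m, n, o']" "k < 2" "k' < 2" "k \<noteq> k'" for m n o' k k'
    using graph_lines_meet_other_root[OF that] unfolding L_def by auto
  have k: "(0 :: nat) < 2" "(1 :: nat) < 2" "(0 :: nat) \<noteq> 1" "(1 :: nat) \<noteq> 0" by simp_all
  note facts = perms[THEN skew(1), OF k(1)] perms[THEN skew(1), OF k(2)]
    perms[THEN skew(2), OF k(1)] perms[THEN skew(2), OF k(2)]
    perms[THEN skew'(1), OF k(1,2,3)] perms[THEN skew'(1), OF k(2,1,4)]
    perms[THEN skew'(2), OF k(1,2,3)] perms[THEN skew'(2), OF k(2,1,4)]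
    perms[THEN skew'(3), OF k(1,2,3)] perms[THEN skew'(3), OF k(2,1,4)]
    perms[THEN skew'(4), OF k(1,2,3)] perms[THEN skew'(4), OF k(2,1,4)]
    perms[THEN meet(1), OF k(1)] perms[THEN meet(1), OF k(2)]
    perms[THEN meet(2), OF k(1)] perms[THEN meet(2), OF k(2)]
    perms[THEN meet(3), OF k(1)] perms[THEN meet(3), OF k(2)]
    perms[THEN meet'(1), OF k(1,2,3)] perms[THEN meet'(1), OF k(2,1,4)]
    perms[THEN meet'(2), OF k(1,2,3)] perms[THEN meet'(2), OF k(2,1,4)]
  have conf: "\<forall>i\<in>{1..6}. \<forall>j\<in>{1..6}. (i \<noteq> j \<longrightarrow> a i \<inter> a j = {} \<and> b i \<inter> b j = {}) \<and> (a i \<inter> b j \<noteq> {} \<longleftrightarrow> i \<noteq> j)"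
    unfolding I ball_simps av bv by (simp add: facts[simplified])
  show ?thesis unfolding double_six_def using card lines D conf by blast
qed


section \<open>The monodromy of the loop\<close>

theorem theorem1p1:
  fixes A :: vertex and hex :: "vertex list" and E :: "nat \<Rightarrow> edge" and D :: "point set set"
  assumes "A \<in> vertices"
    and "is_cycle 6 hex"
    and "set hex = {B \<in> vertices. B \<noteq> A \<and> \<not> adjacent A B}"
    and "E = cyclic_edge hex"
    and "D = {L_edge (E i) | i. True} \<union> {L_pent (Pen_through A (E (i + 3))) | i. True}"
  shows "(\<exists>\<epsilon>\<^sub>0>0. \<forall>\<epsilon> t\<^sub>0 t\<^sub>3. 0 < \<epsilon> \<and> \<epsilon> < \<epsilon>\<^sub>0 \<and> t\<^sub>0 < 0 \<and> 2 * pi < t\<^sub>3 \<longrightarrow>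
            (\<forall>i. g_action A \<epsilon> t\<^sub>0 t\<^sub>3 (L_edge (E i)) = L_pent (Pen_through A (E (i + 3))) \<and>
                 g_action A \<epsilon> t\<^sub>0 t\<^sub>3 (L_pent (Pen_through A (E (i + 3)))) = L_edge (E i)) \<and>
            (\<forall>l \<in> lines_on clebsch - D. g_action A \<epsilon> t\<^sub>0 t\<^sub>3 l = l)) \<and>
         D \<subseteq> lines_on clebsch \<and>
         double_six D \<and>
         card (lines_on clebsch - D) = 15"
proof -
  obtain p q x y z where d: "distinct [p, q, x, y, z]" and A: "A = {p, q}"
    and hex: "hex = [{p, x}, {q, y}, {p, z}, {q, x}, {p, y}, {q, z}]"
    using hexagon_normal_form[OF assms(1-3)] .
  have Em: "E i = cyclic_edge hex (i mod 6)" for i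
    by (simp add: assms(4) hex cyclic_edge_def mod_Suc_eq)
  have Ev: "E 0 = {{p, x}, {q, y}}" "E 1 = {{q, y}, {p, z}}" "E 2 = {{p, z}, {q, x}}"
    "E 3 = {{q, x}, {p, y}}" "E 4 = {{p, y}, {q, z}}" "E 5 = {{q, z}, {p, x}}"
    by (simp_all add: assms(4) hex cyclic_edge_def)
  have E3: "E (i + 3) = E ((i mod 6 + 3) mod 6)" for i
    unfolding Em[of "i + 3"] Em[of "(i mod 6 + 3) mod 6"] by (simp add: mod_add_left_eq)
  \<comment> \<open>The index \<open>a\<close> that does not occur in the edge is the remaining element of \<open>{x, y, z}\<close>.\<close>
  have opposite: "E i = {{p, b}, {q, c}} \<and> E (i + 3) = {{q, b}, {p, c}}"
    if "(i mod 6, b, c) \<in> {(0, x, y), (1, z, y), (2, z, x), (3, y, x), (4, y, z), (5, x, z)}" for i b c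
  proof -
    have "E i = E (i mod 6)" using Em[of i] Em[of "i mod 6"] by simp
    then show ?thesis using that unfolding E3
      by (elim insertE emptyE) (simp_all add: Ev[simplified] doubleton_eq_iff)
  qed
  have ends: "L_edge (E i) = clebsch_line p q (Graph a b 1) \<and>
      L_pent (Pen_through A (E (i + 3))) = clebsch_line p q (Graph a b 0)"
    if "(i mod 6, a, b, c) \<in> {(0, z, x, y), (1, x, z, y), (2, y, z, x), (3, z, y, x), (4, x, y, z), (5, y, x, z)}" for i a b c
  proof -
    have d': "distinct [p, q, a, b, c]" using that d by auto
    have "E i = {{p, b}, {q, c}} \<and> E (i + 3) = {{q, b}, {p, c}}" by (rule opposite) (use that in auto)
    then show ?thesis using L_edge_graph[OF d'] L_pent_graph[OF d'] Pen_through_eq[OF d'] A by simp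
  qed
  have lab: "\<exists>a b. a \<noteq> b \<and> a \<notin> {p, q} \<and> b \<notin> {p, q} \<and> L_edge (E i) = clebsch_line p q (Graph a b 1) \<and>
      L_pent (Pen_through A (E (i + 3))) = clebsch_line p q (Graph a b 0)" for i
  proof -
    have "i mod 6 \<in> {0, 1, 2, 3, 4, 5}" by auto
    then have "\<exists>a b c. (i mod 6, a, b, c) \<in>
        {(0, z, x, y), (1, x, z, y), (2, y, z, x), (3, z, y, x), (4, x, y, z), (5, y, x, z)}"
      by (elim insertE emptyE) simp_all
    then obtain a b c where
      m: "(i mod 6, a, b, c) \<in> {(0, z, x, y), (1, x, z, y), (2, y, z, x), (3, z, y, x), (4, x, y, z), (5, y, x, z)}"
      by (elim exE)
    then have "a \<noteq> b" "a \<notin> {p, q}" "b \<notin> {p, q}" using d by auto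
    then show ?thesis using ends[OF m] by blast
  qed
  have D: "D = clebsch_line p q ` pair_labels p q"
  proof (intro equalityI subsetI)
    fix l assume "l \<in> D"
    then obtain i where i: "l = L_edge (E i) \<or> l = L_pent (Pen_through A (E (i + 3)))" using assms(5) by blast
    obtain a b where "a \<noteq> b" "a \<notin> {p, q}" "b \<notin> {p, q}" "l = clebsch_line p q (Graph a b 1) \<or> l = clebsch_line p q (Graph a b 0)"
      using lab[of i] i by metis
    moreover have "Graph a b 0 \<in> pair_labels p q" "Graph a b 1 \<in> pair_labels p q"
      using calculation by (auto simp: pair_labels_def)
    ultimately show "l \<in> clebsch_line p q ` pair_labels p q" by blast
  next
    fix l assume "l \<in> clebsch_line p q ` pair_labels p q"
    then obtain a b k where l: "l = clebsch_line p q (Graph a b k)" "k < 2"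
      and ab: "(a, b) \<in> {(x, y), (x, z), (y, x), (y, z), (z, x), (z, y)}"
      unfolding pair_labels_eq[OF d] by auto
    from ab obtain i :: nat and c where "(i mod 6, a, b, c) \<in> {(0, z, x, y), (1, x, z, y), (2, y, z, x), (3, z, y, x), (4, x, y, z), (5, y, x, z)}"
    proof (elim insertE emptyE)
      assume "(a, b) = (x, y)" then show ?thesis using that[of 4 z] by simp
    next
      assume "(a, b) = (x, z)" then show ?thesis using that[of 1 y] by simp
    next
      assume "(a, b) = (y, x)" then show ?thesis using that[of 5 z] by simp
    next
      assume "(a, b) = (y, z)" then show ?thesis using that[of 2 x] by simp
    next
      assume "(a, b) = (z, x)" then show ?thesis using that[of 0 y] by simp
    next
      assume "(a, b) = (z, y)" then show ?thesis using that[of 3 x] by simp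
    qed
    from ends[OF this] have "l = L_edge (E i) \<or> l = L_pent (Pen_through A (E (i + 3)))"
      using l less_2_cases[of k] by auto
    then show "l \<in> D" using assms(5) by blast
  qed
  have sub: "pair_labels p q \<subseteq> labels p q" by (fastforce simp: pair_labels_def labels_def)
  note lines = lines_on_clebsch[OF d]
  have diff: "lines_on clebsch - D = clebsch_line p q ` (labels p q - pair_labels p q)"
    unfolding D lines(1) using inj_on_image_set_diff[OF lines(2) _ sub] by blast
  have "\<forall>i. g_action A \<epsilon> t\<^sub>0 t\<^sub>3 (L_edge (E i)) = L_pent (Pen_through A (E (i + 3))) \<and>
       g_action A \<epsilon> t\<^sub>0 t\<^sub>3 (L_pent (Pen_through A (E (i + 3)))) = L_edge (E i)"
    and "\<forall>l \<in> lines_on clebsch - D. g_action A \<epsilon> t\<^sub>0 t\<^sub>3 l = l"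
    if e: "0 < \<epsilon>" "\<epsilon> < 1 / 27" "t\<^sub>0 < 0" "2 * pi < t\<^sub>3" for \<epsilon> t\<^sub>0 t\<^sub>3
  proof -
    note act = g_action_clebsch_line[OF d _ e, folded A]
    show "\<forall>i. g_action A \<epsilon> t\<^sub>0 t\<^sub>3 (L_edge (E i)) = L_pent (Pen_through A (E (i + 3))) \<and>
       g_action A \<epsilon> t\<^sub>0 t\<^sub>3 (L_pent (Pen_through A (E (i + 3)))) = L_edge (E i)"
    proof
      fix i
      obtain a b where ab: "a \<noteq> b" "a \<notin> {p, q}" "b \<notin> {p, q}" and l: "L_edge (E i) = clebsch_line p q (Graph a b 1)"
        "L_pent (Pen_through A (E (i + 3))) = clebsch_line p q (Graph a b 0)"
        using lab[of i] by blast
      have "Graph a b 0 \<in> labels p q" "Graph a b 1 \<in> labels p q" using ab by (auto simp: labels_def)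
      then show "g_action A \<epsilon> t\<^sub>0 t\<^sub>3 (L_edge (E i)) = L_pent (Pen_through A (E (i + 3))) \<and>
          g_action A \<epsilon> t\<^sub>0 t\<^sub>3 (L_pent (Pen_through A (E (i + 3)))) = L_edge (E i)"
        unfolding l using act by (simp add: swap01_def)
    qed
    show "\<forall>l \<in> lines_on clebsch - D. g_action A \<epsilon> t\<^sub>0 t\<^sub>3 l = l"
    proof
      fix l assume "l \<in> lines_on clebsch - D"
      then obtain m where m: "m \<in> labels p q" "m \<notin> pair_labels p q" "l = clebsch_line p q m"
        unfolding diff by blast
      have "swap_label m = m"
      proof (cases m)
        case (Graph a b k)
        then have "\<not> k < 2" using m by (auto simp: labels_def pair_labels_def)
        then show ?thesis using Graph by (auto simp: swap01_def)
      qed simp_all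
      then show "g_action A \<epsilon> t\<^sub>0 t\<^sub>3 l = l" using act[OF m(1)] m(3) by simp
    qed
  qed
  then have "\<exists>\<epsilon>\<^sub>0>0. \<forall>\<epsilon> t\<^sub>0 t\<^sub>3. 0 < \<epsilon> \<and> \<epsilon> < \<epsilon>\<^sub>0 \<and> t\<^sub>0 < 0 \<and> 2 * pi < t\<^sub>3 \<longrightarrow>
            (\<forall>i. g_action A \<epsilon> t\<^sub>0 t\<^sub>3 (L_edge (E i)) = L_pent (Pen_through A (E (i + 3))) \<and>
                 g_action A \<epsilon> t\<^sub>0 t\<^sub>3 (L_pent (Pen_through A (E (i + 3)))) = L_edge (E i)) \<and>
            (\<forall>l \<in> lines_on clebsch - D. g_action A \<epsilon> t\<^sub>0 t\<^sub>3 l = l)"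
    by (intro exI[of _ "1 / 27"]) auto
  moreover have "D \<subseteq> lines_on clebsch" unfolding D lines(1) using sub by blast
  moreover have ds: "double_six D" unfolding D by (rule pair_labels_double_six[OF d])
  moreover have "card (lines_on clebsch - D) = 15"
  proof -
    have fin: "finite (lines_on clebsch)" "card (lines_on clebsch) = 27"
      unfolding lines(1) using card_labels[OF d] card_image[OF lines(2)] by simp_all
    have "card D = 12" using ds by (simp add: double_six_def)
    then show ?thesis
      using card_Diff_subset[of D "lines_on clebsch"] \<open>D \<subseteq> lines_on clebsch\<close> fin finite_subset by fastforce
  qed
  ultimately show ?thesis by blast
qed

end
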